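(* Let $d>0$ be a fundamental discriminant such that there exists a cubic field of discriminant $d$, and let $\mathcal{C}_d$ be the set of isomorphism classes of cubic fields of discriminant $d$. Let $\mathcal{P}_3(\mathrm{Cl}_{\mathbb{Q}(\sqrt{-3d})})$ be the set of subgroups of order $3$ of the class group of $\mathbb{Q}(\sqrt{-3d})$. Then the map $$\Theta_d:\mathcal{C}_d\to\mathcal{P}_3(\mathrm{Cl}_{\mathbb{Q}(\sqrt{-3d})}),\qquad K\mapsto\langle g_K^2\rangle$$ is well defined and injective.
   Context: A fundamental discriminant is the discriminant of a quadratic field. For a number field $K$, $O_K^0=\{x\in O_K:\mathrm{tr}_{K/\mathbb{Q}}(x)=0\}$ and $q_K(x)=\mathrm{tr}_{K/\mathbb{Q}}(x^2)$ on $O_K^0$. Let $n_d=\gcd(3,d)$. For $K\in\mathcal{C}_d$, the form $\frac{1}{2n_d}q_K$, written in a $\mathbb{Z}$-basis of $O_K^0$, is a primitive integral binary quadratic form of discriminant $-3d/n_d^2$; $g_K$ denotes its $\mathrm{SL}_2(\mathbb{Z})$-class, viewed as an element of the class group of $\mathbb{Q}(\sqrt{-3d})$ (identified, via Gauss composition, with $\mathrm{SL}_2(\mathbb{Z})$-classes of primitive forms of discriminant $-3d/n_d^2$, the discriminant of the maximal order). Changing the orientation of the basis replaces $g_K$ by $g_K^{-1}$, so $\langle g_K^2\rangle$ does not depend on the choice of basis. *)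

theory Defs
  imports
    Complex_Main
    "HOL-Algebra.Algebra"
    "HOL-Algebra.Algebraic_Closure_Type"
    "Jordan_Normal_Form.Determinant"
begin

section \<open>Number fields inside the complex numbers\<close>

text \<open>A number field is represented by a subfield of \<open>\<complex>\<close>. Every number field embeds into \<open>\<complex>\<close>,
  so the isomorphism classes of cubic subfields of \<open>\<complex>\<close> are all the isomorphism classes of cubic
  fields.\<close>

abbreviation complex_ring :: "complex ring"
  where "complex_ring \<equiv> ring_of_type_algebra"

global_interpretation rat_space: Vector_Spaces.vector_space "\<lambda>(q::rat) (x::complex). of_rat q * x"
  by unfold_locales (simp_all add: algebra_simps of_rat_add of_rat_mult)

global_interpretation int_module: Modules.module "\<lambda>(n::int) (x::complex). of_int n * x"
  by unfold_locales (simp_all add: algebra_simps)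

definition field_of_degree :: "nat \<Rightarrow> complex set \<Rightarrow> bool"
  where "field_of_degree n K \<longleftrightarrow> n > 0 \<and> subfield K complex_ring \<and> rat_space.dim K = n"

text \<open>\<^const>\<open>Vector_Spaces.vector_space.dim\<close> is \<open>0\<close> on infinite-dimensional spaces, so
  positive dimension includes finiteness of the extension.\<close>

definition isomorphic_fields :: "complex set \<Rightarrow> complex set \<Rightarrow> bool"
  where "isomorphic_fields K L \<longleftrightarrow>
    complex_ring\<lparr>carrier := K\<rparr> \<simeq> complex_ring\<lparr>carrier := L\<rparr>"

text \<open>The trace of multiplication by \<open>x\<close> on the rational vector space \<open>K\<close>.\<close>

definition field_trace :: "complex set \<Rightarrow> complex \<Rightarrow> rat"
  where "field_trace K x =
    (let B = (SOME B. rat_space.independent B \<and> rat_space.span B = K)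
     in \<Sum>b\<in>B. rat_space.representation B (x * b) b)"

definition ring_of_integers :: "complex set \<Rightarrow> complex set"
  where "ring_of_integers K = {x \<in> K. algebraic_int x}"

definition Z_basis :: "complex list \<Rightarrow> complex set \<Rightarrow> bool"
  where "Z_basis bs M \<longleftrightarrow>
    distinct bs \<and> int_module.independent (set bs) \<and> int_module.span (set bs) = M"

definition field_discriminant :: "complex set \<Rightarrow> int"
  where "field_discriminant K =
    (THE D. \<exists>bs. Z_basis bs (ring_of_integers K) \<and>
       of_int D = det (mat (length bs) (length bs) (\<lambda>(i, j). field_trace K (bs ! i * bs ! j))))"

definition fundamental_discriminant :: "int \<Rightarrow> bool"
  where "fundamental_discriminant d \<longleftrightarrow> (\<exists>F. field_of_degree 2 F \<and> field_discriminant F = d)"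

definition cubic_fields :: "int \<Rightarrow> complex set set"
  where "cubic_fields d = {K. field_of_degree 3 K \<and> field_discriminant K = d}"

definition cubic_field_classes :: "int \<Rightarrow> complex set set set"
  where "cubic_field_classes d =
    cubic_fields d // {(K, L). K \<in> cubic_fields d \<and> L \<in> cubic_fields d \<and> isomorphic_fields K L}"

definition quadratic_field :: "int \<Rightarrow> complex set"
  where "quadratic_field m = generate_field complex_ring {csqrt (of_int m)}"


section \<open>The ideal class group\<close>

definition fractional_ideals :: "complex set \<Rightarrow> complex set set"
  where "fractional_ideals F =
    {I. I \<subseteq> F \<and> int_module.span I = I \<and> I \<noteq> {0} \<and>
        (\<forall>r\<in>ring_of_integers F. \<forall>x\<in>I. r * x \<in> I) \<and>
        (\<exists>c\<in>ring_of_integers F. c \<noteq> 0 \<and> (\<forall>x\<in>I. c * x \<in> ring_of_integers F))}"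

definition fractional_ideal_group :: "complex set \<Rightarrow> complex set monoid"
  where "fractional_ideal_group F =
    \<lparr>carrier = fractional_ideals F,
     monoid.mult = (\<lambda>I J. int_module.span {x * y | x y. x \<in> I \<and> y \<in> J}),
     one = ring_of_integers F\<rparr>"

definition principal_ideals :: "complex set \<Rightarrow> complex set set"
  where "principal_ideals F = {(*) x ` ring_of_integers F | x. x \<in> F \<and> x \<noteq> 0}"

definition class_group :: "complex set \<Rightarrow> complex set set monoid"
  where "class_group F = fractional_ideal_group F Mod principal_ideals F"

definition ideal_class :: "complex set \<Rightarrow> complex set \<Rightarrow> complex set set"
  where "ideal_class F I = principal_ideals F #>\<^bsub>fractional_ideal_group F\<^esub> I"

definition order3_subgroups :: "('a, 'b) monoid_scheme \<Rightarrow> 'a set set"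
  where "order3_subgroups G = {H. subgroup H G \<and> card H = 3}"


section \<open>Binary quadratic forms\<close>

text \<open>The triple \<open>(a, b, c)\<close> stands for the form \<open>a x\<^sup>2 + b x y + c y\<^sup>2\<close>.\<close>

type_synonym form = "int \<times> int \<times> int"

fun form_eval :: "form \<Rightarrow> int \<Rightarrow> int \<Rightarrow> int"
  where "form_eval (a, b, c) x y = a * x\<^sup>2 + b * x * y + c * y\<^sup>2"

fun form_disc :: "form \<Rightarrow> int"
  where "form_disc (a, b, c) = b\<^sup>2 - 4 * a * c"

fun primitive_form :: "form \<Rightarrow> bool"
  where "primitive_form (a, b, c) \<longleftrightarrow> Gcd {a, b, c} = 1"

definition SL2_class :: "form \<Rightarrow> form set"
  where "SL2_class f =
    {g. \<exists>p q r s. p * s - q * r = 1 \<and>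
        (\<forall>x y. form_eval g x y = form_eval f (p * x + q * y) (r * x + s * y))}"

text \<open>The lattice attached to a form by the classical correspondence, for \<open>a > 0\<close> and negative
  discriminant. It induces the group isomorphism from classes of primitive positive definite
  forms, under Gauss composition, to ideal classes. Taking the conjugate lattice instead would
  replace each class by its inverse.\<close>

fun form_ideal :: "form \<Rightarrow> complex set"
  where "form_ideal (a, b, c) =
    int_module.span {of_int a, (- of_int b + csqrt (of_int (form_disc (a, b, c)))) / 2}"

definition gauss_class :: "complex set \<Rightarrow> form set \<Rightarrow> complex set set"
  where "gauss_class F C = the_elem ((\<lambda>f. ideal_class F (form_ideal f)) ` C)"


section \<open>The trace form and the map \<open>\<Theta>\<^sub>d\<close>\<close>

definition trace_zero_integers :: "complex set \<Rightarrow> complex set"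
  where "trace_zero_integers K = {x \<in> ring_of_integers K. field_trace K x = 0}"

definition trace_form :: "complex set \<Rightarrow> complex \<Rightarrow> rat"
  where "trace_form K x = field_trace K (x\<^sup>2)"

text \<open>\<open>f\<close> is the form \<open>q\<^sub>K / (2 n\<^sub>d)\<close> written in the \<open>\<int>\<close>-basis \<open>\<beta>, \<gamma>\<close> of the
  trace-zero integers.\<close>

definition is_scaled_trace_form :: "int \<Rightarrow> complex set \<Rightarrow> complex \<Rightarrow> complex \<Rightarrow> form \<Rightarrow> bool"
  where "is_scaled_trace_form d K \<beta> \<gamma> f \<longleftrightarrow>
    (\<forall>x y. of_int (form_eval f x y) =
       trace_form K (of_int x * \<beta> + of_int y * \<gamma>) / (2 * of_int (gcd 3 d)))"

text \<open>The possible values of \<open>g\<^sub>K\<close>, over all ordered \<open>\<int>\<close>-bases of the trace-zero integers.\<close>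

definition g_classes :: "int \<Rightarrow> complex set \<Rightarrow> form set set"
  where "g_classes d K =
    {SL2_class f | f \<beta> \<gamma>. Z_basis [\<beta>, \<gamma>] (trace_zero_integers K) \<and>
       is_scaled_trace_form d K \<beta> \<gamma> f}"

definition square_subgroup :: "int \<Rightarrow> form set \<Rightarrow> complex set set set"
  where "square_subgroup d g =
    (let F = quadratic_field (- 3 * d); G = class_group F
     in generate G {gauss_class F g [^]\<^bsub>G\<^esub> (2::nat)})"

definition Theta_values :: "int \<Rightarrow> complex set set \<Rightarrow> complex set set set set"
  where "Theta_values d C = (\<Union>K\<in>C. square_subgroup d ` g_classes d K)"

definition Theta :: "int \<Rightarrow> complex set set \<Rightarrow> complex set set set"
  where "Theta d C = the_elem (Theta_values d C)"

end

theory Submission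
  imports Defs "Jordan_Normal_Form.Char_Poly"
begin

text \<open>Let \<open>n = gcd 3 d\<close>, \<open>D = - 3 d / n\<^sup>2\<close> and let \<open>\<omega>\<close> be a primitive cube root of unity. Since \<open>d > 0\<close>,
  a cubic field \<open>K\<close> of discriminant \<open>d\<close> has three real embeddings \<open>\<sigma>\<^sub>1, \<sigma>\<^sub>2, \<sigma>\<^sub>3\<close>. The Lagrange
  resolvent \<open>\<rho> x = \<sigma>\<^sub>1 x + \<omega> \<sigma>\<^sub>2 x + \<omega>\<^sup>2 \<sigma>\<^sub>3 x\<close> satisfies \<open>\<bar>\<rho> x\<bar>\<^sup>2 = 3/2 tr (x\<^sup>2)\<close> on the trace-zero
  integers, so it maps them onto a lattice \<open>\<Lambda>\<close> that is a complex multiple of an ideal in the class of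
  \<open>g\<^sub>K\<close> or its inverse. Because \<open>2 Re (\<rho> x \<rho> y \<rho> z) = 9 tr (x y z)\<close>, all products of three elements
  of \<open>\<Lambda>\<close> lie in \<open>3 n P\<close> for a fixed ideal \<open>P\<close> with \<open>P\<^sup>2\<close> principal, and comparing norms gives
  \<open>\<Lambda>\<^sup>3 = 3 n P\<close>. Hence the class of \<open>\<Lambda>\<close> cubes to \<open>[P]\<close>, so its square has order dividing \<open>3\<close>. If the
  square were trivial, then \<open>\<Lambda> = \<zeta> P\<close> with \<open>\<zeta>\<^sup>3 = 1\<close>, and \<open>3 \<in> P\<close> would be the resolvent of an element
  with a conjugate equal to \<open>2\<close>, which does not have trace zero. If two fields give the same subgroup,
  then their lattices agree up to conjugation and a cube root of unity; since \<open>3 \<sigma>\<^sub>1 x = 2 Re (\<rho> x)\<close>,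
  and similarly for the other embeddings, some real embeddings of the two fields have the same image.\<close>

text \<open>The ideal P is the conjugation-stable ideal of norm \<open>3 * n\<close>; its square is
  (3 n), so its class has order at most 2. This is the reason for the square in \<Theta>: the class
  x of \<Lambda> satisfies x^3 = [P], which need not be trivial, whereas x^2 has trivial cube.
  Nothing is lost, because x = [P] (x^2)^(-1) is recovered from x^2. The remaining obstacle is a
  unit: equal cubes determine the factor between two lattices only up to the cube root of a unit.
  For \<open>D \<noteq> - 3\<close> every unit has order dividing 4, hence is the cube of a unit,
  and the factor can be corrected to a cube root of unity; \<open>D = - 3\<close> would mean
  \<open>d = 1\<close>. Cube roots of unity are harmless, since they only permute the conjugates. No
  Galois closure is formed: embeddings are substitutions of complex roots for a generator, written
  in coordinates of a power basis, and \<Lambda> is a lattice in \<complex> tied to ideals only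
  through a complex factor.\<close>

declare int_module.scale_scale [simp del] rat_space.scale_scale [simp del]
  \<comment> \<open>as rewrite rules they loop with \<open>of_int_mult\<close> and \<open>of_rat_mult\<close>\<close>

section \<open>Subfields and algebraic integers\<close>

text \<open>Determinant trick: multiplication by \<open>z\<close> on the generators is an integer
  matrix with eigenvalue \<open>z\<close>, so its characteristic polynomial is a monic integer
  equation for \<open>z\<close>. The nonzero \<open>v0\<close> keeps the eigenvector from
  vanishing.\<close>

lemma algebraic_int_if_stable_span:
  assumes S: "finite S" "v0 \<in> S" "v0 \<noteq> 0"
    and stable: "\<And>v. v \<in> S \<Longrightarrow> z * v \<in> int_module.span S"
  shows "algebraic_int z"
proof -
  obtain vs where vs: "set vs = S" "distinct vs"
    using finite_distinct_list S(1) by blast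
  define n where "n = length vs"
  have "\<exists>u. z * v = (\<Sum>w\<in>S. of_int (u w) * w)" if "v \<in> S" for v
    using stable[OF that] int_module.span_finite[OF S(1)] by auto
  then obtain u where u: "\<And>v. v \<in> S \<Longrightarrow> z * v = (\<Sum>w\<in>S. of_int (u v w) * w)"
    by metis
  define A where "A = mat n n (\<lambda>(i, j). u (vs ! i) (vs ! j))"
  define v where "v = vec n (\<lambda>i. vs ! i)"
  have bij: "bij_betw (\<lambda>j. vs ! j) {..<n} S"
    using bij_betw_nth[OF vs(2)] vs n_def by simp
  have A: "A \<in> carrier_mat n n" by (simp add: A_def)
  have A': "map_mat of_int A \<in> carrier_mat n n" using A by simp
  have "map_mat of_int A *\<^sub>v v = z \<cdot>\<^sub>v v"
  proof (rule eq_vecI)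
    fix i assume "i < dim_vec (z \<cdot>\<^sub>v v)"
    then have i: "i < n" by (simp add: v_def)
    then have "vs ! i \<in> S" using bij bij_betwE by fastforce
    have "(map_mat of_int A *\<^sub>v v) $ i = (\<Sum>j = 0..<n. of_int (u (vs ! i) (vs ! j)) * vs ! j)"
      using i by (simp add: A_def v_def scalar_prod_def)
    also have "\<dots> = (\<Sum>w\<in>S. of_int (u (vs ! i) w) * w)"
      using sum.reindex_bij_betw[OF bij, of "\<lambda>w. of_int (u (vs ! i) w) * w"]
      by (simp add: atLeast0LessThan)
    also have "\<dots> = z * vs ! i" using u \<open>vs ! i \<in> S\<close> by simp
    finally show "(map_mat of_int A *\<^sub>v v) $ i = (z \<cdot>\<^sub>v v) $ i" using i by (simp add: v_def)
  qed (simp add: A_def v_def)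
  moreover have "v \<noteq> 0\<^sub>v n"
  proof
    assume *: "v = 0\<^sub>v n"
    obtain i where "i < n" "vs ! i = v0" using S(2) vs n_def by (metis in_set_conv_nth)
    then show False using * S(3) by (metis index_vec index_zero_vec(1) v_def)
  qed
  ultimately have "eigenvalue (map_mat of_int A) z"
    using A' unfolding eigenvalue_def eigenvector_def v_def by (intro exI[of _ "vec n ((!) vs)"]) auto
  then have root: "poly (char_poly (map_mat of_int A)) z = 0"
    using eigenvalue_root_char_poly[OF A'] by blast
  have "char_poly (map_mat of_int A) = map_poly (of_int :: int \<Rightarrow> complex) (char_poly A)"
    using of_int_hom.char_poly_hom[OF A] by simp
  moreover have "lead_coeff (char_poly A) = 1"
    using degree_monic_char_poly[OF A] by simp
  ultimately show ?thesis
    unfolding algebraic_int_altdef_ipoly using root by metis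
qed

lemma zspan_mult_mem:
  assumes "x \<in> int_module.span S" "\<And>v. v \<in> S \<Longrightarrow> z * v \<in> int_module.span T"
  shows "z * x \<in> int_module.span T"
  using assms(1)
proof (induction rule: int_module.span_induct_alt)
  case base then show ?case by (simp add: int_module.span_zero)
next
  case (step c x y)
  have "z * (of_int c * x + y) = of_int c * (z * x) + z * y" by (simp add: algebra_simps)
  then show ?case using step assms(2) by (simp add: int_module.span_add int_module.span_scale)
qed

lemma algebraic_int_power_span:
  fixes x :: complex
  assumes "algebraic_int x"
  obtains n where "n > 0" "x ^ n \<in> int_module.span {x ^ i | i. i < n}"
proof -
  obtain p :: "int poly" where p: "poly (map_poly of_int p) x = 0" "lead_coeff p = 1"
    using assms algebraic_int_altdef_ipoly by blast
  define n where "n = degree p"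
  have n: "n > 0"
  proof (rule ccontr)
    assume "\<not> n > 0"
    then have "p = 1" using p(2) by (metis n_def degree_0_id gr0I of_nat_1 one_pCons)
    then show False using p by simp
  qed
  have "degree (map_poly of_int p :: complex poly) = n" by (simp add: n_def)
  then have "0 = (\<Sum>i\<le>n. of_int (coeff p i) * x ^ i)"
    using p(1) by (simp add: poly_altdef coeff_map_poly)
  also have "\<dots> = (\<Sum>i<n. of_int (coeff p i) * x ^ i) + x ^ n"
    using p(2) by (simp add: n_def lessThan_Suc_atMost[symmetric])
  finally have "x ^ n = - (\<Sum>i<n. of_int (coeff p i) * x ^ i)"
    by (simp add: add_eq_0_iff)
  also have "\<dots> \<in> int_module.span {x ^ i | i. i < n}"
    by (intro int_module.span_neg int_module.span_sum int_module.span_scale int_module.span_base) auto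
  finally show ?thesis using n that by blast
qed

text \<open>The lattice spanned by the products \<open>x ^ i * y ^ j\<close>, with exponents below
  the degrees of two monic equations, is stable under \<open>x\<close> and under \<open>y\<close>,
  hence under their sum and product. It contains 1, so the determinant trick applies.\<close>

lemma
  fixes x y :: complex
  assumes "algebraic_int x" "algebraic_int y"
  shows algebraic_int_plus: "algebraic_int (x + y)"
    and algebraic_int_times: "algebraic_int (x * y)"
proof -
  obtain m where m: "m > 0" "x ^ m \<in> int_module.span {x ^ i | i. i < m}"
    using algebraic_int_power_span assms by blast
  obtain n where n: "n > 0" "y ^ n \<in> int_module.span {y ^ i | i. i < n}"
    using algebraic_int_power_span assms by blast
  define S where "S = (\<lambda>(i, j). x ^ i * y ^ j) ` ({..<m} \<times> {..<n})"
  have mem: "x ^ i * y ^ j \<in> int_module.span S" if "i < m" "j < n" for i j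
    using that by (intro int_module.span_base) (auto simp: S_def)
  have x: "x * v \<in> int_module.span S" if v: "v \<in> S" for v
  proof -
    obtain i j where ij: "i < m" "j < n" "v = x ^ i * y ^ j" using v by (auto simp: S_def)
    show ?thesis
    proof (cases "Suc i < m")
      case True
      then show ?thesis using mem[OF True ij(2)] ij by (simp add: mult.assoc)
    next
      case False
      \<comment> \<open>At the boundary exponent the monic relation for \<open>x ^ m\<close> brings
        the product back into the lattice.\<close>
      then have "Suc i = m" using ij by simp
      then have "x * v = y ^ j * x ^ m" using ij by (auto simp: mult_ac)
      moreover have "y ^ j * x ^ m \<in> int_module.span S"
        by (rule zspan_mult_mem[OF m(2)]) (use mem ij in \<open>auto simp: mult.commute\<close>)
      ultimately show ?thesis by simp
    qed
  qed
  have y: "y * v \<in> int_module.span S" if v: "v \<in> S" for v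
  proof -
    obtain i j where ij: "i < m" "j < n" "v = x ^ i * y ^ j" using v by (auto simp: S_def)
    show ?thesis
    proof (cases "Suc j < n")
      case True
      then show ?thesis using mem[OF ij(1) True] ij by (simp add: mult_ac)
    next
      case False
      then have "Suc j = n" using ij by simp
      then have "y * v = x ^ i * y ^ n" using ij by (auto simp: mult_ac)
      moreover have "x ^ i * y ^ n \<in> int_module.span S"
        by (rule zspan_mult_mem[OF n(2)]) (use mem ij in auto)
      ultimately show ?thesis by simp
    qed
  qed
  have fin: "finite S" by (simp add: S_def)
  have one: "1 \<in> S"
    unfolding S_def using m n by (intro image_eqI[of _ _ "(0, 0)"]) auto
  show "algebraic_int (x + y)"
    by (rule algebraic_int_if_stable_span[OF fin one])
      (use x y in \<open>auto simp: distrib_right int_module.span_add\<close>)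
  show "algebraic_int (x * y)"
  proof (rule algebraic_int_if_stable_span[OF fin one])
    fix v assume "v \<in> S"
    then show "x * y * v \<in> int_module.span S"
      using zspan_mult_mem[OF y[OF \<open>v \<in> S\<close>], of x S] x by (simp add: mult.assoc)
  qed auto
qed

lemma algebraic_int_diff: "algebraic_int x \<Longrightarrow> algebraic_int y \<Longrightarrow> algebraic_int (x - y)"
  for x y :: complex
  using algebraic_int_plus[of x "- y"] by simp

lemma algebraic_int_quadratic:
  fixes x :: complex
  assumes "x ^ 2 + of_int b * x + of_int c = 0"
  shows "algebraic_int x"
  by (rule algebraic_int.intros[of "[:of_int c, of_int b, 1:]"])
    (use assms in \<open>auto simp: coeff_pCons algebra_simps power2_eq_square split: nat.split\<close>)

lemma algebraic_int_cubic:
  fixes x :: complex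
  assumes "x ^ 3 + of_int a * x ^ 2 + of_int b * x + of_int c = 0"
  shows "algebraic_int x"
  by (rule algebraic_int.intros[of "[:of_int c, of_int b, of_int a, 1:]"])
    (use assms in \<open>auto simp: coeff_pCons algebra_simps power2_eq_square power3_eq_cube split: nat.split\<close>)

lemma algebraic_int_of_rat_iff: "algebraic_int (of_rat q :: complex) \<longleftrightarrow> q \<in> \<int>"
proof
  assume "algebraic_int (of_rat q :: complex)"
  then have "(of_rat q :: complex) \<in> \<int>" by (rule rational_algebraic_int_is_int) simp
  then obtain k where "(of_rat q :: complex) = of_rat (of_int k)" by (auto elim!: Ints_cases)
  then have "q = of_int k" unfolding of_rat_eq_iff .
  then show "q \<in> \<int>" by simp
qed (auto elim!: Ints_cases intro: algebraic_int_of_int)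

text \<open>Closure conditions in the arithmetic of the type \<open>complex\<close>, so that the
  record-based \<open>subfield K complex_ring\<close> is met only at the borders of the development.
  Since \<open>inverse 0 = 0\<close>, the last clause can range over all of
  \<open>K\<close>.\<close>

definition is_subfield :: "complex set \<Rightarrow> bool"
  where "is_subfield K \<longleftrightarrow> 1 \<in> K \<and> (\<forall>x\<in>K. \<forall>y\<in>K. x + y \<in> K \<and> x * y \<in> K) \<and> (\<forall>x\<in>K. - x \<in> K \<and> inverse x \<in> K)"

lemma complex_ring_field: "field complex_ring"
  by (rule field_from_type_algebra)

lemma complex_ring_minus: "\<ominus>\<^bsub>complex_ring\<^esub> x = - x"
proof -
  interpret field complex_ring by (rule complex_ring_field)
  have "x \<oplus>\<^bsub>complex_ring\<^esub> (- x) = \<zero>\<^bsub>complex_ring\<^esub>" by (simp add: ring_of_type_algebra_def)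
  then show ?thesis by (intro minus_equality) (auto simp: ring_of_type_algebra_def)
qed

lemma complex_ring_inv: "x \<noteq> 0 \<Longrightarrow> inv\<^bsub>complex_ring\<^esub> x = inverse x"
proof -
  interpret field complex_ring by (rule complex_ring_field)
  assume "x \<noteq> 0"
  then show ?thesis
    by (intro comm_inv_char) (auto simp: ring_of_type_algebra_def)
qed

lemma subfield_imp_is_subfield:
  assumes "subfield K complex_ring"
  shows "is_subfield K"
proof -
  interpret field complex_ring by (rule complex_ring_field)
  have K: "subring K complex_ring" by (rule subfieldE(1)[OF assms])
  have 0: "0 \<in> K" using subringE(2)[OF K] by (simp add: ring_of_type_algebra_def)
  show ?thesis
    unfolding is_subfield_def
  proof (intro conjI ballI)
    show "1 \<in> K" using subringE(3)[OF K] by (simp add: ring_of_type_algebra_def)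
  next
    fix x y assume "x \<in> K" "y \<in> K"
    then show "x + y \<in> K" "x * y \<in> K"
      using subringE(6,7)[OF K, of x y] by (simp_all add: ring_of_type_algebra_def)
  next
    fix x assume x: "x \<in> K"
    then show "- x \<in> K" using subringE(5)[OF K] by (simp add: complex_ring_minus)
    show "inverse x \<in> K"
    proof (cases "x = 0")
      case False
      then show ?thesis using subfield_m_inv(1)[OF assms, of x] x
        by (simp add: complex_ring_inv) (simp add: ring_of_type_algebra_def)
    qed (use 0 in auto)
  qed
qed

lemma is_subfieldD:
  assumes "is_subfield K"
  shows "1 \<in> K" "x \<in> K \<Longrightarrow> y \<in> K \<Longrightarrow> x + y \<in> K" "x \<in> K \<Longrightarrow> y \<in> K \<Longrightarrow> x * y \<in> K"
    "x \<in> K \<Longrightarrow> - x \<in> K" "x \<in> K \<Longrightarrow> inverse x \<in> K" "0 \<in> K"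
    "x \<in> K \<Longrightarrow> y \<in> K \<Longrightarrow> x - y \<in> K" "x \<in> K \<Longrightarrow> y \<in> K \<Longrightarrow> x / y \<in> K"
    "of_nat n \<in> K" "of_int k \<in> K" "of_rat q \<in> K" "x \<in> K \<Longrightarrow> x ^ n \<in> K" "numeral w \<in> K"
proof -
  show 1: "1 \<in> K" and add: "x \<in> K \<Longrightarrow> y \<in> K \<Longrightarrow> x + y \<in> K"
    and mult: "x \<in> K \<Longrightarrow> y \<in> K \<Longrightarrow> x * y \<in> K"
    and neg: "x \<in> K \<Longrightarrow> - x \<in> K" and inv: "x \<in> K \<Longrightarrow> inverse x \<in> K" for x y
    using assms by (auto simp: is_subfield_def)
  have "1 + - 1 \<in> K" by (intro add neg 1)
  then show 0: "0 \<in> K" by simp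
  show diff: "x \<in> K \<Longrightarrow> y \<in> K \<Longrightarrow> x - y \<in> K" using add[of x "- y"] neg by simp
  show div: "x \<in> K \<Longrightarrow> y \<in> K \<Longrightarrow> x / y \<in> K" for x y
    using mult[of x "inverse y"] inv by (simp add: divide_inverse)
  show nat: "of_nat n \<in> K" for n by (induction n) (auto intro: 0 1 add)
  show int: "of_int k \<in> K" for k
    using nat neg by (cases k rule: int_cases2) auto
  show "of_rat q \<in> K"
    by (cases q) (auto simp: of_rat_rat intro!: div int)
  show "x \<in> K \<Longrightarrow> x ^ n \<in> K" by (induction n) (auto intro: 1 mult)
  show "numeral w \<in> K" using nat[of "numeral w"] by simp
qed

lemma is_subfield_imp_subfield:
  assumes "is_subfield K"
  shows "subfield K complex_ring"
proof -
  interpret field complex_ring by (rule complex_ring_field)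
  note K = is_subfieldD[OF assms]
  have "subcring K complex_ring"
  proof (intro subcringI' subringI)
    show "K \<subseteq> carrier complex_ring" "\<one>\<^bsub>complex_ring\<^esub> \<in> K"
      using K by (simp_all add: ring_of_type_algebra_def)
  next
    fix h1 h2 assume h: "h1 \<in> K" "h2 \<in> K"
    show "h1 \<otimes>\<^bsub>complex_ring\<^esub> h2 \<in> K" "h1 \<oplus>\<^bsub>complex_ring\<^esub> h2 \<in> K"
      using K(2,3)[OF h] by (simp_all add: ring_of_type_algebra_def)
  next
    fix h assume "h \<in> K" then show "\<ominus>\<^bsub>complex_ring\<^esub> h \<in> K" using K by (simp add: complex_ring_minus)
  qed
  then show ?thesis
  proof (rule subfieldI'[OF subcring.axioms(1)])
    fix k assume "k \<in> K - {\<zero>\<^bsub>complex_ring\<^esub>}"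
    then show "inv\<^bsub>complex_ring\<^esub> k \<in> K" using K(5)
      by (subst complex_ring_inv) (auto simp: ring_of_type_algebra_def)
  qed
qed

lemma is_subfield_rat_subspace: "is_subfield K \<Longrightarrow> rat_space.subspace K"
  by (rule rat_space.subspaceI) (auto intro: is_subfieldD)

text \<open>The values outside of \<open>K\<close> are irrelevant.\<close>

definition is_embedding :: "complex set \<Rightarrow> (complex \<Rightarrow> complex) \<Rightarrow> bool"
  where "is_embedding K \<sigma> \<longleftrightarrow> \<sigma> 1 = 1 \<and>
    (\<forall>x\<in>K. \<forall>y\<in>K. \<sigma> (x + y) = \<sigma> x + \<sigma> y \<and> \<sigma> (x * y) = \<sigma> x * \<sigma> y)"

context
  fixes K \<sigma>
  assumes K: "is_subfield K" and \<sigma>: "is_embedding K \<sigma>"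
begin

lemma embedding_simps:
  shows "\<sigma> 0 = 0" "\<sigma> 1 = 1"
    and "x \<in> K \<Longrightarrow> y \<in> K \<Longrightarrow> \<sigma> (x + y) = \<sigma> x + \<sigma> y"
    and "x \<in> K \<Longrightarrow> y \<in> K \<Longrightarrow> \<sigma> (x * y) = \<sigma> x * \<sigma> y"
    and "x \<in> K \<Longrightarrow> \<sigma> (- x) = - \<sigma> x"
    and "x \<in> K \<Longrightarrow> y \<in> K \<Longrightarrow> \<sigma> (x - y) = \<sigma> x - \<sigma> y"
    and "\<sigma> (of_nat n) = of_nat n" "\<sigma> (of_int k) = of_int k"
    and "\<sigma> (of_rat q) = of_rat q"
    and "x \<in> K \<Longrightarrow> \<sigma> (x ^ n) = \<sigma> x ^ n"
    and "\<sigma> (numeral w) = numeral w"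
proof -
  show 1: "\<sigma> 1 = 1" and add: "x \<in> K \<Longrightarrow> y \<in> K \<Longrightarrow> \<sigma> (x + y) = \<sigma> x + \<sigma> y"
    and mult: "x \<in> K \<Longrightarrow> y \<in> K \<Longrightarrow> \<sigma> (x * y) = \<sigma> x * \<sigma> y" for x y
    using \<sigma> by (auto simp: is_embedding_def)
  have "\<sigma> (0 + 0) = \<sigma> 0 + \<sigma> 0" by (intro add is_subfieldD[OF K])
  then show 0: "\<sigma> 0 = 0" by simp
  show neg: "\<sigma> (- x) = - \<sigma> x" if "x \<in> K" for x
    using add[of x "- x"] 0 is_subfieldD(4)[OF K that] that by (simp add: add_eq_0_iff)
  show "\<sigma> (x - y) = \<sigma> x - \<sigma> y" if "x \<in> K" "y \<in> K"
    using add[of x "- y"] neg[of y] is_subfieldD(4)[OF K that(2)] that by simp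
  show nat: "\<sigma> (of_nat n) = of_nat n" for n
    by (induction n) (auto simp: 0 1 add is_subfieldD[OF K])
  show int: "\<sigma> (of_int k) = of_int k" for k
    by (cases k rule: int_cases2) (auto simp: nat neg is_subfieldD[OF K])
  show "\<sigma> (of_rat q) = of_rat q"
  proof -
    obtain a b where q: "q = Rat.Fract a b" "b > 0" by (cases q) auto
    have *: "of_rat q * of_int b = (of_int a :: complex)"
      using q by (simp add: of_rat_rat)
    have "\<sigma> (of_rat q * of_int b) = \<sigma> (of_rat q) * of_int b"
      by (simp add: mult is_subfieldD[OF K] int)
    then have "\<sigma> (of_rat q) * of_int b = of_rat q * of_int b" by (simp add: * int)
    then show ?thesis using q(2) by simp
  qed
  show "\<sigma> (x ^ n) = \<sigma> x ^ n" if "x \<in> K"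
    using that by (induction n) (auto simp: 1 mult is_subfieldD[OF K])
  show "\<sigma> (numeral w) = numeral w" using nat[of "numeral w"] by simp
qed

lemma embedding_eq_iff: "x \<in> K \<Longrightarrow> y \<in> K \<Longrightarrow> \<sigma> x = \<sigma> y \<longleftrightarrow> x = y"
proof
  assume xy: "x \<in> K" "y \<in> K" "\<sigma> x = \<sigma> y"
  show "x = y"
  proof (rule ccontr)
    assume "x \<noteq> y"
    then have "\<sigma> ((x - y) * inverse (x - y)) = 1" by (simp add: embedding_simps)
    moreover have "\<sigma> ((x - y) * inverse (x - y)) = (\<sigma> x - \<sigma> y) * \<sigma> (inverse (x - y))"
      using xy(1,2) by (simp add: embedding_simps is_subfieldD[OF K])
    ultimately show False using xy(3) by simp
  qed
qed auto

lemma embedding_algebraic_int: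
  assumes "x \<in> K" "algebraic_int x"
  shows "algebraic_int (\<sigma> x)"
proof -
  obtain p where p: "poly (map_poly of_int p) x = 0" "lead_coeff p = 1"
    using assms(2) algebraic_int_altdef_ipoly by blast
  have mem: "poly (map_poly of_int p) x \<in> K" for p
    by (induction p) (use assms(1) in \<open>auto simp: map_poly_pCons is_subfieldD[OF K]\<close>)
  then have eq: "\<sigma> (poly (map_poly of_int p) x) = poly (map_poly of_int p) (\<sigma> x)" for p
    by (induction p)
      (use assms(1) in \<open>auto simp: map_poly_pCons embedding_simps is_subfieldD[OF K]\<close>)
  show ?thesis
    unfolding algebraic_int_altdef_ipoly using eq[of p] p by (auto simp: embedding_simps)
qed

end

lemma ring_of_integers_closed:
  assumes K: "is_subfield K"
  shows "x \<in> ring_of_integers K \<Longrightarrow> y \<in> ring_of_integers K \<Longrightarrow> x + y \<in> ring_of_integers K"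
    and "x \<in> ring_of_integers K \<Longrightarrow> y \<in> ring_of_integers K \<Longrightarrow> x * y \<in> ring_of_integers K"
    and "x \<in> ring_of_integers K \<Longrightarrow> y \<in> ring_of_integers K \<Longrightarrow> x - y \<in> ring_of_integers K"
    and "of_int k \<in> ring_of_integers K" "1 \<in> ring_of_integers K" "0 \<in> ring_of_integers K"
  by (auto simp: ring_of_integers_def is_subfieldD[OF K] algebraic_int_plus algebraic_int_times
      algebraic_int_diff algebraic_int_of_int intro: int_imp_algebraic_int)

section \<open>Traces and bases\<close>

lemma representation_of_rat_sum:
  assumes "rat_space.independent B" "\<And>i. i \<in> I \<Longrightarrow> g i \<in> rat_space.span B"
  shows "rat_space.representation B (\<Sum>i\<in>I. of_rat (u i) * g i) c
    = (\<Sum>i\<in>I. u i * rat_space.representation B (g i) c)"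
  using assms
  by (subst rat_space.representation_sum)
    (auto simp: rat_space.representation_scale rat_space.span_scale)

text \<open>Needed because \<open>field_trace\<close> is evaluated in a basis picked by
  \<open>SOME\<close>. It is the invariance of the trace under conjugation: expanding each
  \<open>c\<close> in \<open>B\<close> and going back to \<open>C\<close>, the two coordinate
  changes cancel.\<close>

lemma trace_basis_independent:
  assumes B: "rat_space.independent B" "finite B" and C: "rat_space.independent C" "finite C"
    and span: "rat_space.span B = K" "rat_space.span C = K"
    and stable: "\<And>y. y \<in> K \<Longrightarrow> x * y \<in> K"
  shows "(\<Sum>b\<in>B. rat_space.representation B (x * b) b)
    = (\<Sum>c\<in>C. rat_space.representation C (x * c) c)"
proof -
  let ?r = "rat_space.representation B" and ?s = "rat_space.representation C"
  have BK: "b \<in> K" if "b \<in> B" for b using rat_space.span_base[OF that] span by simp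
  have CK: "c \<in> K" if "c \<in> C" for c using rat_space.span_base[OF that] span by simp
  have sB: "(\<Sum>b\<in>B. of_rat (?r v b) * b) = v" if "v \<in> K" for v
    using rat_space.sum_representation_eq[OF B(1) _ B(2) subset_refl] that span by simp
  have sC: "(\<Sum>c\<in>C. of_rat (?s v c) * c) = v" if "v \<in> K" for v
    using rat_space.sum_representation_eq[OF C(1) _ C(2) subset_refl] that span by simp
  have 1: "?s (x * c) c = (\<Sum>b\<in>B. \<Sum>e\<in>B. ?r (x * b) e * (?s e c * ?r c b))" if c: "c \<in> C" for c
  proof -
    have "x * c = (\<Sum>b\<in>B. of_rat (?r c b) * (x * b))"
      by (subst sB[OF CK[OF c], symmetric]) (simp add: sum_distrib_left mult_ac)
    then have "?s (x * c) c = (\<Sum>b\<in>B. ?r c b * ?s (x * b) c)"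
      using representation_of_rat_sum[OF C(1), of B "\<lambda>b. x * b" "?r c" c] BK stable span
      by simp
    also have "\<dots> = (\<Sum>b\<in>B. ?r c b * (\<Sum>e\<in>B. ?r (x * b) e * ?s e c))"
    proof (rule sum.cong)
      fix b assume "b \<in> B"
      have "?s (x * b) c = ?s (\<Sum>e\<in>B. of_rat (?r (x * b) e) * e) c"
        using sB[OF stable[OF BK[OF \<open>b \<in> B\<close>]]] by simp
      also have "\<dots> = (\<Sum>e\<in>B. ?r (x * b) e * ?s e c)"
        by (rule representation_of_rat_sum[OF C(1)]) (use BK span in auto)
      finally show "?r c b * ?s (x * b) c = ?r c b * (\<Sum>e\<in>B. ?r (x * b) e * ?s e c)" by simp
    qed simp
    finally show ?thesis by (simp add: sum_distrib_left mult_ac)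
  qed
  \<comment> \<open>The two transition matrices multiply to the identity; this collapses the triple
    sum to its diagonal.\<close>
  have 2: "(\<Sum>c\<in>C. ?s e c * ?r c b) = (if b = e then 1 else 0)" if e: "e \<in> B" for e b
  proof -
    have "(\<Sum>c\<in>C. ?s e c * ?r c b) = ?r (\<Sum>c\<in>C. of_rat (?s e c) * c) b"
      by (rule representation_of_rat_sum[OF B(1), symmetric]) (use CK span in auto)
    also have "\<dots> = ?r e b" using sC[OF BK[OF e]] by simp
    finally show ?thesis using rat_space.representation_basis[OF B(1) e] by auto
  qed
  have "(\<Sum>c\<in>C. ?s (x * c) c) = (\<Sum>c\<in>C. \<Sum>b\<in>B. \<Sum>e\<in>B. ?r (x * b) e * (?s e c * ?r c b))"
    using 1 by simp
  also have "\<dots> = (\<Sum>b\<in>B. \<Sum>e\<in>B. \<Sum>c\<in>C. ?r (x * b) e * (?s e c * ?r c b))"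
    by (rule trans[OF sum.swap], rule sum.cong[OF refl], rule sum.swap)
  also have "\<dots> = (\<Sum>b\<in>B. \<Sum>e\<in>B. ?r (x * b) e * (if b = e then 1 else 0))"
    by (intro sum.cong) (simp_all add: 2 flip: sum_distrib_left)
  also have "\<dots> = (\<Sum>b\<in>B. ?r (x * b) b)"
    using B(2) by (simp add: if_distrib[of "\<lambda>x. _ * x"] cong: if_cong)
  finally show ?thesis by simp
qed

lemma field_of_degree_is_subfield: "field_of_degree n K \<Longrightarrow> is_subfield K"
  by (simp add: field_of_degree_def subfield_imp_is_subfield)

lemma field_of_degree_basis:
  assumes K: "field_of_degree n K" and B: "rat_space.independent B" "rat_space.span B = K"
  shows "finite B" "card B = n"
proof -
  have "card B = n"
    using K rat_space.dim_span_eq_card_independent[OF B(1)] B(2) by (simp add: field_of_degree_def)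
  then show "finite B" "card B = n" using K by (auto simp: field_of_degree_def intro: card_ge_0_finite)
qed

lemma field_of_degree_basis_exists:
  assumes K: "field_of_degree n K"
  obtains B where "rat_space.independent B" "rat_space.span B = K" "finite B" "card B = n"
proof -
  obtain B where B: "B \<subseteq> K" "rat_space.independent B" "K \<subseteq> rat_space.span B"
    using rat_space.basis_exists by metis
  have "rat_space.span B = K"
    using B is_subfield_rat_subspace[OF field_of_degree_is_subfield[OF K]]
    by (intro rat_space.span_subspace)
  then show ?thesis using field_of_degree_basis[OF K B(2)] B(2) that by blast
qed

lemma field_trace_eq:
  assumes K: "field_of_degree n K" and B: "rat_space.independent B" "rat_space.span B = K"
    and x: "x \<in> K"
  shows "field_trace K x = (\<Sum>b\<in>B. rat_space.representation B (x * b) b)"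
proof -
  define C where "C = (SOME B. rat_space.independent B \<and> rat_space.span B = K)"
  have C: "rat_space.independent C" "rat_space.span C = K"
    using someI[of "\<lambda>B. rat_space.independent B \<and> rat_space.span B = K" B] B by (simp_all add: C_def)
  have "field_trace K x = (\<Sum>b\<in>C. rat_space.representation C (x * b) b)"
    by (simp add: field_trace_def C_def Let_def)
  also have "\<dots> = (\<Sum>b\<in>B. rat_space.representation B (x * b) b)"
    using C B field_of_degree_basis[OF K] is_subfieldD[OF field_of_degree_is_subfield[OF K]] x
    by (intro trace_basis_independent) auto
  finally show ?thesis .
qed

lemma
  assumes K: "field_of_degree n K"
  shows field_trace_add:
      "x \<in> K \<Longrightarrow> y \<in> K \<Longrightarrow> field_trace K (x + y) = field_trace K x + field_trace K y"
    and field_trace_scale: "x \<in> K \<Longrightarrow> field_trace K (of_rat q * x) = q * field_trace K x"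
proof -
  obtain B where B: "rat_space.independent B" "rat_space.span B = K" "finite B" "card B = n"
    using field_of_degree_basis_exists[OF K] .
  note K' = is_subfieldD[OF field_of_degree_is_subfield[OF K]]
  have mem: "x * b \<in> rat_space.span B" if "b \<in> B" "x \<in> K" for x b
    using that rat_space.span_base[of b B] B(2) K'(3)[of x b] by simp
  show "field_trace K (x + y) = field_trace K x + field_trace K y" if "x \<in> K" "y \<in> K"
    using that by (simp add: field_trace_eq[OF K B(1,2)] K' distrib_right mem
        rat_space.representation_add[OF B(1)] sum.distrib)
  show "field_trace K (of_rat q * x) = q * field_trace K x" if "x \<in> K"
    using that by (simp add: field_trace_eq[OF K B(1,2)] K' mult.assoc mem
        rat_space.representation_scale[OF B(1)] sum_distrib_left)
qed

lemma
  assumes K: "field_of_degree n K"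
  shows field_trace_zero: "field_trace K 0 = 0"
    and field_trace_minus: "x \<in> K \<Longrightarrow> field_trace K (- x) = - field_trace K x"
    and field_trace_diff:
      "x \<in> K \<Longrightarrow> y \<in> K \<Longrightarrow> field_trace K (x - y) = field_trace K x - field_trace K y"
    and field_trace_scale_int: "x \<in> K \<Longrightarrow> field_trace K (of_int k * x) = of_int k * field_trace K x"
    and field_trace_sum:
      "(\<And>i. i \<in> I \<Longrightarrow> g i \<in> K) \<Longrightarrow> field_trace K (sum g I) = (\<Sum>i\<in>I. field_trace K (g i))"
proof -
  note K' = is_subfieldD[OF field_of_degree_is_subfield[OF K]]
  note add = field_trace_add[OF K] and scale = field_trace_scale[OF K]
  show zero: "field_trace K 0 = 0" using scale[of 0 0] K' by simp
  show minus: "field_trace K (- x) = - field_trace K x" if "x \<in> K" for x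
    using scale[of x "-1"] that by (simp add: of_rat_minus)
  show "field_trace K (x - y) = field_trace K x - field_trace K y" if "x \<in> K" "y \<in> K"
    using add[of x "- y"] minus that K' by simp
  show "field_trace K (of_int k * x) = of_int k * field_trace K x" if "x \<in> K"
    using scale[of x "of_int k"] that by simp
  have "sum g I \<in> K \<and> field_trace K (sum g I) = (\<Sum>i\<in>I. field_trace K (g i))"
    if "\<And>i. i \<in> I \<Longrightarrow> g i \<in> K" using that
    by (induction I rule: infinite_finite_induct) (auto simp: zero K' add)
  then show "(\<And>i. i \<in> I \<Longrightarrow> g i \<in> K) \<Longrightarrow> field_trace K (sum g I) = (\<Sum>i\<in>I. field_trace K (g i))"
    by simp
qed

lemma field_trace_one:
  assumes K: "field_of_degree n K"
  shows "field_trace K 1 = of_nat n"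
proof -
  obtain B where B: "rat_space.independent B" "rat_space.span B = K" "finite B" "card B = n"
    using field_of_degree_basis_exists[OF K] .
  have "field_trace K 1 = (\<Sum>b\<in>B. rat_space.representation B b b)"
    using field_trace_eq[OF K B(1,2), of 1] is_subfieldD[OF field_of_degree_is_subfield[OF K]] by simp
  also have "\<dots> = (\<Sum>b\<in>B. 1)"
    by (intro sum.cong) (auto simp: rat_space.representation_basis[OF B(1)])
  finally show ?thesis using B by simp
qed

text \<open>\<phi> carries a rational basis of \<open>K\<close> to one of \<open>L\<close>, and in
  these bases multiplication by \<open>x\<close> and by \<open>\<phi> x\<close> have the same
  matrix. Later this makes the trace forms of isomorphic fields coincide.\<close>

lemma field_trace_iso:
  assumes K: "field_of_degree n K" and L: "field_of_degree n L"
    and \<phi>: "is_embedding K \<phi>" "\<phi> ` K = L" and x: "x \<in> K"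
  shows "field_trace L (\<phi> x) = field_trace K x"
proof -
  note sub = field_of_degree_is_subfield[OF K]
  note K' = is_subfieldD[OF sub]
  note simps = embedding_simps[OF sub \<phi>(1)]
  obtain B where B: "rat_space.independent B" "rat_space.span B = K" "finite B" "card B = n"
    using field_of_degree_basis_exists[OF K] .
  have BK: "b \<in> K" if "b \<in> B" for b using rat_space.span_base[OF that] B by simp
  have inj: "inj_on \<phi> B"
    using embedding_eq_iff[OF sub \<phi>(1)] BK by (auto intro: inj_onI)
  have lin: "\<phi> (\<Sum>b\<in>A. of_rat (u b) * b) = (\<Sum>b\<in>A. of_rat (u b) * \<phi> b)
      \<and> (\<Sum>b\<in>A. of_rat (u b) * b) \<in> K" if "A \<subseteq> B" for A u
    using finite_subset[OF that B(3)] that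
    by (induction A rule: finite_induct) (auto simp: simps K' BK)
  have ind: "rat_space.independent (\<phi> ` B)"
    unfolding rat_space.independent_explicit_module
  proof (intro allI impI)
    fix t u v assume t: "finite t" "t \<subseteq> \<phi> ` B" "(\<Sum>v\<in>t. of_rat (u v) * v) = 0" "v \<in> t"
    obtain A where A: "A \<subseteq> B" "t = \<phi> ` A" using t(2) by (meson subset_imageE)
    have "(\<Sum>v\<in>t. of_rat (u v) * v) = (\<Sum>b\<in>A. of_rat (u (\<phi> b)) * \<phi> b)"
      unfolding A(2) by (subst sum.reindex) (use inj A inj_on_subset in auto)
    then have "\<phi> (\<Sum>b\<in>A. of_rat (u (\<phi> b)) * b) = \<phi> 0"
      using lin[OF A(1), of "\<lambda>b. u (\<phi> b)"] t(3) simps by simp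
    then have *: "(\<Sum>b\<in>A. of_rat (u (\<phi> b)) * b) = 0"
      using lin[OF A(1), of "\<lambda>b. u (\<phi> b)"] embedding_eq_iff[OF sub \<phi>(1) _ K'(6)] by metis
    obtain b where "b \<in> A" "v = \<phi> b" using t(4) A by auto
    then show "u v = 0"
      using rat_space.independentD[OF B(1) finite_subset[OF A(1) B(3)] A(1) *] by simp
  qed
  have repr: "\<phi> v = (\<Sum>b\<in>B. of_rat (rat_space.representation B v b) * \<phi> b)" if "v \<in> K" for v
    using rat_space.sum_representation_eq[OF B(1) _ B(3) subset_refl, of v]
      lin[OF subset_refl, of "rat_space.representation B v"] that B(2) by simp
  have span: "rat_space.span (\<phi> ` B) = L"
  proof
    show "rat_space.span (\<phi> ` B) \<subseteq> L"
      using BK \<phi>(2) is_subfield_rat_subspace[OF field_of_degree_is_subfield[OF L]]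
      by (intro rat_space.span_minimal) auto
    show "L \<subseteq> rat_space.span (\<phi> ` B)"
      using repr \<phi>(2)
      by (auto intro!: rat_space.span_sum rat_space.span_scale intro: rat_space.span_base)
  qed
  have coeff: "rat_space.representation (\<phi> ` B) (\<phi> v) (\<phi> b) = rat_space.representation B v b"
    if "v \<in> K" "b \<in> B" for v b
  proof -
    have "\<phi> c \<in> rat_space.span (\<phi> ` B)" if "c \<in> B" for c using that by (intro rat_space.span_base) auto
    then have "rat_space.representation (\<phi> ` B) (\<phi> v) (\<phi> b)
      = (\<Sum>c\<in>B. rat_space.representation B v c * rat_space.representation (\<phi> ` B) (\<phi> c) (\<phi> b))"
      using repr[OF \<open>v \<in> K\<close>] representation_of_rat_sum[OF ind, of B \<phi>] by simp
    also have "\<dots> = (\<Sum>c\<in>B. rat_space.representation B v c * (if c = b then 1 else 0))"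
      using inj \<open>b \<in> B\<close>
      by (intro sum.cong) (auto simp: rat_space.representation_basis[OF ind] inj_on_eq_iff)
    finally show ?thesis using B(3) \<open>b \<in> B\<close> by (simp add: if_distrib cong: if_cong)
  qed
  have "field_trace L (\<phi> x) = (\<Sum>c\<in>\<phi> ` B. rat_space.representation (\<phi> ` B) (\<phi> x * c) c)"
    using field_trace_eq[OF L ind span] x \<phi>(2) by auto
  also have "\<dots> = (\<Sum>b\<in>B. rat_space.representation (\<phi> ` B) (\<phi> x * \<phi> b) (\<phi> b))"
    by (simp add: sum.reindex[OF inj])
  also have "\<dots> = (\<Sum>b\<in>B. rat_space.representation B (x * b) b)"
    by (intro sum.cong) (use x BK in \<open>auto simp: coeff K' simps(4)[symmetric]\<close>)
  also have "\<dots> = field_trace K x" using field_trace_eq[OF K B(1,2) x] by simp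
  finally show ?thesis .
qed

text \<open>Passes from coefficients attached to elements of a set to coefficients attached to list
  positions, the form in which transition matrices are written. On the right, distinctness is hidden
  in independence: equal entries at positions \<open>i\<close> and \<open>j\<close> would give the
  relation with coefficients 1 and -1.\<close>

lemma Z_basis_iff:
  "Z_basis bs M \<longleftrightarrow>
    (\<forall>u. (\<Sum>i<length bs. of_int (u i) * bs ! i) = 0 \<longrightarrow> (\<forall>i<length bs. u i = 0)) \<and>
    M = {\<Sum>i<length bs. of_int (u i) * bs ! i | u. True}"
proof -
  let ?n = "length bs"
  have dist: "distinct bs"
    if ind: "\<forall>u. (\<Sum>i<?n. of_int (u i) * bs ! i) = 0 \<longrightarrow> (\<forall>i<?n. u i = 0)"
  proof (rule ccontr)
    assume "\<not> distinct bs"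
    then obtain i j where ij: "i < ?n" "j < ?n" "i \<noteq> j" "bs ! i = bs ! j"
      by (auto simp: distinct_conv_nth)
    define u where "u k = (if k = i then 1 else 0) - (if k = j then 1 else 0 :: int)" for k
    have "(\<Sum>k<?n. of_int (u k) * bs ! k) = bs ! i - bs ! j"
      using ij(1,2)
      by (simp add: u_def left_diff_distrib sum_subtractf if_distrib[of of_int] if_distrib[of "\<lambda>x. x * _"]
          cong: if_cong)
    then have "u i = 0" using ind ij by auto
    then show False using ij(3) by (simp add: u_def)
  qed
  have iff: "int_module.independent (set bs) \<and> int_module.span (set bs) = M \<longleftrightarrow>
    (\<forall>u. (\<Sum>i<?n. of_int (u i) * bs ! i) = 0 \<longrightarrow> (\<forall>i<?n. u i = 0)) \<and>
    M = {\<Sum>i<?n. of_int (u i) * bs ! i | u. True}" if d: "distinct bs"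
  proof -
    have bij: "bij_betw ((!) bs) {..<?n} (set bs)" using bij_betw_nth[OF d] by simp
    have re: "(\<Sum>v\<in>set bs. of_int (u v) * v) = (\<Sum>i<?n. of_int (u (bs ! i)) * bs ! i)" for u
      using sum.reindex_bij_betw[OF bij, of "\<lambda>v. of_int (u v) * v"] by simp
    define pos where "pos = the_inv_into {..<?n} ((!) bs)"
    have pos: "pos (bs ! i) = i" if "i < ?n" for i
      using that bij by (auto simp: pos_def bij_betw_def intro!: the_inv_into_f_f)
    have re': "(\<Sum>i<?n. of_int (u i) * bs ! i) = (\<Sum>v\<in>set bs. of_int (u (pos v)) * v)" for u
      unfolding re by (intro sum.cong) (auto simp: pos)
    have "int_module.independent (set bs) \<longleftrightarrow>
        (\<forall>u. (\<Sum>v\<in>set bs. of_int (u v) * v) = 0 \<longrightarrow> (\<forall>v\<in>set bs. u v = 0))"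
      by (auto simp: int_module.dependent_finite)
    also have "\<dots> \<longleftrightarrow> (\<forall>u. (\<Sum>i<?n. of_int (u i) * bs ! i) = 0 \<longrightarrow> (\<forall>i<?n. u i = 0))"
      (is "?l \<longleftrightarrow> ?r")
    proof
      assume l: ?l
      show ?r
      proof (intro allI impI)
        fix u i assume "(\<Sum>i<?n. of_int (u i) * bs ! i) = 0" "i < ?n"
        then show "u i = 0" using l[rule_format, of "\<lambda>v. u (pos v)" "bs ! i"] re'[of u] pos by simp
      qed
    next
      assume r: ?r
      show ?l
      proof (intro allI impI ballI)
        fix u v assume "(\<Sum>v\<in>set bs. of_int (u v) * v) = 0" "v \<in> set bs"
        then obtain i where "i < ?n" "v = bs ! i" by (auto simp: in_set_conv_nth)
        moreover have "\<forall>i<?n. u (bs ! i) = 0"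
          using r[rule_format, of "\<lambda>i. u (bs ! i)"] re[of u] \<open>_ = 0\<close> by simp
        ultimately show "u v = 0" by simp
      qed
    qed
    moreover have "int_module.span (set bs) = {\<Sum>i<?n. of_int (u i) * bs ! i | u. True}"
      unfolding int_module.span_finite[OF finite_set]
    proof (intro equalityI subsetI)
      fix x assume "x \<in> range (\<lambda>u. \<Sum>v\<in>set bs. of_int (u v) * v)"
      then show "x \<in> {\<Sum>i<?n. of_int (u i) * bs ! i | u. True}" using re by auto
    next
      fix x assume "x \<in> {\<Sum>i<?n. of_int (u i) * bs ! i | u. True}"
      then show "x \<in> range (\<lambda>u. \<Sum>v\<in>set bs. of_int (u v) * v)" using re' by auto
    qed
    ultimately show ?thesis by auto
  qed
  show ?thesis
  proof (cases "distinct bs")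
    case True
    then show ?thesis using iff[OF True] unfolding Z_basis_def by simp
  next
    case False
    then show ?thesis using dist unfolding Z_basis_def by fast
  qed
qed

text \<open>Two bases of the same lattice differ by a matrix \<open>A\<close> invertible over the
  integers, so \<open>det A\<close> is 1 or -1. The Gram matrix \<open>G\<close> changes to
  \<open>A G A\<^sup>T\<close>, and its determinant is multiplied by the square of
  \<open>det A\<close>.\<close>

lemma Z_basis_gram_det_unique:
  assumes K: "field_of_degree n K" and "M \<subseteq> K" and bs: "Z_basis bs M" and cs: "Z_basis cs M"
  shows "det (mat (length bs) (length bs) (\<lambda>(i, j). field_trace K (bs ! i * bs ! j)))
    = det (mat (length cs) (length cs) (\<lambda>(i, j). field_trace K (cs ! i * cs ! j)))"
proof -
  note sub = field_of_degree_is_subfield[OF K]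
  let ?m = "length bs" and ?l = "length cs"
  have unit: "(\<Sum>i<length xs. of_int (if i = j then 1 else 0) * xs ! i) = xs ! j"
    if "j < length xs" for xs :: "complex list" and j
    using that by (simp add: if_distrib[of of_int] if_distrib[of "\<lambda>x. x * _"] cong: if_cong)
  have mem: "xs ! j \<in> M" if "Z_basis xs M" "j < length xs" for xs j
  proof -
    have "M = {\<Sum>i<length xs. of_int (u i) * xs ! i | u. True}" using that(1) by (simp add: Z_basis_iff)
    then show ?thesis
      using unit[OF that(2)] by (auto intro!: exI[of _ "\<lambda>i. if i = j then 1 else 0"])
  qed
  have change: "\<exists>A. (\<forall>i<length xs. xs ! i = (\<Sum>k<length ys. of_int (A i k) * ys ! k))"
    if "Z_basis xs M" "Z_basis ys M" for xs ys
  proof -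
    have "\<forall>i<length xs. \<exists>u. xs ! i = (\<Sum>k<length ys. of_int (u k) * ys ! k)"
      using mem[OF that(1)] that(2) unfolding Z_basis_iff by auto
    then show ?thesis by metis
  qed
  obtain P where "\<forall>i<?m. bs ! i = (\<Sum>k<?l. of_int (P i k) * cs ! k)"
    using change[OF bs cs] by (rule exE)
  note P = this[rule_format]
  obtain Q where "\<forall>k<?l. cs ! k = (\<Sum>i<?m. of_int (Q k i) * bs ! i)"
    using change[OF cs bs] by (rule exE)
  note Q = this[rule_format]
  have inverse: "(\<Sum>k<length ys. A i k * B k j) = (if j = i then 1 else 0)"
    if xs: "Z_basis xs M"
      and A: "\<And>i. i < length xs \<Longrightarrow> xs ! i = (\<Sum>k<length ys. of_int (A i k) * ys ! k)"
      and B: "\<And>k. k < length ys \<Longrightarrow> ys ! k = (\<Sum>i<length xs. of_int (B k i) * xs ! i)"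
      and i: "i < length xs" and j: "j < length xs" for A B i j and xs ys :: "complex list"
  proof -
    define u where "u j = (\<Sum>k<length ys. A i k * B k j) - (if j = i then 1 else 0)" for j
    have "xs ! i = (\<Sum>k<length ys. of_int (A i k) * (\<Sum>j<length xs. of_int (B k j) * xs ! j))"
      by (subst A[OF i]) (simp add: B)
    also have "\<dots> = (\<Sum>j<length xs. \<Sum>k<length ys. of_int (A i k) * (of_int (B k j) * xs ! j))"
      by (simp add: sum_distrib_left) (rule sum.swap)
    also have "\<dots> = (\<Sum>j<length xs. of_int (\<Sum>k<length ys. A i k * B k j) * xs ! j)"
      by (simp only: of_int_sum of_int_mult sum_distrib_right mult.assoc)
    finally have "(\<Sum>j<length xs. of_int (u j) * xs ! j) = xs ! i - xs ! i"
      unfolding u_def of_int_diff left_diff_distrib sum_subtractf unit[OF i] by simp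
    then have "(\<Sum>j<length xs. of_int (u j) * xs ! j) = 0" by simp
    then have "u j = 0" using xs j unfolding Z_basis_iff by blast
    then show ?thesis by (simp add: u_def)
  qed
  note PQ = inverse[OF bs P Q] and QP = inverse[OF cs Q P]
  \<comment> \<open>Equal lengths come from comparing traces: \<open>P Q\<close> and
    \<open>Q P\<close> are identity matrices of sizes \<open>?m\<close> and \<open>?l\<close>, and
    they have the same trace.\<close>
  have "of_nat ?m = (\<Sum>i<?m. \<Sum>k<?l. P i k * Q k i)" using PQ by simp
  also have "\<dots> = (\<Sum>k<?l. \<Sum>i<?m. Q k i * P i k)" by (subst sum.swap) (simp add: mult.commute)
  also have "\<dots> = of_nat ?l" using QP by simp
  finally have len: "?l = ?m" by linarith
  define A where "A = mat ?m ?m (\<lambda>(i, k). P i k)"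
  define B where "B = mat ?m ?m (\<lambda>(k, j). Q k j)"
  define G where "G xs = mat ?m ?m (\<lambda>(i, j). field_trace K (xs ! i * xs ! j))" for xs
  have carr: "A \<in> carrier_mat ?m ?m" "B \<in> carrier_mat ?m ?m" "\<And>xs. G xs \<in> carrier_mat ?m ?m"
    by (simp_all add: A_def B_def G_def)
  let ?A = "map_mat of_int A :: rat mat"
  have "A * B = 1\<^sub>m ?m"
    using PQ len by (intro eq_matI) (auto simp: A_def B_def scalar_prod_def atLeast0LessThan)
  then have "det A * det B = 1" using det_mult[OF carr(1,2)] by simp
  then have "det A = 1 \<or> det A = - 1" by (auto simp: zmult_eq_1_iff)
  moreover have "det ?A = of_int (det A)" by (rule of_int_hom.hom_det)
  ultimately have det1: "det ?A * det ?A = 1" by auto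
  have "G bs = ?A * G cs * ?A\<^sup>T"
  proof (rule eq_matI)
    fix i j assume "i < dim_row (?A * G cs * ?A\<^sup>T)" "j < dim_col (?A * G cs * ?A\<^sup>T)"
    then have i: "i < ?m" and j: "j < ?m" by (simp_all add: A_def)
    have csK: "cs ! k \<in> K" if "k < ?m" for k using mem[OF cs] that len assms(2) by auto
    note K' = is_subfieldD[OF sub]
    have "bs ! i * bs ! j = (\<Sum>k<?m. \<Sum>k'<?m. of_int (P i k * P j k') * (cs ! k * cs ! k'))"
      using P[OF i] P[OF j] len by (simp add: sum_product mult_ac)
    then have "field_trace K (bs ! i * bs ! j) =
      field_trace K (\<Sum>(k,k')\<in>{..<?m}\<times>{..<?m}. of_int (P i k * P j k') * (cs ! k * cs ! k'))"
      by (simp add: sum.cartesian_product)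
    also have "\<dots> = (\<Sum>(k,k')\<in>{..<?m}\<times>{..<?m}. of_int (P i k * P j k') * field_trace K (cs ! k * cs ! k'))"
      using csK by (subst field_trace_sum[OF K]) (auto simp: K' field_trace_scale_int[OF K] simp del: of_int_mult intro!: sum.cong)
    also have "\<dots> = (\<Sum>k<?m. \<Sum>k'<?m. of_int (P i k * P j k') * field_trace K (cs ! k * cs ! k'))"
      by (simp add: sum.cartesian_product)
    also have "\<dots> = (\<Sum>k'<?m. (\<Sum>k<?m. of_int (P i k) * field_trace K (cs ! k * cs ! k')) * of_int (P j k'))"
      by (subst sum.swap) (simp only: of_int_mult sum_distrib_left sum_distrib_right mult_ac)
    also have "\<dots> = (?A * G cs * ?A\<^sup>T) $$ (i, j)"
      using i j by (simp add: A_def G_def scalar_prod_def atLeast0LessThan)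
    finally show "G bs $$ (i, j) = (?A * G cs * ?A\<^sup>T) $$ (i, j)" using i j by (simp add: G_def)
  qed (simp_all add: A_def G_def)
  then have "det (G bs) = det ?A * det (G cs) * det ?A"
    using carr by (simp add: det_mult[of _ ?m] det_transpose[of _ ?m])
  then show ?thesis using det1 len by (simp add: G_def mult_ac)
qed

text \<open>Resolves the definite description in \<open>field_discriminant\<close> once some
  integral basis is at hand; uniqueness is the invariance of the Gram determinant.\<close>

lemma field_discriminant_eq:
  assumes K: "field_of_degree n K" and bs: "Z_basis bs (ring_of_integers K)"
    and D: "of_int D = det (mat (length bs) (length bs) (\<lambda>(i, j). field_trace K (bs ! i * bs ! j)))"
  shows "field_discriminant K = D"
  unfolding field_discriminant_def
proof (rule the_equality)
  show "\<exists>bs. Z_basis bs (ring_of_integers K) \<and>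
       of_int D = det (mat (length bs) (length bs) (\<lambda>(i, j). field_trace K (bs ! i * bs ! j)))"
    using bs D by blast
next
  fix E assume "\<exists>bs. Z_basis bs (ring_of_integers K) \<and>
       of_int E = det (mat (length bs) (length bs) (\<lambda>(i, j). field_trace K (bs ! i * bs ! j)))"
  then obtain cs where cs: "Z_basis cs (ring_of_integers K)"
    "of_int E = det (mat (length cs) (length cs) (\<lambda>(i, j). field_trace K (cs ! i * cs ! j)))" by blast
  have "ring_of_integers K \<subseteq> K" by (auto simp: ring_of_integers_def)
  then have "of_int E = (of_int D :: rat)"
    using Z_basis_gram_det_unique[OF K _ bs cs(1)] D cs(2) by simp
  then show "E = D" by simp
qed

section \<open>Quadratic fields and fundamental discriminants\<close>

lemma Z_basis_pair_iff:
  "Z_basis [b, c] M \<longleftrightarrow>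
    (\<forall>m n. of_int m * b + of_int n * c = 0 \<longrightarrow> m = 0 \<and> n = 0) \<and>
    M = {of_int m * b + of_int n * c | m n. True}"
proof -
  have 1: "(\<forall>u. (\<Sum>i<length [b, c]. of_int (u i) * [b, c] ! i) = 0 \<longrightarrow> (\<forall>i<length [b, c]. u i = 0))
    \<longleftrightarrow> (\<forall>m n. of_int m * b + of_int n * c = 0 \<longrightarrow> m = 0 \<and> n = 0)" (is "?l \<longleftrightarrow> ?r")
  proof
    assume l: ?l
    show ?r
    proof (intro allI impI)
      fix m n assume "of_int m * b + of_int n * c = 0"
      then show "m = 0 \<and> n = 0"
        using l[rule_format, of "\<lambda>i. if i = 0 then m else n" 0]
          l[rule_format, of "\<lambda>i. if i = 0 then m else n" 1] by simp
    qed
  next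
    assume ?r then show ?l by (auto simp: less_Suc_eq)
  qed
  have 2: "{\<Sum>i<length [b, c]. of_int (u i) * [b, c] ! i | u. True}
      = {of_int m * b + of_int n * c | m n. True}"
  proof (intro equalityI subsetI)
    fix x assume "x \<in> {of_int m * b + of_int n * c | m n. True}"
    then obtain m n where "x = of_int m * b + of_int n * c" by auto
    then show "x \<in> {\<Sum>i<length [b, c]. of_int (u i) * [b, c] ! i | u. True}"
      by (auto intro!: exI[of _ "\<lambda>i. if i = 0 then m else n"])
  qed auto
  show ?thesis unfolding Z_basis_iff 1 2 ..
qed

lemma Z_basis_triple_iff:
  "Z_basis [a, b, c] M \<longleftrightarrow>
    (\<forall>l m n. of_int l * a + of_int m * b + of_int n * c = 0 \<longrightarrow> l = 0 \<and> m = 0 \<and> n = 0) \<and>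
    M = {of_int l * a + of_int m * b + of_int n * c | l m n. True}"
proof -
  have 1: "(\<forall>u. (\<Sum>i<length [a, b, c]. of_int (u i) * [a, b, c] ! i) = 0 \<longrightarrow> (\<forall>i<length [a, b, c]. u i = 0))
    \<longleftrightarrow> (\<forall>l m n. of_int l * a + of_int m * b + of_int n * c = 0 \<longrightarrow> l = 0 \<and> m = 0 \<and> n = 0)" (is "?l \<longleftrightarrow> ?r")
  proof
    assume l: ?l
    show ?r
    proof (intro allI impI)
      fix k m n assume "of_int k * a + of_int m * b + of_int n * c = 0"
      then show "k = 0 \<and> m = 0 \<and> n = 0"
        using l[rule_format, of "\<lambda>i. if i = 0 then k else if i = 1 then m else n" 0]
          l[rule_format, of "\<lambda>i. if i = 0 then k else if i = 1 then m else n" 1]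
          l[rule_format, of "\<lambda>i. if i = 0 then k else if i = 1 then m else n" 2] by (simp add: add.assoc)
    qed
  next
    assume r: ?r
    show ?l
    proof (intro allI impI)
      fix u i assume "(\<Sum>i<length [a, b, c]. of_int (u i) * [a, b, c] ! i) = 0" "i < length [a, b, c]"
      then show "u i = 0"
        using r[rule_format, of "u 0" "u 1" "u 2"] by (auto simp: less_Suc_eq numeral_2_eq_2 add.assoc)
    qed
  qed
  have 2: "{\<Sum>i<length [a, b, c]. of_int (u i) * [a, b, c] ! i | u. True}
      = {of_int l * a + of_int m * b + of_int n * c | l m n. True}"
  proof (intro equalityI subsetI)
    fix x assume "x \<in> {of_int l * a + of_int m * b + of_int n * c | l m n. True}"
    then obtain l m n where "x = of_int l * a + of_int m * b + of_int n * c" by auto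
    then show "x \<in> {\<Sum>i<length [a, b, c]. of_int (u i) * [a, b, c] ! i | u. True}"
      by (auto intro!: exI[of _ "\<lambda>i. if i = 0 then l else if i = 1 then m else n"] simp: add.assoc)
  next
    fix x assume "x \<in> {\<Sum>i<length [a, b, c]. of_int (u i) * [a, b, c] ! i | u. True}"
    then obtain u where "x = (\<Sum>i<length [a, b, c]. of_int (u i) * [a, b, c] ! i)" by blast
    then have "x = of_int (u 0) * a + of_int (u 1) * b + of_int (u 2) * c"
      by (simp add: add.assoc numeral_2_eq_2)
    then show "x \<in> {of_int l * a + of_int m * b + of_int n * c | l m n. True}" by blast
  qed
  show ?thesis unfolding Z_basis_iff 1 2 ..
qed

lemma int_subgroup_generator:
  fixes A :: "int set"
  assumes diff: "\<And>a b. a \<in> A \<Longrightarrow> b \<in> A \<Longrightarrow> a - b \<in> A" and k: "k \<in> A" "k \<noteq> 0"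
  obtains g where "g > 0" "g \<in> A" "\<And>a. a \<in> A \<Longrightarrow> g dvd a"
proof -
  have 0: "0 \<in> A" using diff[OF k(1) k(1)] by simp
  have neg: "- a \<in> A" if "a \<in> A" for a using diff[OF 0 that] by simp
  have mult: "of_nat n * a \<in> A" if "a \<in> A" for n a
  proof (induction n)
    case (Suc n)
    then have "of_nat n * a - (- a) \<in> A" using diff neg that by blast
    then show ?case by (simp add: algebra_simps)
  qed (simp add: 0)
  have "\<exists>m::nat. m > 0 \<and> int m \<in> A"
    using k neg[OF k(1)] by (intro exI[of _ "nat \<bar>k\<bar>"]) (auto simp: abs_if)
  then obtain m :: nat where m: "m > 0" "int m \<in> A" "\<And>l. l < m \<Longrightarrow> \<not> (l > 0 \<and> int l \<in> A)"
    using exists_least_iff[of "\<lambda>m. m > 0 \<and> int m \<in> A"] by blast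
  have "int m dvd a" if a: "a \<in> A" for a
  proof -
    have "int m * (a div int m) \<in> A"
      using mult[OF m(2), of "nat \<bar>a div int m\<bar>"] neg[OF mult[OF m(2), of "nat \<bar>a div int m\<bar>"]]
      by (cases "a div int m \<ge> 0") (auto simp: mult.commute)
    then have "a mod int m \<in> A" using diff[OF a, of "int m * (a div int m)"]
      by (simp only: minus_mult_div_eq_mod)
    moreover have "0 \<le> a mod int m" "a mod int m < int m" using m(1) by auto
    ultimately have "a mod int m = 0"
      using m(3)[of "nat (a mod int m)"] by (auto simp: nat_less_iff)
    then show ?thesis by auto
  qed
  then show ?thesis using that[of "int m"] m by simp
qed

text \<open>Hermite normal form in rank two: \<beta> has the least positive
  \<open>b1\<close>-coordinate occurring in \<open>M\<close>, and \<gamma> generates the part of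
  \<open>M\<close> on the \<open>b2\<close>-axis. The multiple \<open>N\<close> guarantees that both
  minima exist.\<close>

lemma rank2_sublattice_basis:
  fixes b1 b2 :: complex
  assumes ind: "\<And>m n::int. of_int m * b1 + of_int n * b2 = 0 \<Longrightarrow> m = 0 \<and> n = 0"
    and M: "int_module.subspace M"
    and sub: "\<And>x. x \<in> M \<Longrightarrow> \<exists>m n::int. x = of_int m * b1 + of_int n * b2"
    and N: "N \<noteq> 0" "of_int N * b1 \<in> M" "of_int N * b2 \<in> M"
  obtains \<beta> \<gamma> where "Z_basis [\<beta>, \<gamma>] M"
proof -
  have diff: "x - y \<in> M" if "x \<in> M" "y \<in> M" for x y
    using int_module.subspace_diff[OF M that] .
  have scale: "of_int k * x \<in> M" if "x \<in> M" for k x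
    using int_module.subspace_scale[OF M that] by simp
  obtain k where k: "k > 0" "of_int k * b2 \<in> M" "\<And>a. of_int a * b2 \<in> M \<Longrightarrow> k dvd a"
    using int_subgroup_generator[of "{k. of_int k * b2 \<in> M}" N] N diff
    by (auto simp: left_diff_distrib)
  define A where "A = {j. \<exists>h::int. of_int j * b1 + of_int h * b2 \<in> M}"
  have "a - b \<in> A" if ab: "a \<in> A" "b \<in> A" for a b
  proof -
    obtain h h' where "of_int a * b1 + of_int h * b2 \<in> M" "of_int b * b1 + of_int h' * b2 \<in> M"
      using ab by (auto simp: A_def)
    then have "of_int (a - b) * b1 + of_int (h - h') * b2 \<in> M"
      using diff by (fastforce simp: algebra_simps)
    then show ?thesis unfolding A_def by blast
  qed
  moreover have "N \<in> A" using N(2) by (auto simp: A_def intro!: exI[of _ 0])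
  ultimately obtain j where j: "j > 0" "j \<in> A" "\<And>a. a \<in> A \<Longrightarrow> j dvd a"
    using int_subgroup_generator[of A N] N(1) by metis
  obtain h where h: "of_int j * b1 + of_int h * b2 \<in> M" using j(2) by (auto simp: A_def)
  define \<beta> \<gamma> where "\<beta> = of_int j * b1 + of_int h * b2" and "\<gamma> = of_int k * b2"
  have "Z_basis [\<beta>, \<gamma>] M"
    unfolding Z_basis_pair_iff
  proof (intro conjI allI impI)
    fix m n assume "of_int m * \<beta> + of_int n * \<gamma> = 0"
    then have "of_int (m * j) * b1 + of_int (m * h + n * k) * b2 = 0"
      by (simp add: \<beta>_def \<gamma>_def algebra_simps)
    then have "m * j = 0 \<and> m * h + n * k = 0" by (rule ind)
    then show "m = 0" "n = 0" using j(1) k(1) by auto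
  next
    show "M = {of_int m * \<beta> + of_int n * \<gamma> | m n. True}"
    proof (intro equalityI subsetI)
      fix x assume x: "x \<in> M"
      obtain p q where pq: "x = of_int p * b1 + of_int q * b2" using sub[OF x] by blast
      then have "j dvd p" using x j(3) by (auto simp: A_def)
      then obtain m where m: "p = j * m" by auto
      have "x - of_int m * \<beta> = of_int (q - m * h) * b2"
        by (simp add: pq m \<beta>_def algebra_simps)
      moreover have "x - of_int m * \<beta> \<in> M" using diff[OF x scale] h \<beta>_def by simp
      ultimately have "k dvd q - m * h" using k(3) by simp
      then obtain n where "q - m * h = k * n" by auto
      then have "x = of_int m * \<beta> + of_int n * \<gamma>"
        using \<open>x - of_int m * \<beta> = _\<close> by (simp add: \<gamma>_def algebra_simps)
      then show "x \<in> {of_int m * \<beta> + of_int n * \<gamma> | m n. True}" by blast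
    next
      fix x assume "x \<in> {of_int m * \<beta> + of_int n * \<gamma> | m n. True}"
      then obtain m n where "x = of_int m * \<beta> + of_int n * \<gamma>" by blast
      moreover have "\<beta> \<in> M" "\<gamma> \<in> M" using h k(2) by (simp_all add: \<beta>_def \<gamma>_def)
      ultimately show "x \<in> M" by (simp add: int_module.subspace_add[OF M] scale)
    qed
  qed
  then show ?thesis using that by blast
qed

definition fund_disc :: "int \<Rightarrow> bool"
  where "fund_disc e \<longleftrightarrow> e mod 4 \<in> {0, 1} \<and> (\<forall>m k. e = m\<^sup>2 * k \<and> k mod 4 \<in> {0, 1} \<longrightarrow> m\<^sup>2 = 1)"

lemma fund_discD: "fund_disc e \<Longrightarrow> e = m\<^sup>2 * k \<Longrightarrow> k mod 4 \<in> {0, 1} \<Longrightarrow> m\<^sup>2 = 1"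
  by (rule fund_disc_def[THEN iffD1, THEN conjunct2, rule_format, OF _ conjI])

lemma square_mod_4: "(a::int)\<^sup>2 mod 4 \<in> {0, 1}" "odd a \<Longrightarrow> a\<^sup>2 mod 4 = 1"
proof -
  show "odd a \<Longrightarrow> a\<^sup>2 mod 4 = 1"
  proof -
    assume "odd a"
    then obtain k where "a = 2 * k + 1" by (auto elim: oddE)
    then have *: "a\<^sup>2 = 1 + 4 * (k\<^sup>2 + k)" by (simp add: power2_eq_square algebra_simps)
    show ?thesis unfolding * by (subst mod_mult_self2) simp
  qed
  then show "a\<^sup>2 mod 4 \<in> {0, 1}" by (cases "even a") (auto elim!: evenE simp: power_mult_distrib)
qed

definition qfield :: "complex \<Rightarrow> complex set"
  where "qfield s = {of_rat u + of_rat v * s | u v. True}"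

definition qconj :: "complex \<Rightarrow> complex \<Rightarrow> complex"
  where "qconj s x = (THE y. \<exists>u v. x = of_rat u + of_rat v * s \<and> y = of_rat u - of_rat v * s)"

lemma of_rat_add_mult_eq_iff:
  fixes s :: complex
  assumes "s \<notin> \<rat>"
  shows "of_rat u + of_rat v * s = of_rat u' + of_rat v' * s \<longleftrightarrow> u = u' \<and> v = v'"
proof
  assume *: "of_rat u + of_rat v * s = of_rat u' + of_rat v' * s"
  have "v = v'"
  proof (rule ccontr)
    assume "v \<noteq> v'"
    have gen: "c \<noteq> 0 \<Longrightarrow> c * s = b \<Longrightarrow> s = b / c" for b c by (auto simp: field_simps)
    have "of_rat (v - v') \<noteq> (0::complex)" using \<open>v \<noteq> v'\<close> by simp
    moreover have "of_rat (v - v') * s = of_rat (u' - u)"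
      using * by (simp add: of_rat_diff algebra_simps)
    ultimately have "s = of_rat (u' - u) / of_rat (v - v')"
      by (rule gen)
    then have "s \<in> \<rat>" by (metis Rats_divide Rats_of_rat)
    then show False using assms by simp
  qed
  then show "u = u' \<and> v = v'" using * by simp
qed auto

context
  fixes s :: complex and e :: int
  assumes s: "s\<^sup>2 = of_int e" and irrational: "s \<notin> \<rat>"
begin

lemma qconj_eq: "qconj s (of_rat u + of_rat v * s) = of_rat u - of_rat v * s"
  unfolding qconj_def
  by (rule the_equality) (auto simp: of_rat_add_mult_eq_iff[OF irrational])

lemma qfield_mult:
  "(of_rat u + of_rat v * s) * (of_rat u' + of_rat v' * s) =
    of_rat (u * u' + v * v' * of_int e) + of_rat (u * v' + v * u') * s"
  using s by (simp add: of_rat_add of_rat_mult power2_eq_square algebra_simps)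

lemma is_subfield_qfield: "is_subfield (qfield s)"
  unfolding is_subfield_def
proof (intro conjI ballI)
  have "1 = of_rat 1 + of_rat 0 * s" by simp
  then show "1 \<in> qfield s" unfolding qfield_def by blast
next
  fix x y assume "x \<in> qfield s" "y \<in> qfield s"
  then obtain u v u' v' where x: "x = of_rat u + of_rat v * s" and y: "y = of_rat u' + of_rat v' * s"
    by (auto simp: qfield_def)
  have "x + y = of_rat (u + u') + of_rat (v + v') * s" by (simp add: x y of_rat_add algebra_simps)
  then show "x + y \<in> qfield s" unfolding qfield_def by blast
  show "x * y \<in> qfield s" unfolding x y qfield_mult unfolding qfield_def by blast
next
  fix x assume "x \<in> qfield s"
  then obtain u v where x: "x = of_rat u + of_rat v * s" by (auto simp: qfield_def)
  have "- x = of_rat (- u) + of_rat (- v) * s" by (simp add: x of_rat_minus)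
  then show "- x \<in> qfield s" unfolding qfield_def by blast
  show "inverse x \<in> qfield s"
  proof (cases "x = 0")
    case True
    then have "inverse x = of_rat 0 + of_rat 0 * s" by simp
    then show ?thesis unfolding qfield_def by blast
  next
    case False
    define n where "n = u * u - v * v * of_int e"
    have "of_rat u - of_rat v * s \<noteq> 0"
      using of_rat_add_mult_eq_iff[OF irrational, of u "- v" 0 0] False by (auto simp: x of_rat_minus)
    moreover have n: "x * (of_rat u - of_rat v * s) = of_rat n"
      using qfield_mult[of u v u "- v"] by (simp add: x n_def of_rat_minus)
    ultimately have "of_rat n \<noteq> (0::complex)" using False by (metis mult_eq_0_iff)
    then have "inverse x = of_rat (u / n) + of_rat (- v / n) * s"
      using n False by (simp add: of_rat_divide of_rat_minus field_simps)
    then show ?thesis unfolding qfield_def by blast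
  qed
qed

lemma is_embedding_qconj: "is_embedding (qfield s) (qconj s)"
  unfolding is_embedding_def
proof (intro conjI ballI)
  show "qconj s 1 = 1" using qconj_eq[of 1 0] by simp
next
  fix x y assume "x \<in> qfield s" "y \<in> qfield s"
  then obtain u v u' v' where x: "x = of_rat u + of_rat v * s" and y: "y = of_rat u' + of_rat v' * s"
    by (auto simp: qfield_def)
  have "x + y = of_rat (u + u') + of_rat (v + v') * s" by (simp add: x y of_rat_add algebra_simps)
  then have "qconj s (x + y) = of_rat (u + u') - of_rat (v + v') * s" by (simp only: qconj_eq)
  also have "\<dots> = qconj s x + qconj s y"
    unfolding x y qconj_eq by (simp add: of_rat_add algebra_simps)
  finally show "qconj s (x + y) = qconj s x + qconj s y" .
  have "qconj s (x * y) = of_rat (u * u' + v * v' * of_int e) - of_rat (u * v' + v * u') * s"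
    unfolding x y qfield_mult qconj_eq ..
  also have "\<dots> = qconj s x * qconj s y"
  proof -
    have "of_int e = s * s" using s by (simp add: power2_eq_square)
    then show ?thesis
      unfolding x y qconj_eq by (simp add: of_rat_add of_rat_mult algebra_simps)
  qed
  finally show "qconj s (x * y) = qconj s x * qconj s y" .
qed

text \<open>Trace and norm of an integral element are rational integers. With
  \<open>2 * v = p / q\<close> in lowest terms they force \<open>q\<^sup>2\<close> to divide
  \<open>e\<close> with a quotient again 0 or 1 mod 4, so \<open>q = 1\<close> because
  \<open>e\<close> is fundamental. The parity condition treats even and odd \<open>e\<close>
  together.\<close>

lemma qfield_algebraic_int_iff:
  assumes e: "fund_disc e" and x: "x \<in> qfield s"
  shows "algebraic_int x \<longleftrightarrow> (\<exists>a b. x = (of_int a + of_int b * s) / 2 \<and> even (a - b * e))"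
proof
  assume "\<exists>a b. x = (of_int a + of_int b * s) / 2 \<and> even (a - b * e)"
  then obtain a b k where ab: "x = (of_int a + of_int b * s) / 2" and k: "a = b * e + 2 * k"
    by (metis add.commute diff_add_cancel evenE)
  \<comment> \<open>This divisibility makes the constant term of the quadratic equation of
    \<open>x\<close> an integer.\<close>
  have "4 dvd e * (e - 1)"
  proof -
    have "4 dvd e \<or> 4 dvd e - 1" using e unfolding fund_disc_def by (auto simp: mod_eq_dvd_iff[of e 4 1, simplified])
    then show ?thesis by auto
  qed
  then obtain l where l: "e * (e - 1) = 4 * l" by auto
  have "(2 * x - of_int a)\<^sup>2 = of_int (b\<^sup>2 * e)" by (simp add: ab power_mult_distrib s)
  moreover have "4 * (x\<^sup>2 + of_int (- a) * x) = (2 * x - of_int a)\<^sup>2 - of_int (a\<^sup>2)"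
    by (simp add: power2_eq_square algebra_simps)
  ultimately have "4 * (x\<^sup>2 + of_int (- a) * x) = of_int (b\<^sup>2 * e - a\<^sup>2)" by simp
  also have "b\<^sup>2 * e - a\<^sup>2 = 4 * - (b\<^sup>2 * l + b * e * k + k\<^sup>2)"
  proof -
    have "b\<^sup>2 * e - a\<^sup>2 = - (b\<^sup>2 * (e * (e - 1)) + 4 * (b * e * k) + 4 * k\<^sup>2)"
      unfolding k by (simp add: power2_eq_square algebra_simps)
    then show ?thesis unfolding l by (simp add: algebra_simps)
  qed
  finally have *: "4 * (x\<^sup>2 + of_int (- a) * x) = of_int (4 * - (b\<^sup>2 * l + b * e * k + k\<^sup>2))" .
  have "z + of_int m = 0" if "4 * z = of_int (4 * - m)" for z :: complex and m using that by simp
  from this[OF *] have "x\<^sup>2 + of_int (- a) * x + of_int (b\<^sup>2 * l + b * e * k + k\<^sup>2) = 0" .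
  then show "algebraic_int x" by (rule algebraic_int_quadratic)
next
  assume int: "algebraic_int x"
  obtain u v where x': "x = of_rat u + of_rat v * s" using x by (auto simp: qfield_def)
  have int': "algebraic_int (of_rat u - of_rat v * s)"
    using embedding_algebraic_int[OF is_subfield_qfield is_embedding_qconj x int] by (simp add: x' qconj_eq)
  have "x + (of_rat u - of_rat v * s) = of_rat (2 * u)" by (simp add: x' of_rat_mult)
  then have "algebraic_int (of_rat (2 * u) :: complex)" using algebraic_int_plus[OF int int'] by simp
  then obtain a where a: "2 * u = of_int a" unfolding algebraic_int_of_rat_iff by (auto elim: Ints_cases)
  have "x * (of_rat u - of_rat v * s) = of_rat (u * u - v * v * of_int e)"
    using qfield_mult[of u v u "- v"] by (simp add: x' of_rat_minus)
  then have "algebraic_int (of_rat (u * u - v * v * of_int e) :: complex)"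
    using algebraic_int_times[OF int int'] by simp
  then obtain n where n: "u * u - v * v * of_int e = of_int n"
    unfolding algebraic_int_of_rat_iff by (auto elim: Ints_cases)
  obtain p q where pq: "2 * v = Rat.Fract p q" "q > 0" "Rings.coprime p q" by (cases "2 * v") auto
  then have v: "2 * v * of_int q = of_int p" by (simp add: Fract_of_int_quotient)
  have "of_int (p\<^sup>2 * e) = (of_int (q\<^sup>2 * (a\<^sup>2 - 4 * n)) :: rat)"
    unfolding of_int_mult of_int_power of_int_diff v[symmetric] a[symmetric] n[symmetric]
    by (simp add: power2_eq_square algebra_simps)
  then have pe: "p\<^sup>2 * e = q\<^sup>2 * (a\<^sup>2 - 4 * n)" unfolding of_int_eq_iff .
  then have "q\<^sup>2 dvd p\<^sup>2 * e" by simp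
  moreover have "Rings.coprime (q\<^sup>2) (p\<^sup>2)" using pq(3) by (simp add: coprime_commute)
  ultimately have "q\<^sup>2 dvd e" using coprime_dvd_mult_right_iff by blast
  then obtain k where k: "e = q\<^sup>2 * k" by auto
  have pk: "p\<^sup>2 * k = a\<^sup>2 - 4 * n" using pe k pq(2) by auto
  \<comment> \<open>Either \<open>p\<close> is even, so \<open>q\<close> is odd and
    \<open>q\<^sup>2\<close> is 1 mod 4, or \<open>p\<close> is odd and \<open>k\<close> agrees mod
    4 with \<open>p\<^sup>2 * k\<close>, which is a square mod 4.\<close>
  have "k mod 4 \<in> {0, 1}"
  proof (cases "even p")
    case True
    then have "odd q" using pq(3) by (metis coprime_common_divisor odd_one)
    then have "q\<^sup>2 mod 4 = 1" by (rule square_mod_4)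
    then have "e mod 4 = k mod 4" unfolding k by (metis mod_mult_left_eq mult_1)
    then show ?thesis using e by (simp add: fund_disc_def)
  next
    case False
    then have "p\<^sup>2 mod 4 = 1" by (rule square_mod_4)
    then have "k mod 4 = p\<^sup>2 * k mod 4" by (metis mod_mult_left_eq mult_1)
    also have "\<dots> = a\<^sup>2 mod 4" unfolding pk by (simp add: mod_diff_eq[symmetric, of _ "4 * n"])
    finally show ?thesis using square_mod_4(1)[of a] by simp
  qed
  then have "q\<^sup>2 = 1" by (rule fund_discD[OF e k])
  then have "q = 1" using pq(2) by (simp add: power2_eq_1_iff)
  then have v: "2 * v = of_int p" using v by simp
  have "of_int a + of_int p * s = 2 * x"
  proof -
    have "of_int a = (of_rat (2 * u) :: complex)" "of_int p = (of_rat (2 * v) :: complex)" by (simp_all add: a v)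
    then show ?thesis by (simp add: x' of_rat_mult algebra_simps)
  qed
  moreover have "even (a - p * e)"
  proof -
    have "p\<^sup>2 * e = a\<^sup>2 - 4 * n" using pe \<open>q = 1\<close> by simp
    then have "even (p\<^sup>2 * e) = even (a\<^sup>2 - 4 * n)" by simp
    then show ?thesis by auto
  qed
  ultimately show "\<exists>a b. x = (of_int a + of_int b * s) / 2 \<and> even (a - b * e)"
    by (intro exI[of _ a] exI[of _ p]) simp
qed

end

lemma degree_independent_spans:
  assumes K: "field_of_degree n K" and B: "rat_space.independent B" "B \<subseteq> K" "finite B" "card B = n"
  shows "rat_space.span B = K"
proof
  show "rat_space.span B \<subseteq> K"
    using B is_subfield_rat_subspace[OF field_of_degree_is_subfield[OF K]] by (simp add: rat_space.span_minimal)
  show "K \<subseteq> rat_space.span B"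
  proof
    fix x assume x: "x \<in> K"
    obtain C where C: "rat_space.independent C" "rat_space.span C = K" "finite C" "card C = n"
      using field_of_degree_basis_exists[OF K] .
    show "x \<in> rat_space.span B"
    proof (rule ccontr)
      assume nin: "x \<notin> rat_space.span B"
      then have "rat_space.independent (insert x B)" using B(1) by (simp add: rat_space.independent_insertI)
      moreover have "insert x B \<subseteq> rat_space.span C" using x B(2) C(2) by simp
      ultimately have "card (insert x B) \<le> card C" using rat_space.independent_span_bound[OF C(3)] by blast
      moreover have "x \<notin> B" using nin rat_space.span_base[of x B] by blast
      ultimately show False using card_insert_disjoint[OF B(3)] B(4) C(4) by simp
    qed
  qed
qed

lemma rat_space_span_one: "rat_space.span {1} = \<rat>"
  by (auto simp: rat_space.span_singleton Rats_def)

lemma rat_space_span_one_insert: "rat_space.span {1, s} = qfield s"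
proof -
  have "x \<in> rat_space.span {1, s} \<longleftrightarrow> (\<exists>v. x - of_rat v * s \<in> \<rat>)" for x
    by (simp add: insert_commute[of 1 s] rat_space.span_breakdown_eq rat_space_span_one)
  also have "\<dots> x \<longleftrightarrow> x \<in> qfield s" for x
  proof
    assume "\<exists>v. x - of_rat v * s \<in> \<rat>"
    then obtain u v where "x - of_rat v * s = of_rat u" by (auto simp: Rats_def)
    then have "x = of_rat u + of_rat v * s" by (simp add: algebra_simps)
    then show "x \<in> qfield s" unfolding qfield_def by blast
  next
    assume "x \<in> qfield s"
    then obtain u v where "x = of_rat u + of_rat v * s" unfolding qfield_def by blast
    then have "x - of_rat v * s \<in> \<rat>" by simp
    then show "\<exists>v. x - of_rat v * s \<in> \<rat>" by blast
  qed
  finally show ?thesis by blast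
qed

lemma rat_space_independent_one_insert: "s \<notin> \<rat> \<Longrightarrow> rat_space.independent {1, s}"
  unfolding insert_commute[of 1 s]
  by (intro rat_space.independent_insertI) (simp_all add: rat_space_span_one rat_space.independent_empty)

lemma field_of_degree_irrational:
  assumes K: "field_of_degree n K" "n > 1"
  obtains \<theta> where "\<theta> \<in> K" "\<theta> \<notin> \<rat>"
proof -
  have "\<not> K \<subseteq> \<rat>"
  proof
    assume "K \<subseteq> \<rat>"
    then have "K \<subseteq> rat_space.span {1}" by (simp add: rat_space_span_one)
    then have "rat_space.dim K \<le> card {1::complex}" by (rule rat_space.dim_le_card) simp
    then show False using K by (simp add: field_of_degree_def)
  qed
  then show ?thesis using that by blast
qed

lemma det_mat_2: "det (mat 2 2 f) = f (0, 0) * f (1, 1) - f (0, 1) * f (1, 0)"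
  for f :: "nat \<times> nat \<Rightarrow> 'a :: comm_ring_1"
  by (subst laplace_expansion_row[of _ 2 0])
    (auto simp: numeral_2_eq_2 cofactor_def mat_delete_def det_single)

lemma det_mat_3: "det (mat 3 3 f) = f (0, 0) * (f (1, 1) * f (2, 2) - f (1, 2) * f (2, 1))
    - f (0, 1) * (f (1, 0) * f (2, 2) - f (1, 2) * f (2, 0))
    + f (0, 2) * (f (1, 0) * f (2, 1) - f (1, 1) * f (2, 0))"
  for f :: "nat \<times> nat \<Rightarrow> 'a :: comm_ring_1"
proof -
  have m: "mat_delete (mat 3 3 f) 0 j = mat 2 2 (\<lambda>(i', j'). f (Suc i', if j' < j then j' else Suc j'))"
    if "j < 3" for j
    using that by (intro eq_matI) (auto simp: mat_delete_def numeral_3_eq_3 numeral_2_eq_2)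
  have "det (mat 3 3 f) = (\<Sum>j<3. f (0, j) * cofactor (mat 3 3 f) 0 j)"
    by (subst laplace_expansion_row[of _ 3 0]) auto
  also have "\<dots> = (\<Sum>j\<in>{0,1,2}. f (0, j) * cofactor (mat 3 3 f) 0 j)"
    by (rule sum.cong) auto
  also have "\<dots> = f (0, 0) * cofactor (mat 3 3 f) 0 0 + f (0, 1) * cofactor (mat 3 3 f) 0 1
     + f (0, 2) * cofactor (mat 3 3 f) 0 2"
    by (simp add: add.assoc)
  finally have *: "det (mat 3 3 f) = f (0, 0) * cofactor (mat 3 3 f) 0 0
    + f (0, 1) * cofactor (mat 3 3 f) 0 1 + f (0, 2) * cofactor (mat 3 3 f) 0 2" .
  show ?thesis
    unfolding One_nat_def * cofactor_def m[of 0, simplified] m[of 1, simplified] m[of 2, simplified] det_mat_2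
    by (simp add: numeral_2_eq_2 algebra_simps)
qed

text \<open>Completing the square gives a root of \<open>v\<^sup>2 + 4 * u\<close>, and
  multiplication by \<open>q\<close> clears the denominator. The extra factor 2 makes
  \<open>s\<^sup>2\<close> a multiple of 4, so that \<open>s\<close> is admissible in the search for
  a minimal square that is 0 or 1 mod 4.\<close>

lemma quadratic_irrational_scaled:
  fixes \<theta> :: complex
  assumes \<theta>: "\<theta> \<notin> \<rat>" and uv: "\<theta>\<^sup>2 = of_rat u + of_rat v * \<theta>"
  obtains p q s where "s = 2 * of_int q * (2 * \<theta> - of_rat v)" "s\<^sup>2 = of_int (4 * p * q)" "s \<notin> \<rat>" "q \<noteq> 0"
proof -
  obtain p q where pq: "v\<^sup>2 + 4 * u = Rat.Fract p q" "q > 0" by (cases "v\<^sup>2 + 4 * u") auto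
  define s where "s = 2 * of_int q * (2 * \<theta> - of_rat v)"
  have "(2 * \<theta> - of_rat v)\<^sup>2 = of_rat (v\<^sup>2 + 4 * u)"
    by (simp add: power2_diff power_mult_distrib uv of_rat_add of_rat_mult of_rat_power algebra_simps)
  also have "\<dots> = of_int p / of_int q" using pq by (simp add: of_rat_rat)
  finally have "s\<^sup>2 = of_int (4 * p * q)"
    using pq(2) by (simp add: s_def power_mult_distrib) (simp add: power2_eq_square)
  moreover have "s \<notin> \<rat>"
  proof
    assume "s \<in> \<rat>"
    then have "(s / (2 * of_int q) + of_rat v) / 2 \<in> \<rat>" by simp
    moreover have "\<theta> = (s / (2 * of_int q) + of_rat v) / 2" using pq(2) by (simp add: s_def)
    ultimately have "\<theta> \<in> \<rat>" by (simp only:)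
    then show False using \<theta> by simp
  qed
  ultimately show ?thesis using that[of s q p] pq(2) by (simp add: s_def)
qed

text \<open>Among the irrational \<open>s\<close> in the field whose square is an integer 0 or 1 mod
  4, take one with the least absolute value of \<open>e = s\<^sup>2\<close>. Dividing
  \<open>s\<close> by integers shows that \<open>e\<close> is fundamental; then 1 and
  \<open>(e + s) / 2\<close> form an integral basis with Gram determinant \<open>e\<close>.\<close>

theorem fundamental_discriminant_imp_fund_disc:
  assumes "fundamental_discriminant d"
  shows "fund_disc d" "d \<noteq> 1"
proof -
  obtain F where F: "field_of_degree 2 F" and disc: "field_discriminant F = d"
    using assms by (auto simp: fundamental_discriminant_def)
  note sub = field_of_degree_is_subfield[OF F]
  note F' = is_subfieldD[OF sub]
  obtain \<theta> where \<theta>: "\<theta> \<in> F" "\<theta> \<notin> \<rat>" using field_of_degree_irrational[OF F] by auto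
  have span: "qfield s = F" if "s \<in> F" "s \<notin> \<rat>" for s
  proof -
    have "s \<noteq> 1" using that(2) by auto
    then have "rat_space.span {1, s} = F"
      by (intro degree_independent_spans[OF F] rat_space_independent_one_insert) (use that F' in auto)
    then show ?thesis by (simp add: rat_space_span_one_insert)
  qed
  have ex: "\<exists>e s. s \<in> F \<and> s \<notin> \<rat> \<and> s\<^sup>2 = of_int e \<and> e mod 4 \<in> {0, 1}"
  proof -
    have "\<theta>\<^sup>2 \<in> qfield \<theta>" using span[OF \<theta>] F' \<theta>(1) by simp
    then obtain u v where uv: "\<theta>\<^sup>2 = of_rat u + of_rat v * \<theta>" by (auto simp: qfield_def)
    obtain p q s where s: "s = 2 * of_int q * (2 * \<theta> - of_rat v)" "s\<^sup>2 = of_int (4 * p * q)" "s \<notin> \<rat>"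
      using quadratic_irrational_scaled[OF \<theta>(2) uv] by metis
    moreover have "s \<in> F" unfolding s(1) using F' \<theta> by simp
    ultimately show ?thesis by (intro exI[of _ "4 * p * q"] exI[of _ s]) (auto simp: mult.assoc)
  qed
  define P where "P e \<longleftrightarrow> (\<exists>s. s \<in> F \<and> s \<notin> \<rat> \<and> s\<^sup>2 = of_int e \<and> e mod 4 \<in> {0, 1})" for e
  have "\<exists>e. P e" using ex by (simp add: P_def)
  then obtain e where e: "P e" "\<And>e'. P e' \<Longrightarrow> nat \<bar>e\<bar> \<le> nat \<bar>e'\<bar>"
    using ex_has_least_nat[of P _ "\<lambda>e. nat \<bar>e\<bar>"] by blast
  obtain s where s: "s \<in> F" "s \<notin> \<rat>" "s\<^sup>2 = of_int e" "e mod 4 \<in> {0, 1}" using e(1) by (auto simp: P_def)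
  have "e \<noteq> 0" using s(2,3) by auto
  have fund: "fund_disc e"
    unfolding fund_disc_def
  proof (intro conjI allI impI)
    fix m k assume mk: "e = m\<^sup>2 * k \<and> k mod 4 \<in> {0, 1}"
    then have m: "m \<noteq> 0" "k \<noteq> 0" using \<open>e \<noteq> 0\<close> by auto
    have "(s / of_int m)\<^sup>2 = of_int k" using s(3) mk m(1) by (simp add: power_divide field_simps)
    moreover have "s / of_int m \<notin> \<rat>"
    proof
      assume "s / of_int m \<in> \<rat>"
      then have "s / of_int m * of_int m \<in> \<rat>" by (intro Rats_mult) auto
      then show False using s(2) m(1) by simp
    qed
    ultimately have "P k" using mk s(1) F' unfolding P_def by (intro exI[of _ "s / of_int m"]) auto
    then have "\<bar>e\<bar> \<le> \<bar>k\<bar>" using e(2)[of k] by simp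
    then have "m\<^sup>2 * \<bar>k\<bar> \<le> 1 * \<bar>k\<bar>" using mk by (simp add: abs_mult)
    then have "m\<^sup>2 \<le> 1" using m(2) by simp
    moreover have "m\<^sup>2 > 0" using m(1) by simp
    ultimately show "m\<^sup>2 = 1" by linarith
  qed (use s in auto)
  have Fs: "F = qfield s" using span s by simp
  have tr_s: "field_trace F s = 0"
  proof -
    have B: "rat_space.independent {1, s}" "rat_space.span {1, s} = F"
      using rat_space_independent_one_insert[OF s(2)] rat_space_span_one_insert Fs by auto
    have "s \<noteq> 1" using s(2) by auto
    have "rat_space.representation {1, s} (s * s) s
        = of_int e * rat_space.representation {1, s} 1 s"
      using s(3) rat_space.representation_scale[OF B(1), of 1 "of_int e"] F'(1) B(2)
      by (simp add: power2_eq_square)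
    then show ?thesis
      using field_trace_eq[OF F B s(1)] \<open>s \<noteq> 1\<close>
      by (simp add: rat_space.representation_basis[OF B(1)])
  qed
  \<comment> \<open>Adding \<open>e\<close> itself instead of 0 or 1 gives one generator for both
    residues of \<open>e\<close> mod 4.\<close>
  define w where "w = (of_int e + s) / 2"
  have basis: "Z_basis [1, w] (ring_of_integers F)"
    unfolding Z_basis_pair_iff
  proof (intro conjI allI impI)
    fix m n assume "of_int m * 1 + of_int n * w = 0"
    moreover have "of_rat (of_int m + of_int n * of_int e / 2) + of_rat (of_int n / 2) * s
        = of_int m * 1 + of_int n * w"
      by (simp add: w_def of_rat_add of_rat_mult of_rat_divide add_divide_distrib distrib_left)
    ultimately have "of_rat (of_int m + of_int n * of_int e / 2) + of_rat (of_int n / 2) * s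
        = of_rat 0 + of_rat 0 * s" by simp
    then show "m = 0" "n = 0" unfolding of_rat_add_mult_eq_iff[OF s(2)] by auto
  next
    show "ring_of_integers F = {of_int m * 1 + of_int n * w | m n. True}"
    proof (intro equalityI subsetI)
      fix x assume "x \<in> ring_of_integers F"
      then obtain a b where ab: "x = (of_int a + of_int b * s) / 2" "even (a - b * e)"
        using qfield_algebraic_int_iff[OF s(3,2) fund, of x] Fs unfolding ring_of_integers_def by blast
      then obtain k where "a = b * e + 2 * k" by (metis add.commute diff_add_cancel evenE)
      then have "x = of_int k * 1 + of_int b * w" by (simp add: ab w_def field_simps)
      then show "x \<in> {of_int m * 1 + of_int n * w | m n. True}" by blast
    next
      fix x assume "x \<in> {of_int m * 1 + of_int n * w | m n. True}"
      then obtain m n where "x = of_int m + of_int n * w" by auto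
      then have x: "x = (of_int (2 * m + n * e) + of_int n * s) / 2" by (simp add: w_def field_simps)
      have "x \<in> F" unfolding x using F' s by simp
      moreover have "\<exists>a b. x = (of_int a + of_int b * s) / 2 \<and> even (a - b * e)"
        using x by (intro exI[of _ "2 * m + n * e"] exI[of _ n] conjI) simp_all
      ultimately show "x \<in> ring_of_integers F"
        using qfield_algebraic_int_iff[OF s(3,2) fund, of x] Fs by (simp add: ring_of_integers_def)
    qed
  qed
  have tr: "field_trace F (of_rat u + of_rat v * s) = 2 * u" for u v
    using field_trace_add[OF F, of "of_rat u" "of_rat v * s"] F' s(1) tr_s
      field_trace_scale[OF F, of 1 u] field_trace_scale[OF F s(1), of v] field_trace_one[OF F] by simp
  have "w = of_rat (of_int e / 2) + of_rat (1 / 2) * s"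
    by (simp add: w_def of_rat_divide add_divide_distrib)
  then have trw: "field_trace F w = of_int e" using tr[of "of_int e / 2" "1 / 2"] by simp
  have "w * w = of_rat ((of_int e ^ 2 + of_int e) / 4) + of_rat (of_int e / 2) * s"
  proof -
    have "w * w = (of_int e ^ 2 + s\<^sup>2) / 4 + of_int e / 2 * s"
      by (simp add: w_def power2_eq_square field_simps)
    then show ?thesis by (simp add: s(3) of_rat_divide of_rat_add of_rat_power)
  qed
  then have trww: "field_trace F (w * w) = (of_int e ^ 2 + of_int e) / 2" using tr by simp
  have "field_discriminant F = e"
    by (rule field_discriminant_eq[OF F basis])
      (simp add: numeral_2_eq_2[symmetric] det_mat_2 trw trww field_trace_one[OF F] power2_eq_square)
  then show "fund_disc d" "d \<noteq> 1" using disc fund s(2,3) by (auto simp: power2_eq_1_iff)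
qed

section \<open>Embeddings of cubic fields\<close>

text \<open>A degree argument done by hand: otherwise \<open>K\<close> would contain an irrational
  square root \<open>s\<close> of an integer, and for \<kappa> in \<open>K\<close> outside the
  quadratic field the four elements 1, s, \<kappa>, \<kappa> s would be independent in a space of
  dimension 3.\<close>

lemma cubic_square_notin_qfield:
  assumes K: "field_of_degree 3 K" and \<theta>: "\<theta> \<in> K" "\<theta> \<notin> \<rat>"
  shows "\<theta>\<^sup>2 \<notin> qfield \<theta>"
proof
  assume "\<theta>\<^sup>2 \<in> qfield \<theta>"
  then obtain u v where uv: "\<theta>\<^sup>2 = of_rat u + of_rat v * \<theta>" by (auto simp: qfield_def)
  obtain p q s where s: "s = 2 * of_int q * (2 * \<theta> - of_rat v)" "s\<^sup>2 = of_int (4 * p * q)" "s \<notin> \<rat>"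
    using quadratic_irrational_scaled[OF \<theta>(2) uv] by metis
  note K' = is_subfieldD[OF field_of_degree_is_subfield[OF K]]
  note F = is_subfieldD[OF is_subfield_qfield[OF s(2,3)]]
  have sK: "s \<in> K" unfolding s(1) using K' \<theta> by simp
  then have s1: "s \<noteq> 1" using s(3) by auto
  have sF: "s \<in> qfield s" using rat_space.span_base[of s "{1, s}"] by (simp add: rat_space_span_one_insert)
  have ind: "rat_space.independent {1, s}" using rat_space_independent_one_insert[OF s(3)] .
  have "\<not> K \<subseteq> qfield s"
  proof
    assume "K \<subseteq> qfield s"
    then have "rat_space.dim K \<le> card {1, s}"
      by (intro rat_space.dim_le_card) (simp_all add: rat_space_span_one_insert)
    also have "\<dots> \<le> 2" by (rule card_insert_le_m1) auto
    finally show False using K by (simp add: field_of_degree_def)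
  qed
  then obtain \<kappa> where \<kappa>: "\<kappa> \<in> K" "\<kappa> \<notin> qfield s" by blast
  have notin: "\<kappa> * s \<notin> rat_space.span (insert \<kappa> {1, s})"
  proof
    assume "\<kappa> * s \<in> rat_space.span (insert \<kappa> {1, s})"
    then obtain t where "\<kappa> * s - of_rat t * \<kappa> \<in> qfield s"
      using rat_space.span_breakdown_eq[of "\<kappa> * s" \<kappa> "{1, s}"] by (auto simp: rat_space_span_one_insert)
    then have "(\<kappa> * s - of_rat t * \<kappa>) / (s - of_rat t) \<in> qfield s"
      using F(8)[OF _ F(7)[OF sF F(11)]] by blast
    moreover have "s - of_rat t \<noteq> 0" using s(3) by auto
    moreover have "\<kappa> * s - of_rat t * \<kappa> = \<kappa> * (s - of_rat t)" by (simp add: algebra_simps)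
    ultimately show False using \<kappa>(2) by simp
  qed
  have ind4: "rat_space.independent (insert (\<kappa> * s) (insert \<kappa> {1, s}))"
    using rat_space.independent_insertI[OF notin rat_space.independent_insertI[OF _ ind]] \<kappa>(2)
    by (simp add: rat_space_span_one_insert)
  have card: "card (insert (\<kappa> * s) (insert \<kappa> {1, s})) = 4"
  proof -
    have "\<kappa> \<notin> {1, s}" using \<kappa>(2) F(1) sF by auto
    moreover have "\<kappa> * s \<notin> insert \<kappa> {1, s}" using contra_subsetD[OF rat_space.span_superset notin] .
    ultimately show ?thesis using s1 by (simp add: card_insert_if)
  qed
  obtain C where C: "rat_space.independent C" "rat_space.span C = K" "finite C" "card C = 3"
    using field_of_degree_basis_exists[OF K] .
  have "insert (\<kappa> * s) (insert \<kappa> {1, s}) \<subseteq> rat_space.span C" using C(2) K' \<kappa>(1) sK by simp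
  then show False using rat_space.independent_span_bound[OF C(3) ind4] card C(4) by simp
qed

text \<open>The inequalities in \<open>distinct\<close> say that
  \<open>{1, \<theta>, \<theta>\<^sup>2}\<close> really has three elements, so that sums over this
  set and values of \<open>representation\<close> at its members can be expanded.\<close>

locale cubic_generator =
  fixes K :: "complex set" and \<theta> :: complex and c0 c1 c2 :: rat
  assumes deg: "field_of_degree 3 K" and gen: "\<theta> \<in> K"
    and distinct: "\<theta> \<noteq> 1" "\<theta>\<^sup>2 \<noteq> 1" "\<theta>\<^sup>2 \<noteq> \<theta>"
    and basis: "rat_space.independent {1, \<theta>, \<theta>\<^sup>2}" "rat_space.span {1, \<theta>, \<theta>\<^sup>2} = K"
    and cubic: "\<theta> ^ 3 = of_rat c0 + of_rat c1 * \<theta> + of_rat c2 * \<theta>\<^sup>2"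
begin

lemma sub: "is_subfield K"
  by (rule field_of_degree_is_subfield[OF deg])

lemmas K_closed = is_subfieldD[OF sub]

definition elt :: "complex \<Rightarrow> rat \<Rightarrow> rat \<Rightarrow> rat \<Rightarrow> complex"
  where "elt t q0 q1 q2 = of_rat q0 + of_rat q1 * t + of_rat q2 * t\<^sup>2"

lemma elt_in: "elt \<theta> q0 q1 q2 \<in> K"
  unfolding elt_def by (intro K_closed gen)

lemma representation_elt:
  "rat_space.representation {1, \<theta>, \<theta>\<^sup>2} (elt \<theta> q0 q1 q2) 1 = q0"
  "rat_space.representation {1, \<theta>, \<theta>\<^sup>2} (elt \<theta> q0 q1 q2) \<theta> = q1"
  "rat_space.representation {1, \<theta>, \<theta>\<^sup>2} (elt \<theta> q0 q1 q2) (\<theta>\<^sup>2) = q2"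
proof -
  let ?r = "rat_space.representation {1, \<theta>, \<theta>\<^sup>2}"
  have mem: "of_rat q \<in> rat_space.span {1, \<theta>, \<theta>\<^sup>2}" "of_rat q * \<theta> \<in> rat_space.span {1, \<theta>, \<theta>\<^sup>2}"
    "of_rat q * \<theta>\<^sup>2 \<in> rat_space.span {1, \<theta>, \<theta>\<^sup>2}" for q
    using K_closed gen basis(2) by simp_all
  have one: "?r (of_rat q) b = q * ?r 1 b" for q b
    using rat_space.representation_scale[OF basis(1), of 1 q] K_closed(1) basis(2) by simp
  have eq: "?r (elt \<theta> q0 q1 q2) b = q0 * ?r 1 b + q1 * ?r \<theta> b + q2 * ?r (\<theta>\<^sup>2) b" for b
    unfolding elt_def using mem K_closed gen basis(2)
    by (simp add: rat_space.representation_add[OF basis(1)] rat_space.representation_scale[OF basis(1)] one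
        rat_space.span_add)
  show "?r (elt \<theta> q0 q1 q2) 1 = q0" "?r (elt \<theta> q0 q1 q2) \<theta> = q1" "?r (elt \<theta> q0 q1 q2) (\<theta>\<^sup>2) = q2"
    unfolding eq using distinct by (simp_all add: rat_space.representation_basis[OF basis(1)])
qed

lemma elt_eq_iff: "elt \<theta> q0 q1 q2 = elt \<theta> r0 r1 r2 \<longleftrightarrow> q0 = r0 \<and> q1 = r1 \<and> q2 = r2"
  using representation_elt[of q0 q1 q2] representation_elt[of r0 r1 r2] by auto

lemma elt_exists:
  assumes "x \<in> K"
  obtains q0 q1 q2 where "x = elt \<theta> q0 q1 q2"
proof -
  have "x \<in> rat_space.span (insert (\<theta>\<^sup>2) {1, \<theta>})"
    using assms basis(2) by (simp add: insert_commute)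
  then obtain q2 where "x - of_rat q2 * \<theta>\<^sup>2 \<in> qfield \<theta>"
    using rat_space.span_breakdown_eq[of x "\<theta>\<^sup>2" "{1, \<theta>}"] by (auto simp: rat_space_span_one_insert)
  then obtain q0 q1 where "x - of_rat q2 * \<theta>\<^sup>2 = of_rat q0 + of_rat q1 * \<theta>" by (auto simp: qfield_def)
  then have "x = elt \<theta> q0 q1 q2" unfolding elt_def by (simp only: diff_eq_eq)
  then show ?thesis using that by blast
qed

lemma elt_add: "elt t q0 q1 q2 + elt t r0 r1 r2 = elt t (q0 + r0) (q1 + r1) (q2 + r2)"
  by (simp add: elt_def of_rat_add distrib_right)

text \<open>After reduction of the third and fourth power, the structure constants depend only on
  the cubic relation. Used for \<theta> and for any other root \<open>t\<close> of the same cubic,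
  this is what makes the substitution of \<open>t\<close> for \<theta> multiplicative.\<close>

lemma elt_mult:
  assumes t: "t ^ 3 = elt t c0 c1 c2"
  shows "elt t q0 q1 q2 * elt t r0 r1 r2 = elt t
    (q0 * r0 + (q1 * r2 + q2 * r1) * c0 + q2 * r2 * (c2 * c0))
    (q0 * r1 + q1 * r0 + (q1 * r2 + q2 * r1) * c1 + q2 * r2 * (c0 + c2 * c1))
    (q0 * r2 + q1 * r1 + q2 * r0 + (q1 * r2 + q2 * r1) * c2 + q2 * r2 * (c1 + c2 * c2))"
proof -
  have "t * elt t c0 c1 c2 = of_rat c0 * t + of_rat c1 * t\<^sup>2 + of_rat c2 * t ^ 3"
    unfolding elt_def by (simp add: power2_eq_square power3_eq_cube algebra_simps)
  also have "\<dots> = elt t (c2 * c0) (c0 + c2 * c1) (c1 + c2 * c2)"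
    unfolding t elt_def of_rat_add of_rat_mult distrib_left distrib_right by (simp only: ac_simps)
  finally have t4: "t * t ^ 3 = elt t (c2 * c0) (c0 + c2 * c1) (c1 + c2 * c2)"
    unfolding t .
  have "elt t q0 q1 q2 * elt t r0 r1 r2 =
    elt t (q0 * r0) (q0 * r1 + q1 * r0) (q0 * r2 + q1 * r1 + q2 * r0)
    + of_rat (q1 * r2 + q2 * r1) * t ^ 3 + of_rat (q2 * r2) * (t * t ^ 3)"
    by (simp add: elt_def of_rat_add of_rat_mult power2_eq_square power3_eq_cube algebra_simps)
  then show ?thesis
    unfolding t4 unfolding t elt_def of_rat_add of_rat_mult distrib_left distrib_right
    by (simp only: ac_simps)
qed

definition emb :: "complex \<Rightarrow> complex \<Rightarrow> complex"
  where "emb t x = (THE y. \<exists>q0 q1 q2. x = elt \<theta> q0 q1 q2 \<and> y = elt t q0 q1 q2)"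

lemma emb_elt: "emb t (elt \<theta> q0 q1 q2) = elt t q0 q1 q2"
  unfolding emb_def by (rule the_equality) (auto simp: elt_eq_iff)

lemma generator_cubic: "\<theta> ^ 3 = elt \<theta> c0 c1 c2"
  by (simp add: cubic elt_def)

lemma is_embedding_emb:
  assumes t: "t ^ 3 = elt t c0 c1 c2"
  shows "is_embedding K (emb t)"
  unfolding is_embedding_def
proof (intro conjI ballI)
  show "emb t 1 = 1" using emb_elt[of t 1 0 0] by (simp add: elt_def)
next
  fix x y assume "x \<in> K" "y \<in> K"
  then obtain q0 q1 q2 r0 r1 r2 where xy: "x = elt \<theta> q0 q1 q2" "y = elt \<theta> r0 r1 r2"
    using elt_exists by metis
  show "emb t (x + y) = emb t x + emb t y" unfolding xy elt_add emb_elt ..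
  show "emb t (x * y) = emb t x * emb t y"
    unfolding xy elt_mult[OF generator_cubic] emb_elt elt_mult[OF t] ..
qed

text \<open>The three coefficients are the power sums tr 1, tr \<theta> and tr \<theta>^2, read off
  from the diagonals of the multiplication matrices.\<close>

lemma trace_elt: "field_trace K (elt \<theta> q0 q1 q2) = 3 * q0 + c2 * q1 + (c2\<^sup>2 + 2 * c1) * q2"
proof -
  have tr: "field_trace K x = rat_space.representation {1, \<theta>, \<theta>\<^sup>2} x 1
      + rat_space.representation {1, \<theta>, \<theta>\<^sup>2} (x * \<theta>) \<theta>
      + rat_space.representation {1, \<theta>, \<theta>\<^sup>2} (x * \<theta>\<^sup>2) (\<theta>\<^sup>2)" if "x \<in> K" for x
    using field_trace_eq[OF deg basis that] distinct by (simp add: add.assoc)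
  have m: "elt \<theta> q0 q1 q2 * \<theta> = elt \<theta> q0 q1 q2 * elt \<theta> 0 1 0"
    "elt \<theta> q0 q1 q2 * \<theta>\<^sup>2 = elt \<theta> q0 q1 q2 * elt \<theta> 0 0 1" by (simp_all add: elt_def)
  show ?thesis
    unfolding tr[OF elt_in] m elt_mult[OF generator_cubic] representation_elt
    by (simp add: power2_eq_square algebra_simps)
qed

end

text \<open>One root comes from the fundamental theorem of algebra, the other two from the quadratic
  formula for the remaining factor. Stating the conclusion in symmetric functions counts roots with
  multiplicity.\<close>

lemma complex_cubic_roots:
  fixes a b c :: complex
  obtains t1 t2 t3 where "t1 + t2 + t3 = a" "t1 * t2 + t1 * t3 + t2 * t3 = b" "t1 * t2 * t3 = c"
proof -
  have "\<not> constant (poly [:- c, b, - a, 1:])"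
    by (subst constant_degree) simp
  then obtain t1 where "poly [:- c, b, - a, 1:] t1 = 0"
    using fundamental_theorem_of_algebra by blast
  then have t1: "c = t1 * (b - t1 * (a - t1))" by (simp add: algebra_simps)
  define S where "S = a - t1"
  define Q where "Q = b - t1 * S"
  define r where "r = csqrt (S\<^sup>2 - 4 * Q)"
  have r: "r * r = S * S - 4 * Q" by (simp add: r_def flip: power2_eq_square)
  have sum: "(S + r) / 2 + (S - r) / 2 = S" by (simp add: field_simps)
  have "(S + r) / 2 * ((S - r) / 2) = (S * S - r * r) / 4" by (simp add: field_simps)
  then have prod: "(S + r) / 2 * ((S - r) / 2) = Q" unfolding r by simp
  show ?thesis
  proof (rule that[of t1 "(S + r) / 2" "(S - r) / 2"])
    show "t1 + (S + r) / 2 + (S - r) / 2 = a" using sum by (simp add: S_def add.assoc)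
    have "t1 * ((S + r) / 2) + t1 * ((S - r) / 2) = t1 * S"
      using sum by (metis distrib_left)
    then show "t1 * ((S + r) / 2) + t1 * ((S - r) / 2) + (S + r) / 2 * ((S - r) / 2) = b"
      unfolding prod by (simp add: Q_def)
    show "t1 * ((S + r) / 2) * ((S - r) / 2) = c"
      using prod t1 by (simp add: mult.assoc Q_def S_def)
  qed
qed

text \<open>The trace identity ties the three embeddings together: applied to powers of
  \<open>x\<close>, it gives the power sums, and hence all symmetric functions, of the conjugates of
  \<open>x\<close> as rational numbers.\<close>

locale cubic_embeddings =
  fixes K :: "complex set" and \<sigma>1 \<sigma>2 \<sigma>3 :: "complex \<Rightarrow> complex"
  assumes deg: "field_of_degree 3 K"
    and emb1: "is_embedding K \<sigma>1" and emb2: "is_embedding K \<sigma>2" and emb3: "is_embedding K \<sigma>3"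
    and trace: "x \<in> K \<Longrightarrow> of_rat (field_trace K x) = \<sigma>1 x + \<sigma>2 x + \<sigma>3 x"

text \<open>The embeddings substitute the complex roots of the cubic equation of \<theta>. Roots and
  coordinates are exported as well, because the reality of the embeddings is later read off from the
  discriminant of this cubic.\<close>

theorem cubic_embeddings_exist:
  assumes K: "field_of_degree 3 K"
  obtains \<sigma>1 \<sigma>2 \<sigma>3 t1 t2 t3 c0 c1 c2 \<theta> where "cubic_embeddings K \<sigma>1 \<sigma>2 \<sigma>3"
    "cubic_generator K \<theta> c0 c1 c2"
    "t1 + t2 + t3 = of_rat c2" "t1 * t2 + t1 * t3 + t2 * t3 = of_rat (- c1)" "t1 * t2 * t3 = of_rat c0"
    "\<And>x. x \<in> K \<Longrightarrow> \<exists>q0 q1 q2. x = of_rat q0 + of_rat q1 * \<theta> + of_rat q2 * \<theta>\<^sup>2 \<and>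
      \<sigma>1 x = of_rat q0 + of_rat q1 * t1 + of_rat q2 * t1\<^sup>2 \<and>
      \<sigma>2 x = of_rat q0 + of_rat q1 * t2 + of_rat q2 * t2\<^sup>2 \<and>
      \<sigma>3 x = of_rat q0 + of_rat q1 * t3 + of_rat q2 * t3\<^sup>2"
proof -
  note K' = is_subfieldD[OF field_of_degree_is_subfield[OF K]]
  obtain \<theta> where \<theta>: "\<theta> \<in> K" "\<theta> \<notin> \<rat>" using field_of_degree_irrational[OF K] by auto
  have sq: "\<theta>\<^sup>2 \<notin> rat_space.span {1, \<theta>}"
    using cubic_square_notin_qfield[OF K \<theta>] by (simp add: rat_space_span_one_insert)
  have ne: "\<theta> \<noteq> 1" "\<theta>\<^sup>2 \<noteq> 1" "\<theta>\<^sup>2 \<noteq> \<theta>"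
    using \<theta>(2) sq rat_space.span_base[of _ "{1, \<theta>}"] by auto
  have perm: "{1, \<theta>, \<theta>\<^sup>2} = insert (\<theta>\<^sup>2) {1, \<theta>}" by auto
  have ind: "rat_space.independent {1, \<theta>, \<theta>\<^sup>2}"
    unfolding perm using rat_space.independent_insertI[OF sq rat_space_independent_one_insert[OF \<theta>(2)]] .
  have span: "rat_space.span {1, \<theta>, \<theta>\<^sup>2} = K"
    by (rule degree_independent_spans[OF K ind]) (use ne \<theta> K' in auto)
  have "\<theta> ^ 3 \<in> rat_space.span (insert (\<theta>\<^sup>2) {1, \<theta>})" using span K' \<theta> by (simp add: perm)
  then obtain c2 where "\<theta> ^ 3 - of_rat c2 * \<theta>\<^sup>2 \<in> qfield \<theta>"
    using rat_space.span_breakdown_eq[of "\<theta> ^ 3" "\<theta>\<^sup>2" "{1, \<theta>}"] by (auto simp: rat_space_span_one_insert)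
  then obtain c0 c1 where "\<theta> ^ 3 - of_rat c2 * \<theta>\<^sup>2 = of_rat c0 + of_rat c1 * \<theta>" by (auto simp: qfield_def)
  then have c: "\<theta> ^ 3 = of_rat c0 + of_rat c1 * \<theta> + of_rat c2 * \<theta>\<^sup>2" by (simp only: diff_eq_eq)
  interpret cubic_generator K \<theta> c0 c1 c2
    by unfold_locales (use K \<theta> ne ind span c in auto)
  obtain t1 t2 t3 :: complex where t: "t1 + t2 + t3 = of_rat c2" "t1 * t2 + t1 * t3 + t2 * t3 = of_rat (- c1)"
    "t1 * t2 * t3 = of_rat c0"
    using complex_cubic_roots[of "of_rat c2" "of_rat (- c1)" "of_rat c0"] by metis
  have c1: "of_rat c1 = - (t1 * t2 + t1 * t3 + t2 * t3)" using t(2) by (simp add: of_rat_minus)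
  have root: "t1 ^ 3 = elt t1 c0 c1 c2" "t2 ^ 3 = elt t2 c0 c1 c2" "t3 ^ 3 = elt t3 c0 c1 c2"
    unfolding elt_def c1 t(1)[symmetric] t(3)[symmetric]
    by (simp_all add: power2_eq_square power3_eq_cube algebra_simps)
  have emb: "is_embedding K (emb t1)" "is_embedding K (emb t2)" "is_embedding K (emb t3)"
    using root by (simp_all add: is_embedding_emb)
  have "cubic_embeddings K (emb t1) (emb t2) (emb t3)"
  proof
    fix x assume "x \<in> K"
    then obtain q0 q1 q2 where x: "x = elt \<theta> q0 q1 q2" using elt_exists by blast
    have "t1\<^sup>2 + t2\<^sup>2 + t3\<^sup>2 = (t1 + t2 + t3)\<^sup>2 - 2 * (t1 * t2 + t1 * t3 + t2 * t3)"
      by (simp add: power2_eq_square algebra_simps)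
    then have sq: "t1\<^sup>2 + t2\<^sup>2 + t3\<^sup>2 = of_rat (c2\<^sup>2 + 2 * c1)"
      unfolding t by (simp add: of_rat_add of_rat_minus of_rat_mult of_rat_power)
    have "emb t1 x + emb t2 x + emb t3 x = 3 * of_rat q0 + of_rat q1 * (t1 + t2 + t3)
      + of_rat q2 * (t1\<^sup>2 + t2\<^sup>2 + t3\<^sup>2)"
      unfolding x emb_elt unfolding elt_def by (simp add: algebra_simps)
    then show "of_rat (field_trace K x) = emb t1 x + emb t2 x + emb t3 x"
      unfolding sq t x trace_elt by (simp add: of_rat_add of_rat_mult mult.commute)
  qed (use K emb in auto)
  moreover have "\<exists>q0 q1 q2. x = of_rat q0 + of_rat q1 * \<theta> + of_rat q2 * \<theta>\<^sup>2 \<and>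
      emb t1 x = of_rat q0 + of_rat q1 * t1 + of_rat q2 * t1\<^sup>2 \<and>
      emb t2 x = of_rat q0 + of_rat q1 * t2 + of_rat q2 * t2\<^sup>2 \<and>
      emb t3 x = of_rat q0 + of_rat q1 * t3 + of_rat q2 * t3\<^sup>2" if "x \<in> K" for x
  proof -
    obtain q0 q1 q2 where x: "x = elt \<theta> q0 q1 q2" using elt_exists[OF \<open>x \<in> K\<close>] .
    then show ?thesis using emb_elt[of _ q0 q1 q2] unfolding elt_def by blast
  qed
  ultimately show ?thesis using that[OF _ cubic_generator_axioms t] by blast
qed

context cubic_embeddings
begin

lemma sub: "is_subfield K"
  by (rule field_of_degree_is_subfield[OF deg])

lemmas K_closed = is_subfieldD[OF sub]

lemmas simps1 = embedding_simps[OF sub emb1]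
lemmas simps2 = embedding_simps[OF sub emb2]
lemmas simps3 = embedding_simps[OF sub emb3]

lemma symmetric2:
  assumes x: "x \<in> K"
  shows "\<sigma>1 x * \<sigma>2 x + \<sigma>1 x * \<sigma>3 x + \<sigma>2 x * \<sigma>3 x
    = of_rat (((field_trace K x)\<^sup>2 - field_trace K (x\<^sup>2)) / 2)"
proof -
  have tx2: "of_rat (field_trace K (x\<^sup>2)) = (\<sigma>1 x)\<^sup>2 + (\<sigma>2 x)\<^sup>2 + (\<sigma>3 x)\<^sup>2"
    using trace[of "x\<^sup>2"] x K_closed by (simp add: simps1 simps2 simps3)
  show ?thesis
    unfolding of_rat_divide of_rat_diff of_rat_power tx2 trace[OF x]
    by (simp add: power2_eq_square algebra_simps)
qed

lemma symmetric3:
  assumes x: "x \<in> K"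
  shows "\<sigma>1 x * \<sigma>2 x * \<sigma>3 x = of_rat (((field_trace K x) ^ 3
    - 3 * field_trace K x * field_trace K (x\<^sup>2) + 2 * field_trace K (x ^ 3)) / 6)"
proof -
  have tx2: "of_rat (field_trace K (x\<^sup>2)) = (\<sigma>1 x)\<^sup>2 + (\<sigma>2 x)\<^sup>2 + (\<sigma>3 x)\<^sup>2"
    using trace[of "x\<^sup>2"] x K_closed by (simp add: simps1 simps2 simps3)
  have tx3: "of_rat (field_trace K (x ^ 3)) = (\<sigma>1 x) ^ 3 + (\<sigma>2 x) ^ 3 + (\<sigma>3 x) ^ 3"
    using trace[of "x ^ 3"] x K_closed by (simp add: simps1 simps2 simps3)
  show ?thesis
    unfolding of_rat_divide of_rat_diff of_rat_add of_rat_mult of_rat_power tx2 tx3 trace[OF x]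
    by (simp add: power2_eq_square power3_eq_cube algebra_simps)
qed

text \<open>This is the characteristic polynomial of \<open>x\<close>, with coefficients from
  Newton's identities. It is checked after applying \<sigma>1, where it factors over the three
  conjugates, and pulled back by injectivity.\<close>

lemma cubic_equation:
  assumes x: "x \<in> K"
  obtains e1 e2 e3 where "x ^ 3 + of_rat e1 * x\<^sup>2 + of_rat e2 * x + of_rat e3 = 0"
proof -
  define e1 where "e1 = - field_trace K x"
  define e2 where "e2 = ((field_trace K x)\<^sup>2 - field_trace K (x\<^sup>2)) / 2"
  define e3 where "e3 = - (((field_trace K x) ^ 3
    - 3 * field_trace K x * field_trace K (x\<^sup>2) + 2 * field_trace K (x ^ 3)) / 6)"
  have 1: "of_rat e1 = - (\<sigma>1 x + \<sigma>2 x + \<sigma>3 x)" unfolding e1_def of_rat_minus trace[OF x] ..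
  have 2: "of_rat e2 = \<sigma>1 x * \<sigma>2 x + \<sigma>1 x * \<sigma>3 x + \<sigma>2 x * \<sigma>3 x"
    unfolding e2_def symmetric2[OF x] ..
  have 3: "of_rat e3 = - (\<sigma>1 x * \<sigma>2 x * \<sigma>3 x)"
    unfolding e3_def of_rat_minus symmetric3[OF x] ..
  have "\<sigma>1 (x ^ 3 + of_rat e1 * x\<^sup>2 + of_rat e2 * x + of_rat e3)
      = \<sigma>1 x ^ 3 + of_rat e1 * (\<sigma>1 x)\<^sup>2 + of_rat e2 * \<sigma>1 x + of_rat e3"
    using x K_closed by (simp add: simps1)
  also have "\<dots> = 0"
    unfolding 1 2 3 by (simp add: power2_eq_square power3_eq_cube algebra_simps)
  finally have "\<sigma>1 (x ^ 3 + of_rat e1 * x\<^sup>2 + of_rat e2 * x + of_rat e3) = \<sigma>1 0"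
    by (simp only: simps1)
  moreover have "x ^ 3 + of_rat e1 * x\<^sup>2 + of_rat e2 * x + of_rat e3 \<in> K"
    by (intro K_closed x)
  ultimately have "x ^ 3 + of_rat e1 * x\<^sup>2 + of_rat e2 * x + of_rat e3 = 0"
    using embedding_eq_iff[OF sub emb1] K_closed(6) by blast
  then show ?thesis using that by blast
qed

lemma integer_multiple:
  assumes x: "x \<in> K"
  obtains N :: int where "N > 0" "of_int N * x \<in> ring_of_integers K"
proof -
  obtain e1 e2 e3 where e: "x ^ 3 + of_rat e1 * x\<^sup>2 + of_rat e2 * x + of_rat e3 = 0"
    using cubic_equation[OF x] .
  have den: "\<exists>N>0. \<exists>k. of_int N * e = of_int k" for e :: rat
  proof -
    obtain a b where "e = Rat.Fract a b" "b > 0" by (cases e) auto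
    then show ?thesis by (intro exI[of _ b]) (auto simp: Fract_of_int_quotient)
  qed
  obtain N1 k1 where 1: "N1 > 0" "of_int N1 * e1 = of_int k1" using den by blast
  obtain N2 k2 where 2: "N2 > 0" "of_int N2 * e2 = of_int k2" using den by blast
  obtain N3 k3 where 3: "N3 > 0" "of_int N3 * e3 = of_int k3" using den by blast
  define N where "N = N1 * N2 * N3"
  have N: "N > 0" using 1 2 3 by (simp add: N_def)
  have r: "of_rat (of_int N * e) = (of_int N * of_rat e :: complex)" for e by (simp add: of_rat_mult)
  have "of_int N * e1 = of_int (N2 * N3 * k1)" "of_int N * e2 = of_int (N1 * N3 * k2)"
    "of_int N * e3 = of_int (N1 * N2 * k3)"
    by (simp_all add: N_def 1(2)[symmetric] 2(2)[symmetric] 3(2)[symmetric] mult_ac)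
  then have e': "of_int N * of_rat e1 = (of_int (N2 * N3 * k1) :: complex)"
    "of_int N * of_rat e2 = (of_int (N1 * N3 * k2) :: complex)"
    "of_int N * of_rat e3 = (of_int (N1 * N2 * k3) :: complex)"
    unfolding r[symmetric] by (simp_all only: of_rat_of_int_eq)
  have "(of_int N * x) ^ 3 + of_int (N2 * N3 * k1) * (of_int N * x)\<^sup>2
      + of_int (N * (N1 * N3 * k2)) * (of_int N * x) + of_int (N\<^sup>2 * (N1 * N2 * k3))
    = of_int N ^ 3 * (x ^ 3 + of_rat e1 * x\<^sup>2 + of_rat e2 * x + of_rat e3)"
  proof -
    have "(n * x) ^ 3 + (n * a) * (n * x)\<^sup>2 + (n * (n * b)) * (n * x) + n\<^sup>2 * (n * c)
      = n ^ 3 * (x ^ 3 + a * x\<^sup>2 + b * x + c)" for n a b c :: complex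
      by (simp add: power2_eq_square power3_eq_cube algebra_simps)
    then show ?thesis
      unfolding of_int_mult[of N "N1 * N3 * k2"] of_int_mult[of "N\<^sup>2" "N1 * N2 * k3"] e'[symmetric]
        of_int_power by (simp only: mult.assoc)
  qed
  also have "\<dots> = 0" using e by simp
  finally have "algebraic_int (of_int N * x)" by (rule algebraic_int_cubic)
  then show ?thesis using that[of N] N x K_closed by (simp add: ring_of_integers_def)
qed

text \<open>The floor only produces the type \<open>int\<close>; on the ring of integers the trace
  is already integral.\<close>

definition int_trace :: "complex \<Rightarrow> int"
  where "int_trace x = \<lfloor>field_trace K x\<rfloor>"

lemma field_trace_eq_int:
  assumes "x \<in> ring_of_integers K"
  shows "field_trace K x = of_int (int_trace x)"
proof -
  have x: "x \<in> K" "algebraic_int x" using assms by (auto simp: ring_of_integers_def)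
  have "algebraic_int (of_rat (field_trace K x) :: complex)"
    unfolding trace[OF x(1)]
    by (intro algebraic_int_plus embedding_algebraic_int[OF sub emb1 x]
        embedding_algebraic_int[OF sub emb2 x] embedding_algebraic_int[OF sub emb3 x])
  then have "field_trace K x \<in> \<int>" unfolding algebraic_int_of_rat_iff .
  then show ?thesis by (auto simp: int_trace_def elim: Ints_cases)
qed

lemma int_trace: "x \<in> ring_of_integers K \<Longrightarrow> of_int (int_trace x) = \<sigma>1 x + \<sigma>2 x + \<sigma>3 x"
  using trace[of x] field_trace_eq_int[of x] by (simp add: ring_of_integers_def)

text \<open>At trace zero, half the trace of x^2 is minus the second elementary symmetric function
  of the conjugates, an algebraic integer. This is the source of the 2 in the scaling of the trace
  form.\<close>

lemma even_trace_square:
  assumes x: "x \<in> ring_of_integers K" and 0: "field_trace K x = 0"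
  shows "even (int_trace (x\<^sup>2))"
proof -
  have xK: "x \<in> K" "algebraic_int x" using x by (auto simp: ring_of_integers_def)
  have "x\<^sup>2 \<in> ring_of_integers K" using ring_of_integers_closed[OF sub] x by (simp add: power2_eq_square)
  then have eq: "((field_trace K x)\<^sup>2 - field_trace K (x\<^sup>2)) / 2 = - (of_int (int_trace (x\<^sup>2)) / 2)"
    using 0 by (simp add: field_trace_eq_int)
  have "algebraic_int (of_rat (- (of_int (int_trace (x\<^sup>2)) / 2)) :: complex)"
    unfolding eq[symmetric] symmetric2[OF xK(1), symmetric]
    by (intro algebraic_int_plus algebraic_int_times embedding_algebraic_int[OF sub emb1 xK]
        embedding_algebraic_int[OF sub emb2 xK] embedding_algebraic_int[OF sub emb3 xK])
  then have "- (of_int (int_trace (x\<^sup>2)) / 2) \<in> (\<int> :: rat set)" unfolding algebraic_int_of_rat_iff .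
  then obtain k where k: "- (of_int (int_trace (x\<^sup>2)) / 2) = (of_int k :: rat)" by (elim Ints_cases)
  have "(of_int (int_trace (x\<^sup>2)) :: rat) = of_int (- 2 * k)" unfolding of_int_mult k[symmetric] by simp
  then have "int_trace (x\<^sup>2) = - 2 * k" unfolding of_int_eq_iff .
  then show ?thesis by simp
qed

lemma int_trace_add:
  "x \<in> ring_of_integers K \<Longrightarrow> y \<in> ring_of_integers K \<Longrightarrow> int_trace (x + y) = int_trace x + int_trace y"
  and int_trace_scale: "x \<in> ring_of_integers K \<Longrightarrow> int_trace (of_int k * x) = k * int_trace x"
  and int_trace_one: "int_trace 1 = 3"
proof -
  show "int_trace (x + y) = int_trace x + int_trace y"
    if xy: "x \<in> ring_of_integers K" "y \<in> ring_of_integers K"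
  proof -
    have "of_int (int_trace (x + y)) = (of_int (int_trace x + int_trace y) :: rat)"
      using field_trace_add[OF deg, of x y] field_trace_eq_int[OF xy(1)] field_trace_eq_int[OF xy(2)]
        field_trace_eq_int[OF ring_of_integers_closed(1)[OF sub xy]] xy by (simp add: ring_of_integers_def)
    then show ?thesis unfolding of_int_eq_iff .
  qed
  show "int_trace (of_int k * x) = k * int_trace x" if x: "x \<in> ring_of_integers K"
  proof -
    have "of_int (int_trace (of_int k * x)) = (of_int (k * int_trace x) :: rat)"
      using field_trace_scale_int[OF deg, of x k] field_trace_eq_int[OF x]
        field_trace_eq_int[OF ring_of_integers_closed(2)[OF sub ring_of_integers_closed(4)[OF sub] x]] x
      by (simp add: ring_of_integers_def)
    then show ?thesis unfolding of_int_eq_iff .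
  qed
  show "int_trace 1 = 3" by (simp add: int_trace_def field_trace_one[OF deg])
qed

end

section \<open>The trace form of a cubic field\<close>

lemma mod_4_eq: "a = b + 4 * c \<Longrightarrow> a mod 4 = b mod 4" for a b c :: int
  by simp

text \<open>As \<open>3\<^sup>2\<close> is 1 mod 4, dividing by 9 would preserve the residue mod 4
  and contradict minimality.\<close>

lemma fund_disc_nine: "fund_disc d \<Longrightarrow> \<not> 9 dvd d"
proof
  assume d: "fund_disc d" "9 dvd d"
  then obtain k where "d = 9 * k" by auto
  then have k: "d = 3\<^sup>2 * k" and "d = k + 4 * (2 * k)" by simp_all
  then have "k mod 4 = d mod 4" using mod_4_eq by metis
  then have "k mod 4 \<in> {0, 1}" using d(1) by (simp add: fund_disc_def)
  from fund_discD[OF d(1) k this] show False by simp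
qed

lemma dvd_three_cases: "g dvd 3 \<Longrightarrow> g > 0 \<Longrightarrow> g = 1 \<or> g = 3" for g :: int
proof -
  assume g: "g dvd 3" "g > 0"
  then have "g \<le> 3" by (simp add: zdvd_imp_le)
  moreover have "g \<noteq> 2" using g(1) by auto
  ultimately show ?thesis using g(2) by linarith
qed

text \<open>Passing between \<open>d\<close> and \<open>D\<close> multiplies or divides by -3, which
  is 1 mod 4; so residues mod 4 persist, and a square factor of \<open>D\<close> becomes one of
  \<open>d\<close>. Exactly one of \<open>d\<close> and \<open>D\<close> is divisible by 3, and
  \<open>n\<close> records which.\<close>

lemma fund_disc_dual:
  assumes d: "fund_disc d"
  defines "n \<equiv> gcd 3 d" and "D \<equiv> (- 3 * d) div (gcd 3 d)\<^sup>2"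
  shows "n\<^sup>2 * D = - 3 * d" "fund_disc D" "n = 1 \<and> \<not> 3 dvd d \<and> D = - 3 * d \<or> n = 3 \<and> 3 dvd d \<and> d = - 3 * D \<and> \<not> 3 dvd D"
proof -
  have "n\<^sup>2 * D = - 3 * d \<and> fund_disc D \<and>
    (n = 1 \<and> \<not> 3 dvd d \<and> D = - 3 * d \<or> n = 3 \<and> 3 dvd d \<and> d = - 3 * D \<and> \<not> 3 dvd D)"
  proof (cases "3 dvd d")
    case True
    then obtain e where e: "d = 3 * e" by auto
    have n: "n = 3" using True by (simp add: n_def)
    then have D: "D = - e" by (simp add: D_def n_def[symmetric] e)
    have "\<not> 3 dvd e" using fund_disc_nine[OF d] by (auto simp: e)
    moreover have "fund_disc D"
      unfolding fund_disc_def
    proof (intro conjI allI impI)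
      have "D mod 4 = d mod 4" by (rule mod_4_eq[of _ _ "- e"]) (simp add: D e)
      then show "D mod 4 \<in> {0, 1}" using d by (simp add: fund_disc_def)
    next
      fix m k assume mk: "D = m\<^sup>2 * k \<and> k mod 4 \<in> {0, 1}"
      have "d = - 3 * D" using D e by simp
      also have "\<dots> = m\<^sup>2 * (- 3 * k)" by (subst conjunct1[OF mk]) simp
      finally have d': "d = m\<^sup>2 * (- 3 * k)" .
      have "(- 3 * k) mod 4 = k mod 4" by (rule mod_4_eq[of _ _ "- k"]) simp
      then show "m\<^sup>2 = 1" using fund_discD[OF d d'] mk by simp
    qed
    ultimately show ?thesis using n D e by simp
  next
    case False
    have "n dvd d" "n dvd 3" "n > 0" by (simp_all add: n_def)
    then have n: "n = 1" using dvd_three_cases[of n] False by auto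
    then have D: "D = - 3 * d" by (simp add: D_def n_def[symmetric])
    have "fund_disc D"
      unfolding fund_disc_def
    proof (intro conjI allI impI)
      have "D mod 4 = d mod 4" by (rule mod_4_eq[of _ _ "- d"]) (simp add: D)
      then show "D mod 4 \<in> {0, 1}" using d by (simp add: fund_disc_def)
    next
      fix m k assume mk: "D = m\<^sup>2 * k \<and> k mod 4 \<in> {0, 1}"
      \<comment> \<open>A factor 3 in \<open>m\<close> would make 9 divide \<open>3 * d\<close>;
        hence the 3 in \<open>D\<close> sits in \<open>k\<close> and can be removed there.\<close>
      have "\<not> 3 dvd m"
      proof
        assume "3 dvd m"
        then obtain l where "m = 3 * l" by auto
        then have "- d = 3 * (k * l\<^sup>2)" using mk D by (simp add: power_mult_distrib)
        then have "d = 3 * - (k * l\<^sup>2)" by linarith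
        then show False using False by simp
      qed
      moreover have "3 dvd m\<^sup>2 * k" using mk D by (metis dvd_minus_iff dvd_triv_left mult_minus_left)
      ultimately have "3 dvd k" by (simp add: prime_dvd_mult_iff prime_dvd_power_iff)
      then obtain l where l: "k = 3 * l" by auto
      then have "- d = l * m\<^sup>2" using mk D by simp
      then have d': "d = m\<^sup>2 * (- l)" by (simp add: mult.commute equation_minus_iff)
      have "(- l) mod 4 = k mod 4" by (rule mod_4_eq[of _ _ "- l"]) (simp add: l)
      then show "m\<^sup>2 = 1" using fund_discD[OF d d'] mk by simp
    qed
    then show ?thesis using n D False by simp
  qed
  then show "n\<^sup>2 * D = - 3 * d" "fund_disc D" "n = 1 \<and> \<not> 3 dvd d \<and> D = - 3 * d \<or> n = 3 \<and> 3 dvd d \<and> d = - 3 * D \<and> \<not> 3 dvd D"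
    by simp_all
qed

text \<open>A common divisor \<open>m\<close> of the coefficients takes \<open>m\<^sup>2\<close> out
  of the discriminant and leaves the discriminant of a form, which is a square mod 4.\<close>

lemma fund_disc_primitive_form:
  assumes "fund_disc (form_disc f)"
  shows "primitive_form f"
proof -
  obtain a b c where f: "f = (a, b, c)" by (cases f)
  define m where "m = Gcd {a, b, c}"
  have "m dvd a" "m dvd b" "m dvd c" unfolding m_def by (rule Gcd_dvd; simp)+
  then obtain a' b' c' where abc: "a = m * a'" "b = m * b'" "c = m * c'" by (auto elim!: dvdE)
  have "form_disc f = m\<^sup>2 * (b'\<^sup>2 - 4 * a' * c')"
    by (simp add: f abc power2_eq_square algebra_simps)
  moreover have "(b'\<^sup>2 - 4 * a' * c') mod 4 = b'\<^sup>2 mod 4"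
    using mod_mult_self2[of "b'\<^sup>2" 4 "- a' * c'"] by (simp add: algebra_simps)
  ultimately have "m\<^sup>2 = 1" using fund_discD[OF assms] square_mod_4(1)[of b'] by metis
  moreover have "m \<ge> 0" by (simp add: m_def)
  ultimately have "m = 1" by (simp add: power2_eq_1_iff)
  then show ?thesis by (simp add: f m_def)
qed

text \<open>With \<open>E\<close>, \<open>P\<close>, \<open>Q\<close> the traces of \<eta>^2, \<eta>
  \<beta>, \<eta> \<gamma>, the first three hypotheses say that \<open>(3, u, v)\<close> times the
  Gram matrix of \<eta>, \<beta>, \<gamma> is \<open>(1, 0, 0)\<close>. Cramer's rule expresses
  cofactors by \<open>d\<close>, and modulo 3 the entries \<open>A\<close> and \<open>C\<close>
  become multiples of \<open>d\<close>.\<close>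

lemma three_dvd_gram:
  fixes A B C E P Q u v d :: int
  assumes "3 * P + u * A + v * B = 0" "3 * Q + u * B + v * C = 0" "3 * E + u * P + v * Q = 1"
    and det: "A * C - B\<^sup>2 = 3 * d" and d: "3 dvd d"
  shows "3 dvd A" "3 dvd B" "3 dvd C"
proof -
  have "3 * (A * Q - B * P + d * v) = A * (3 * Q + u * B + v * C) - B * (3 * P + u * A + v * B)
      - v * (A * C - B\<^sup>2 - 3 * d)"
    by (simp add: power2_eq_square algebra_simps)
  \<comment> \<open>The cofactors of the first row of that Gram matrix are \<open>3 * d\<close>,
    \<open>d * u\<close> and \<open>d * v\<close>; this is the one belonging to
    \<open>v\<close>.\<close>
  then have 1: "A * Q - B * P + d * v = 0" using assms by simp
  have "3 * (C * P - B * Q + d * u) = C * (3 * P + u * A + v * B) - B * (3 * Q + u * B + v * C)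
      - u * (A * C - B\<^sup>2 - 3 * d)"
    by (simp add: power2_eq_square algebra_simps)
  then have 2: "C * P - B * Q + d * u = 0" using assms by simp
  have "A * (3 * E + u * P + v * Q) = 3 * (A * E - P\<^sup>2) - d * v\<^sup>2
      + P * (3 * P + u * A + v * B) + v * (A * Q - B * P + d * v)"
    by (simp add: power2_eq_square algebra_simps)
  then have "A = 3 * (A * E - P\<^sup>2) - d * v\<^sup>2" using 1 assms by simp
  then show A: "3 dvd A" using d by (metis dvd_diff dvd_mult2 dvd_triv_left)
  have "C * (3 * E + u * P + v * Q) = 3 * (C * E - Q\<^sup>2) - d * u\<^sup>2
      + Q * (3 * Q + u * B + v * C) + u * (C * P - B * Q + d * u)"
    by (simp add: power2_eq_square algebra_simps)
  then have "C = 3 * (C * E - Q\<^sup>2) - d * u\<^sup>2" using 2 assms by simp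
  then show "3 dvd C" using d by (metis dvd_diff dvd_mult2 dvd_triv_left)
  have "B\<^sup>2 = A * C - 3 * d" using det by simp
  then have "3 dvd B\<^sup>2" using A by simp
  then show "3 dvd B" by (simp add: prime_dvd_power_iff)
qed

section \<open>The rank-two lattice of trace-zero integers\<close>

context cubic_embeddings
begin

abbreviation "OK \<equiv> ring_of_integers K"
abbreviation "OK0 \<equiv> trace_zero_integers K"

lemmas OK_closed = ring_of_integers_closed[OF sub]

lemma OK_in_K: "x \<in> OK \<Longrightarrow> x \<in> K"
  by (simp add: ring_of_integers_def)

lemma OK0_iff: "x \<in> OK0 \<longleftrightarrow> x \<in> OK \<and> int_trace x = 0"
  by (auto simp: trace_zero_integers_def field_trace_eq_int)

lemma OK0_in_OK: "x \<in> OK0 \<Longrightarrow> x \<in> OK"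
  by (simp add: OK0_iff)

lemma int_trace_diff:
  assumes "x \<in> OK" "y \<in> OK" shows "int_trace (x - y) = int_trace x - int_trace y"
  using int_trace_add[of "x - y" y] assms OK_closed by simp

lemma int_trace_of_int: "int_trace (of_int k) = 3 * k"
  using int_trace_scale[of 1 k] OK_closed(5) by (simp add: int_trace_one)

lemma OK0_subspace: "int_module.subspace OK0"
proof (rule int_module.subspaceI)
  show "0 \<in> OK0" using int_trace_of_int[of 0] OK_closed(6) by (simp add: OK0_iff)
next
  fix x y assume "x \<in> OK0" "y \<in> OK0"
  then show "x + y \<in> OK0" using OK_closed by (simp add: OK0_iff int_trace_add)
next
  fix c x assume "x \<in> OK0"
  then show "of_int c * x \<in> OK0" using OK_closed by (simp add: OK0_iff int_trace_scale)
qed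

lemma three_times_minus_trace: "x \<in> OK \<Longrightarrow> 3 * x - of_int (int_trace x) \<in> OK0"
  using int_trace_diff[of "3 * x" "of_int (int_trace x)"] int_trace_scale[of x 3] int_trace_of_int
    OK_closed(2,3,4) OK_closed(4)[of 3]
  by (simp add: OK0_iff)

text \<open>Multiples of \<theta> and \<theta>^2, projected to trace zero, give integral elements
  \<open>b1\<close> and \<open>b2\<close> spanning the trace-zero space. Their Gram determinant
  \<Delta> is nonzero, so the trace-zero integers lie between the lattice of \<open>b1, b2\<close>
  and the same lattice divided by \<Delta>.\<close>

lemma trace_zero_basis_exists:
  obtains \<beta> \<gamma> where "Z_basis [\<beta>, \<gamma>] OK0"
proof -
  obtain c0 c1 c2 \<theta> where "cubic_generator K \<theta> c0 c1 c2"
    using cubic_embeddings_exist[OF deg] by metis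
  then interpret G: cubic_generator K \<theta> c0 c1 c2 .
  note lin = field_trace_add[OF deg] field_trace_scale[OF deg]
  obtain N1 where N1: "N1 > 0" "of_int N1 * \<theta> \<in> OK" using integer_multiple[OF G.gen] .
  obtain N2 where N2: "N2 > 0" "of_int N2 * \<theta>\<^sup>2 \<in> OK" using integer_multiple[OF K_closed(12)[OF G.gen, of 2]] .
  define T1 T2 where "T1 = int_trace (of_int N1 * \<theta>)" and "T2 = int_trace (of_int N2 * \<theta>\<^sup>2)"
  define b1 b2 where "b1 = 3 * (of_int N1 * \<theta>) - of_int T1" and "b2 = 3 * (of_int N2 * \<theta>\<^sup>2) - of_int T2"
  have b: "b1 \<in> OK0" "b2 \<in> OK0"
    unfolding b1_def b2_def T1_def T2_def using three_times_minus_trace N1 N2 by blast+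
  then have bO: "b1 \<in> OK" "b2 \<in> OK" by (simp_all add: OK0_in_OK)
  then have bK: "b1 \<in> K" "b2 \<in> K" by (simp_all add: OK_in_K)
  have b_elt: "of_rat r1 * b1 + of_rat r2 * b2
      = G.elt \<theta> (- r1 * of_int T1 - r2 * of_int T2) (3 * of_int N1 * r1) (3 * of_int N2 * r2)" for r1 r2
    by (simp add: b1_def b2_def G.elt_def of_rat_minus of_rat_diff of_rat_mult algebra_simps)
  have zero_elt: "0 = G.elt \<theta> 0 0 0" by (simp add: G.elt_def)
  have ind: "r1 = 0 \<and> r2 = 0" if "of_rat r1 * b1 + of_rat r2 * b2 = 0" for r1 r2
  proof -
    have "3 * of_int N1 * r1 = 0 \<and> 3 * of_int N2 * r2 = 0"
      using that unfolding b_elt zero_elt G.elt_eq_iff by simp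
    then show ?thesis using N1(1) N2(1) by simp
  qed
  have span: "\<exists>r1 r2. x = of_rat r1 * b1 + of_rat r2 * b2" if x: "x \<in> K" "field_trace K x = 0" for x
  proof -
    obtain q0 q1 q2 where q: "x = G.elt \<theta> q0 q1 q2" using G.elt_exists[OF x(1)] .
    define r1 r2 where "r1 = q1 / (3 * of_int N1)" and "r2 = q2 / (3 * of_int N2)"
    define r0 where "r0 = q0 + r1 * of_int T1 + r2 * of_int T2"
    have r: "q1 = 3 * of_int N1 * r1" "q2 = 3 * of_int N2 * r2"
      using N1(1) N2(1) by (simp_all add: r1_def r2_def)
    have "x = of_rat r0 + (of_rat r1 * b1 + of_rat r2 * b2)"
      unfolding b_elt q r r0_def by (simp add: G.elt_def of_rat_minus of_rat_diff of_rat_mult of_rat_add algebra_simps)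
    moreover have "field_trace K (of_rat r0 + (of_rat r1 * b1 + of_rat r2 * b2)) = 3 * r0"
      using lin bK K_closed field_trace_scale[OF deg, of 1 r0] b field_trace_one[OF deg]
      by (simp add: trace_zero_integers_def)
    ultimately have "r0 = 0" "x = of_rat r0 + (of_rat r1 * b1 + of_rat r2 * b2)" using x(2) by simp_all
    then show ?thesis by auto
  qed
  \<comment> \<open>If a nonzero \<open>y\<close> were orthogonal to 1, \<open>b1\<close> and
    \<open>b2\<close>, expanding \<open>inverse y\<close> in these three would give
    \<open>y * inverse y\<close> the trace 0, whereas 1 has trace 3.\<close>
  have nondeg: "y = 0" if y: "y \<in> K" "field_trace K y = 0" "field_trace K (y * b1) = 0" "field_trace K (y * b2) = 0" for y
  proof (rule ccontr)
    assume "y \<noteq> 0"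
    define t where "t = field_trace K (inverse y) / 3"
    have iy: "inverse y \<in> K" using y(1) K_closed by simp
    have "field_trace K (inverse y - of_rat t) = 0"
      using field_trace_diff[OF deg iy, of "of_rat t"] field_trace_scale[OF deg, of 1 t] K_closed field_trace_one[OF deg]
      by (simp add: t_def)
    then obtain r1 r2 where "inverse y - of_rat t = of_rat r1 * b1 + of_rat r2 * b2"
      using span[of "inverse y - of_rat t"] iy K_closed by auto
    then have iy': "inverse y = of_rat t + (of_rat r1 * b1 + of_rat r2 * b2)" by (simp add: algebra_simps)
    have "y * inverse y = of_rat t * y + (of_rat r1 * (y * b1) + of_rat r2 * (y * b2))"
      unfolding iy' by (simp add: algebra_simps)
    then have "field_trace K 1 = field_trace K (of_rat t * y + (of_rat r1 * (y * b1) + of_rat r2 * (y * b2)))"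
      using \<open>y \<noteq> 0\<close> by simp
    also have "\<dots> = 0" using lin bK y K_closed by simp
    finally show False using field_trace_one[OF deg] by simp
  qed
  define A B C where "A = int_trace (b1 * b1)" and "B = int_trace (b1 * b2)" and "C = int_trace (b2 * b2)"
  have tr: "field_trace K (b1 * b1) = of_int A" "field_trace K (b1 * b2) = of_int B"
    "field_trace K (b2 * b1) = of_int B" "field_trace K (b2 * b2) = of_int C"
    using bO OK_closed by (simp_all add: A_def B_def C_def field_trace_eq_int mult.commute)
  have tr0: "field_trace K b1 = 0" "field_trace K b2 = 0" using b by (simp_all add: trace_zero_integers_def)
  define \<Delta> where "\<Delta> = A * C - B * B"
  have tr_lin: "field_trace K (of_rat r1 * b1 + of_rat r2 * b2) = 0"
    "field_trace K ((of_rat r1 * b1 + of_rat r2 * b2) * b1) = r1 * of_int A + r2 * of_int B"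
    "field_trace K ((of_rat r1 * b1 + of_rat r2 * b2) * b2) = r1 * of_int B + r2 * of_int C" for r1 r2
    using bK K_closed by (simp_all add: lin distrib_right mult.assoc tr tr0)
  have "\<Delta> \<noteq> 0"
  proof
    assume \<Delta>: "\<Delta> = 0"
    have "of_rat (of_int C) * b1 + of_rat (of_int (- B)) * b2 = 0"
    proof (rule nondeg)
      show "of_rat (of_int C) * b1 + of_rat (of_int (- B)) * b2 \<in> K" by (intro K_closed bK)
      show "field_trace K ((of_rat (of_int C) * b1 + of_rat (of_int (- B)) * b2) * b1) = 0"
        unfolding tr_lin using \<Delta> unfolding \<Delta>_def by (metis (no_types, lifting) diff_eq_eq mult.commute mult_minus_left of_int_0 of_int_add of_int_mult right_minus add_0)
    qed (unfold tr_lin, simp_all)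
    then have "of_int C = (0::rat) \<and> of_int (- B) = (0::rat)" by (rule ind)
    then have "field_trace K (b2 * b1) = 0" "field_trace K (b2 * b2) = 0" unfolding tr by simp_all
    then have "b2 = 0" using nondeg[OF bK(2) tr0(2)] by simp
    then show False using ind[of 0 1] by simp
  qed
  have ind': "m = 0 \<and> n = 0" if "of_int m * (b1 / of_int \<Delta>) + of_int n * (b2 / of_int \<Delta>) = 0" for m n :: int
  proof -
    have "of_rat (of_int m) * b1 + of_rat (of_int n) * b2
        = of_int \<Delta> * (of_int m * (b1 / of_int \<Delta>) + of_int n * (b2 / of_int \<Delta>))"
      using \<open>\<Delta> \<noteq> 0\<close> by (simp add: field_simps)
    also have "\<dots> = 0" using that by (simp only: mult_zero_right)
    finally have "(of_int m :: rat) = 0 \<and> (of_int n :: rat) = 0" by (rule ind)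
    then show ?thesis by simp
  qed
  have sub': "\<exists>m n::int. x = of_int m * (b1 / of_int \<Delta>) + of_int n * (b2 / of_int \<Delta>)" if x: "x \<in> OK0" for x
  proof -
    obtain r1 r2 where r: "x = of_rat r1 * b1 + of_rat r2 * b2"
      using span[of x] x by (auto simp: trace_zero_integers_def ring_of_integers_def)
    have xO: "x \<in> OK" using x by (rule OK0_in_OK)
    define p q where "p = int_trace (x * b1)" and "q = int_trace (x * b2)"
    have pq: "of_int p = r1 * of_int A + r2 * of_int B" "of_int q = r1 * of_int B + r2 * of_int C"
      using tr_lin(2,3)[of r1 r2] field_trace_eq_int[OF OK_closed(2)[OF xO bO(1)]]
        field_trace_eq_int[OF OK_closed(2)[OF xO bO(2)]] by (simp_all add: r p_def q_def)
    \<comment> \<open>Cramer's rule for the coordinates of \<open>x\<close>, with the integers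
      \<open>p\<close> and \<open>q\<close> as right-hand sides.\<close>
    have "of_int (p * C - q * B) = r1 * (of_int \<Delta> :: rat)" "of_int (q * A - p * B) = r2 * (of_int \<Delta> :: rat)"
      unfolding of_int_diff of_int_mult pq \<Delta>_def by (simp_all add: algebra_simps)
    then have "(of_rat (of_int (p * C - q * B)) :: complex) = of_rat (r1 * of_int \<Delta>)"
      "(of_rat (of_int (q * A - p * B)) :: complex) = of_rat (r2 * of_int \<Delta>)" by simp_all
    then have "(of_int (p * C - q * B) :: complex) = of_rat r1 * of_int \<Delta>"
      "(of_int (q * A - p * B) :: complex) = of_rat r2 * of_int \<Delta>" by (simp_all only: of_rat_mult of_rat_of_int_eq)
    then have "x = of_int (p * C - q * B) * (b1 / of_int \<Delta>) + of_int (q * A - p * B) * (b2 / of_int \<Delta>)"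
      using \<open>\<Delta> \<noteq> 0\<close> by (simp only: r) simp
    then show ?thesis by blast
  qed
  show ?thesis
    by (rule rank2_sublattice_basis[of "b1 / of_int \<Delta>" "b2 / of_int \<Delta>" OK0 \<Delta>, OF ind' OK0_subspace sub' \<open>\<Delta> \<noteq> 0\<close>])
      (use b \<open>\<Delta> \<noteq> 0\<close> that in auto)
qed

end

locale cubic_trace_basis = cubic_embeddings +
  fixes d :: int and \<beta> \<gamma> :: complex
  assumes fund: "fund_disc d" and disc: "field_discriminant K = d"
    and basis: "Z_basis [\<beta>, \<gamma>] (trace_zero_integers K)"
begin

lemma OK0_eq: "OK0 = {of_int m * \<beta> + of_int n * \<gamma> | m n. True}"
  using basis by (simp add: Z_basis_pair_iff)

lemma basis_independent: "of_int m * \<beta> + of_int n * \<gamma> = 0 \<Longrightarrow> m = 0 \<and> n = 0"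
  using basis by (simp add: Z_basis_pair_iff)

lemma basis_in: "\<beta> \<in> OK0" "\<gamma> \<in> OK0"
proof -
  have "of_int 1 * \<beta> + of_int 0 * \<gamma> \<in> OK0" "of_int 0 * \<beta> + of_int 1 * \<gamma> \<in> OK0" unfolding OK0_eq by blast+
  then show "\<beta> \<in> OK0" "\<gamma> \<in> OK0" by simp_all
qed

lemmas basis_in_OK = basis_in[THEN OK0_in_OK]

definition "A = int_trace (\<beta> * \<beta>)"
definition "B = int_trace (\<beta> * \<gamma>)"
definition "C = int_trace (\<gamma> * \<gamma>)"

text \<open>The trace maps the ring of integers onto the multiples of \<open>g\<close> with kernel
  \<open>OK0\<close>, and \<eta> splits this map.\<close>

lemma complement_basis:
  assumes \<eta>: "\<eta> \<in> OK" "int_trace \<eta> = g" "g > 0" and g: "\<And>x. x \<in> OK \<Longrightarrow> g dvd int_trace x"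
  shows "Z_basis [\<eta>, \<beta>, \<gamma>] OK"
  unfolding Z_basis_triple_iff
proof (intro conjI allI impI)
  fix l m n assume *: "of_int l * \<eta> + of_int m * \<beta> + of_int n * \<gamma> = 0"
  have mem: "of_int l * \<eta> \<in> OK" "of_int m * \<beta> \<in> OK" "of_int n * \<gamma> \<in> OK"
    using \<eta> basis_in_OK OK_closed by simp_all
  have "int_trace (of_int l * \<eta> + of_int m * \<beta> + of_int n * \<gamma>) = l * g"
    using mem OK_closed \<eta> basis_in by (simp add: int_trace_add int_trace_scale OK0_iff)
  then have "l * g = 0" using * int_trace_of_int[of 0] by simp
  then show l: "l = 0" using \<eta>(3) by simp
  then show "m = 0" "n = 0" using * basis_independent[of m n] by simp_all
next
  show "OK = {of_int l * \<eta> + of_int m * \<beta> + of_int n * \<gamma> | l m n. True}"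
  proof (intro equalityI subsetI)
    fix x assume x: "x \<in> OK"
    obtain l where l: "int_trace x = g * l" using g[OF x] by auto
    have l\<eta>: "of_int l * \<eta> \<in> OK" using \<eta>(1) OK_closed by simp
    have "x - of_int l * \<eta> \<in> OK0"
      using x l\<eta> OK_closed int_trace_diff[OF x l\<eta>] int_trace_scale[OF \<eta>(1), of l] \<eta>(2) l
      by (simp add: OK0_iff)
    then obtain m n where "x - of_int l * \<eta> = of_int m * \<beta> + of_int n * \<gamma>" unfolding OK0_eq by blast
    then have "x = of_int l * \<eta> + of_int m * \<beta> + of_int n * \<gamma>" by (simp add: algebra_simps)
    then show "x \<in> {of_int l * \<eta> + of_int m * \<beta> + of_int n * \<gamma> | l m n. True}" by blast
  next
    fix x assume "x \<in> {of_int l * \<eta> + of_int m * \<beta> + of_int n * \<gamma> | l m n. True}"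
    then obtain l m n where "x = of_int l * \<eta> + of_int m * \<beta> + of_int n * \<gamma>" by blast
    then show "x \<in> OK" using \<eta>(1) basis_in_OK OK_closed by simp
  qed
qed

lemma discriminant_formula:
  assumes \<eta>: "\<eta> \<in> OK" and basis: "Z_basis [\<eta>, \<beta>, \<gamma>] OK"
  shows "d = int_trace (\<eta> * \<eta>) * (A * C - B * B)
    - int_trace (\<eta> * \<beta>) * (int_trace (\<eta> * \<beta>) * C - B * int_trace (\<eta> * \<gamma>))
    + int_trace (\<eta> * \<gamma>) * (int_trace (\<eta> * \<beta>) * B - A * int_trace (\<eta> * \<gamma>))"
proof -
  have tr: "field_trace K (x * y) = of_int (int_trace (x * y))" if "x \<in> OK" "y \<in> OK" for x y
    using field_trace_eq_int OK_closed(2) that by blast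
  note O = \<eta> basis_in_OK
  have comm: "int_trace (\<beta> * \<eta>) = int_trace (\<eta> * \<beta>)" "int_trace (\<gamma> * \<eta>) = int_trace (\<eta> * \<gamma>)"
    "int_trace (\<gamma> * \<beta>) = B" by (simp_all add: mult.commute B_def)
  show ?thesis
    unfolding disc[symmetric]
    by (rule field_discriminant_eq[OF deg basis])
      (simp add: numeral_3_eq_3[symmetric] det_mat_3 tr O comm A_def[symmetric] B_def[symmetric] C_def[symmetric])
qed

text \<open>The trace values form a group containing tr 1 = 3, so they are generated by 1 or 3. In
  the latter case 1, \<beta>, \<gamma> is an integral basis, \<open>A\<close>, \<open>B\<close>,
  \<open>C\<close> are multiples of 3, and 9 divides the discriminant
  \<open>3 * (A * C - B * B)\<close>, which is impossible for a fundamental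
  \<open>d\<close>.\<close>

lemma trace_one_exists:
  obtains \<eta> where "\<eta> \<in> OK" "int_trace \<eta> = 1" "Z_basis [\<eta>, \<beta>, \<gamma>] OK"
proof -
  have "a - b \<in> int_trace ` OK" if "a \<in> int_trace ` OK" "b \<in> int_trace ` OK" for a b
    using that OK_closed(3) by (auto simp flip: int_trace_diff)
  moreover have "3 \<in> int_trace ` OK" using int_trace_one OK_closed(5) by (metis image_eqI)
  ultimately obtain g where g: "g > 0" "g \<in> int_trace ` OK" "\<And>a. a \<in> int_trace ` OK \<Longrightarrow> g dvd a"
    using int_subgroup_generator[of "int_trace ` OK" 3] by auto
  obtain \<eta> where \<eta>: "\<eta> \<in> OK" "int_trace \<eta> = g" using g(2) by auto
  have "g dvd 3" using g(3) \<open>3 \<in> _\<close> by blast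
  then have "g = 1 \<or> g = 3" using g(1) by (rule dvd_three_cases)
  moreover have "g \<noteq> 3"
  proof
    assume g3: "g = 3"
    then have three: "3 dvd int_trace x" if "x \<in> OK" for x using g(3) that by blast
    have "Z_basis [1, \<beta>, \<gamma>] OK" using complement_basis[of 1 3] OK_closed(5) int_trace_one three by simp
    then have "d = 3 * (A * C - B * B)"
      using discriminant_formula[of 1] OK_closed(5) basis_in by (simp add: int_trace_one OK0_iff)
    moreover have "3 dvd A" "3 dvd B" "3 dvd C"
      using three basis_in_OK OK_closed by (simp_all add: A_def B_def C_def)
    then have "3 dvd A * C - B * B" by simp
    ultimately have "9 dvd d" using mult_dvd_mono[of 3 3 3 "A * C - B * B"] by simp
    then show False using fund_disc_nine[OF fund] by simp
  qed
  ultimately show ?thesis using that[OF \<eta>(1)] \<eta> complement_basis[OF \<eta>] g by auto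
qed

text \<open>Expand 1 in the basis \<eta>, \<beta>, \<gamma>: taking traces, the coefficient of
  \<eta> is tr 1 = 3. Multiplying this expansion by \<beta>, \<gamma>, \<eta> and taking traces
  gives the three relations.\<close>

lemma gram_relations:
  assumes \<eta>: "\<eta> \<in> OK" "int_trace \<eta> = 1" "Z_basis [\<eta>, \<beta>, \<gamma>] OK"
  obtains u v where
    "3 * int_trace (\<eta> * \<beta>) + u * A + v * B = 0"
    "3 * int_trace (\<eta> * \<gamma>) + u * B + v * C = 0"
    "3 * int_trace (\<eta> * \<eta>) + u * int_trace (\<eta> * \<beta>) + v * int_trace (\<eta> * \<gamma>) = 1"
proof -
  have "1 - of_int 3 * \<eta> \<in> OK0"
    using three_times_minus_trace[OF \<eta>(1)] int_module.subspace_neg[OF OK0_subspace, of "3 * \<eta> - 1"] \<eta>(2) by simp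
  then obtain u v where uv: "1 - of_int 3 * \<eta> = of_int u * \<beta> + of_int v * \<gamma>" unfolding OK0_eq by blast
  then have one: "1 = of_int 3 * \<eta> + of_int u * \<beta> + of_int v * \<gamma>" by (simp add: algebra_simps)
  have exp: "int_trace x = 3 * int_trace (\<eta> * x) + u * int_trace (\<beta> * x) + v * int_trace (\<gamma> * x)"
    if x: "x \<in> OK" for x
  proof -
    have "1 * x = of_int 3 * (\<eta> * x) + of_int u * (\<beta> * x) + of_int v * (\<gamma> * x)"
      by (subst one) (simp only: distrib_right mult.assoc)
    then have "int_trace x = int_trace (of_int 3 * (\<eta> * x) + of_int u * (\<beta> * x) + of_int v * (\<gamma> * x))"
      by simp
    also have "\<dots> = 3 * int_trace (\<eta> * x) + u * int_trace (\<beta> * x) + v * int_trace (\<gamma> * x)"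
      using \<eta>(1) basis_in_OK x OK_closed by (simp add: int_trace_add int_trace_scale del: of_int_numeral)
    finally show ?thesis .
  qed
  show ?thesis
  proof (rule that)
    show "3 * int_trace (\<eta> * \<beta>) + u * A + v * B = 0"
      using exp[OF basis_in_OK(1)] basis_in by (simp add: A_def B_def OK0_iff mult.commute)
    show "3 * int_trace (\<eta> * \<gamma>) + u * B + v * C = 0"
      using exp[OF basis_in_OK(2)] basis_in by (simp add: B_def C_def OK0_iff)
    show "3 * int_trace (\<eta> * \<eta>) + u * int_trace (\<eta> * \<beta>) + v * int_trace (\<eta> * \<gamma>) = 1"
      using exp[OF \<eta>(1)] \<eta>(2) by (simp add: mult.commute[of \<beta> \<eta>] mult.commute[of \<gamma> \<eta>])
  qed
qed

text \<open>The lattice generated by 1 and \<open>OK0\<close> has index 3 in \<open>OK\<close>, so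
  its discriminant \<open>3 * (A * C - B\<^sup>2)\<close> is \<open>9 * d\<close>. The proof carries
  this out as a determinant identity with the relations for the expansion of 1.\<close>

lemma gram_det: "A * C - B\<^sup>2 = 3 * d"
proof -
  obtain \<eta> where \<eta>: "\<eta> \<in> OK" "int_trace \<eta> = 1" "Z_basis [\<eta>, \<beta>, \<gamma>] OK" using trace_one_exists .
  define E P Q where "E = int_trace (\<eta> * \<eta>)" and "P = int_trace (\<eta> * \<beta>)" and "Q = int_trace (\<eta> * \<gamma>)"
  obtain u v where rel: "3 * P + u * A + v * B = 0" "3 * Q + u * B + v * C = 0" "3 * E + u * P + v * Q = 1"
    using gram_relations[OF \<eta>] unfolding E_def P_def Q_def .
  have d: "d = E * (A * C - B * B) - P * (P * C - B * Q) + Q * (P * B - A * Q)"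
    using discriminant_formula[OF \<eta>(1,3)] unfolding E_def P_def Q_def .
  have "3 * d = (A * C - B\<^sup>2) * (3 * E + u * P + v * Q)
      - (3 * P + u * A + v * B) * (P * C - B * Q) + (3 * Q + u * B + v * C) * (P * B - A * Q)"
    unfolding d by (simp add: power2_eq_square algebra_simps)
  then show ?thesis using rel by simp
qed

lemma gram_divisible: "gcd 3 d dvd A" "gcd 3 d dvd B" "gcd 3 d dvd C"
proof -
  obtain \<eta> where \<eta>: "\<eta> \<in> OK" "int_trace \<eta> = 1" "Z_basis [\<eta>, \<beta>, \<gamma>] OK" using trace_one_exists .
  obtain u v where rel: "3 * int_trace (\<eta> * \<beta>) + u * A + v * B = 0"
    "3 * int_trace (\<eta> * \<gamma>) + u * B + v * C = 0"
    "3 * int_trace (\<eta> * \<eta>) + u * int_trace (\<eta> * \<beta>) + v * int_trace (\<eta> * \<gamma>) = 1"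
    using gram_relations[OF \<eta>] .
  have "gcd 3 d dvd A \<and> gcd 3 d dvd B \<and> gcd 3 d dvd C"
    using fund_disc_dual(3)[OF fund] three_dvd_gram[OF rel gram_det] by auto
  then show "gcd 3 d dvd A" "gcd 3 d dvd B" "gcd 3 d dvd C" by simp_all
qed

lemma gram_even: "even A" "even C"
  using even_trace_square[of \<beta>] even_trace_square[of \<gamma>] basis_in
  by (simp_all add: A_def C_def power2_eq_square trace_zero_integers_def)

text \<open>All three divisions are exact, by the evenness of the diagonal and the divisibility of
  the Gram matrix by \<open>gcd 3 d\<close>.\<close>

definition scaled_form :: form
  where "scaled_form = (A div (2 * gcd 3 d), B div gcd 3 d, C div (2 * gcd 3 d))"

lemma scaled_form_coeffs:
  obtains a b c where "scaled_form = (a, b, c)"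
    "A = 2 * gcd 3 d * a" "B = gcd 3 d * b" "C = 2 * gcd 3 d * c"
proof -
  have n: "gcd 3 d = 1 \<or> gcd 3 d = 3" using fund_disc_dual(3)[OF fund] by auto
  then have "Rings.coprime 2 (gcd 3 d)" by (auto simp: coprime_left_2_iff_odd)
  then have "2 * gcd 3 d dvd A" "2 * gcd 3 d dvd C"
    using gram_even gram_divisible by (simp_all add: divides_mult)
  then obtain a c where ac: "A = 2 * gcd 3 d * a" "C = 2 * gcd 3 d * c" by (elim dvdE)
  obtain b where b: "B = gcd 3 d * b" using gram_divisible(2) by (elim dvdE)
  have "scaled_form = (a, b, c)" by (simp add: scaled_form_def ac b)
  then show ?thesis using that ac b by blast
qed

lemma is_scaled_trace_form_scaled_form: "is_scaled_trace_form d K \<beta> \<gamma> scaled_form"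
  unfolding is_scaled_trace_form_def
proof (intro allI)
  fix x y
  obtain a b c where f: "scaled_form = (a, b, c)" "A = 2 * gcd 3 d * a" "B = gcd 3 d * b" "C = 2 * gcd 3 d * c"
    using scaled_form_coeffs .
  have sq: "(p * s + q * t)\<^sup>2 = p\<^sup>2 * (s * s) + 2 * p * q * (s * t) + q\<^sup>2 * (t * t)" for p q s t :: complex
    by (simp add: power2_eq_square algebra_simps)
  have n: "(of_int (gcd 3 d) :: rat) \<noteq> 0" by simp
  have "(of_int x * \<beta> + of_int y * \<gamma>)\<^sup>2
    = of_int (x\<^sup>2) * (\<beta> * \<beta>) + of_int (2 * x * y) * (\<beta> * \<gamma>) + of_int (y\<^sup>2) * (\<gamma> * \<gamma>)"
    unfolding sq by simp
  moreover have "int_trace \<dots> = x\<^sup>2 * A + 2 * x * y * B + y\<^sup>2 * C"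
    unfolding A_def B_def C_def using basis_in_OK OK_closed
    by (simp only: int_trace_add int_trace_scale)
  moreover have "of_int (x\<^sup>2) * (\<beta> * \<beta>) + of_int (2 * x * y) * (\<beta> * \<gamma>) + of_int (y\<^sup>2) * (\<gamma> * \<gamma>) \<in> OK"
    using basis_in_OK by (intro OK_closed)
  ultimately have "trace_form K (of_int x * \<beta> + of_int y * \<gamma>) = of_int (x\<^sup>2 * A + 2 * x * y * B + y\<^sup>2 * C)"
    unfolding trace_form_def by (simp only: field_trace_eq_int)
  also have "x\<^sup>2 * A + 2 * x * y * B + y\<^sup>2 * C = 2 * gcd 3 d * form_eval scaled_form x y"
    unfolding f(1) by (simp add: f(2-4) algebra_simps)
  finally show "of_int (form_eval scaled_form x y) = trace_form K (of_int x * \<beta> + of_int y * \<gamma>) / (2 * of_int (gcd 3 d))"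
    using n by simp
qed

lemma scaled_form_disc: "form_disc scaled_form = (- 3 * d) div (gcd 3 d)\<^sup>2"
proof -
  obtain a b c where f: "scaled_form = (a, b, c)" "A = 2 * gcd 3 d * a" "B = gcd 3 d * b" "C = 2 * gcd 3 d * c"
    using scaled_form_coeffs .
  have "(gcd 3 d)\<^sup>2 * form_disc scaled_form = B\<^sup>2 - A * C"
    unfolding f(1) f(2-4) by (simp add: power2_eq_square algebra_simps)
  also have "\<dots> = (gcd 3 d)\<^sup>2 * ((- 3 * d) div (gcd 3 d)\<^sup>2)"
    using gram_det fund_disc_dual(1)[OF fund] by simp
  finally show ?thesis by simp
qed

lemma scaled_form_primitive: "primitive_form scaled_form"
  using fund_disc_primitive_form[of scaled_form] fund_disc_dual(2)[OF fund] by (simp add: scaled_form_disc)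

text \<open>For products of two trace-zero integers this is the divisibility of the Gram matrix. For
  three, \<open>y * z\<close> is made trace-zero by subtracting \<open>k\<close> times an element of
  trace 1, where \<open>k\<close>, the trace of \<open>y * z\<close>, is itself divisible.\<close>

lemma triple_trace_divisible:
  assumes "x \<in> OK0" "y \<in> OK0" "z \<in> OK0"
  shows "gcd 3 d dvd int_trace (x * y * z)"
proof -
  let ?n = "gcd 3 d"
  have div2: "?n dvd int_trace (x * y)" if xy: "x \<in> OK0" "y \<in> OK0" for x y
  proof -
    obtain k l m n where "x = of_int k * \<beta> + of_int l * \<gamma>" "y = of_int m * \<beta> + of_int n * \<gamma>"
      using xy unfolding OK0_eq by blast
    then have "x * y = of_int (k * m) * (\<beta> * \<beta>) + of_int (k * n + l * m) * (\<beta> * \<gamma>) + of_int (l * n) * (\<gamma> * \<gamma>)"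
      by (simp add: algebra_simps)
    moreover have "int_trace \<dots> = k * m * A + (k * n + l * m) * B + l * n * C"
      unfolding A_def B_def C_def using basis_in_OK OK_closed
      by (simp only: int_trace_add int_trace_scale)
    ultimately show ?thesis using gram_divisible by simp
  qed
  obtain \<eta> where \<eta>: "\<eta> \<in> OK" "int_trace \<eta> = 1" "Z_basis [\<eta>, \<beta>, \<gamma>] OK" using trace_one_exists .
  note O = assms[THEN OK0_in_OK]
  define k where "k = int_trace (y * z)"
  have yz: "y * z \<in> OK" using O OK_closed by simp
  have k\<eta>: "of_int k * \<eta> \<in> OK" using \<eta>(1) OK_closed by simp
  have z0: "y * z - of_int k * \<eta> \<in> OK0"
    using yz k\<eta> \<eta> OK_closed int_trace_diff[OF yz k\<eta>] int_trace_scale[OF \<eta>(1), of k] by (simp add: OK0_iff k_def)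
  have mem: "x * \<eta> \<in> OK" "x * (y * z - of_int k * \<eta>) \<in> OK" "of_int k * (x * \<eta>) \<in> OK"
    using O \<eta>(1) OK0_in_OK[OF z0] OK_closed by simp_all
  have "x * y * z = of_int k * (x * \<eta>) + x * (y * z - of_int k * \<eta>)" by (simp add: algebra_simps)
  then have "int_trace (x * y * z) = k * int_trace (x * \<eta>) + int_trace (x * (y * z - of_int k * \<eta>))"
    using mem by (simp add: int_trace_add int_trace_scale)
  moreover have "?n dvd k" unfolding k_def using div2 assms by simp
  ultimately show ?thesis using div2[OF assms(1) z0] by simp
qed

end

section \<open>Ideal classes of imaginary quadratic fields\<close>

definition ideal_prod :: "complex set \<Rightarrow> complex set \<Rightarrow> complex set" (infixl \<open>\<star>\<close> 70)
  where "I \<star> J = int_module.span {x * y | x y. x \<in> I \<and> y \<in> J}"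

lemma ideal_prod_subspace: "int_module.subspace (I \<star> J)"
  unfolding ideal_prod_def by (rule int_module.subspace_span)

lemma ideal_prod_memI: "x \<in> I \<Longrightarrow> y \<in> J \<Longrightarrow> x * y \<in> I \<star> J"
  unfolding ideal_prod_def by (rule int_module.span_base) blast

lemma ideal_prod_subset_iff:
  assumes "int_module.subspace M"
  shows "I \<star> J \<subseteq> M \<longleftrightarrow> (\<forall>x\<in>I. \<forall>y\<in>J. x * y \<in> M)"
proof
  assume "\<forall>x\<in>I. \<forall>y\<in>J. x * y \<in> M"
  then have "{x * y | x y. x \<in> I \<and> y \<in> J} \<subseteq> M" by blast
  then show "I \<star> J \<subseteq> M" unfolding ideal_prod_def using assms by (rule int_module.span_minimal)
qed (use ideal_prod_memI in blast)

lemma ideal_prod_mult_mem: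
  assumes "u \<in> I \<star> J" "int_module.subspace M" "\<And>x y. x \<in> I \<Longrightarrow> y \<in> J \<Longrightarrow> z * (x * y) \<in> M"
  shows "z * u \<in> M"
proof -
  have "z * u \<in> int_module.span M"
    using assms(1) unfolding ideal_prod_def
    by (rule zspan_mult_mem) (use assms(3) int_module.span_base in blast)
  moreover have "int_module.span M = M" using assms(2) by (simp only: int_module.span_eq_iff)
  ultimately show ?thesis by simp
qed

lemma ideal_prod_comm: "I \<star> J = J \<star> I"
proof -
  have "{x * y | x y. x \<in> I \<and> y \<in> J} = {x * y | x y. x \<in> J \<and> y \<in> I}"
    by (intro Collect_cong) (metis mult.commute)
  then show ?thesis by (simp add: ideal_prod_def)
qed

lemma ideal_prod_mono: "I \<subseteq> I' \<Longrightarrow> J \<subseteq> J' \<Longrightarrow> I \<star> J \<subseteq> I' \<star> J'"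
  unfolding ideal_prod_def by (rule int_module.span_mono) blast

lemma ideal_prod_assoc_subset: "I \<star> J \<star> M \<subseteq> I \<star> (J \<star> M)"
proof -
  have "z * (x * y) \<in> I \<star> (J \<star> M)" if "x \<in> I" "y \<in> J" "z \<in> M" for x y z
  proof -
    have *: "z * (x * y) = x * (y * z)" by (simp only: ac_simps)
    show ?thesis unfolding * using that by (intro ideal_prod_memI)
  qed
  then have "z * u \<in> I \<star> (J \<star> M)" if "u \<in> I \<star> J" "z \<in> M" for u z
    using ideal_prod_mult_mem[OF that(1) ideal_prod_subspace] that(2) by blast
  then show ?thesis by (simp add: ideal_prod_subset_iff[OF ideal_prod_subspace] mult.commute)
qed

lemma ideal_prod_assoc: "I \<star> J \<star> M = I \<star> (J \<star> M)"
proof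
  have "I \<star> (J \<star> M) = M \<star> J \<star> I" by (simp add: ideal_prod_comm)
  also have "\<dots> \<subseteq> M \<star> (J \<star> I)" by (rule ideal_prod_assoc_subset)
  also have "\<dots> = I \<star> J \<star> M" by (simp add: ideal_prod_comm)
  finally show "I \<star> (J \<star> M) \<subseteq> I \<star> J \<star> M" .
qed (rule ideal_prod_assoc_subset)

lemma scale_subspace:
  assumes "int_module.subspace I"
  shows "int_module.subspace ((*) c ` I)"
proof (rule int_module.subspaceI)
  show "0 \<in> (*) c ` I" using int_module.subspace_0[OF assms] by force
next
  fix x y assume "x \<in> (*) c ` I" "y \<in> (*) c ` I"
  then obtain x' y' where "x = c * x'" "y = c * y'" "x' \<in> I" "y' \<in> I" by blast
  then show "x + y \<in> (*) c ` I"
    using int_module.subspace_add[OF assms, of x' y'] by (auto simp flip: distrib_left)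
next
  fix k x assume "x \<in> (*) c ` I"
  then obtain x' where "x = c * x'" "x' \<in> I" by blast
  then show "of_int k * x \<in> (*) c ` I"
    using int_module.subspace_scale[OF assms, of x' k] by (auto simp: mult.left_commute)
qed

lemma scale_scale: "(*) c ` (*) c' ` I = (*) (c * c') ` (I :: complex set)"
  by (auto simp: image_image mult.assoc)

lemma scale_one: "(*) 1 ` I = (I :: complex set)"
  by simp

lemma scale_eq_iff: "c \<noteq> 0 \<Longrightarrow> (*) c ` I = J \<longleftrightarrow> I = (*) (1 / c) ` (J :: complex set)"
  by (auto simp: image_image)

lemma ideal_prod_scale_left: "(*) c ` I \<star> J = (*) c ` (I \<star> J)"
proof
  show "(*) c ` I \<star> J \<subseteq> (*) c ` (I \<star> J)"
    by (auto simp: ideal_prod_subset_iff[OF scale_subspace[OF ideal_prod_subspace]] mult.assoc ideal_prod_memI)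
  have "c * u \<in> (*) c ` I \<star> J" if "u \<in> I \<star> J" for u
    by (rule ideal_prod_mult_mem[OF that ideal_prod_subspace])
      (auto simp flip: mult.assoc intro!: ideal_prod_memI)
  then show "(*) c ` (I \<star> J) \<subseteq> (*) c ` I \<star> J" by blast
qed

lemma ideal_prod_scale_right: "I \<star> (*) c ` J = (*) c ` (I \<star> J)"
  using ideal_prod_scale_left[of c J I] by (simp add: ideal_prod_comm)

lemma cnj_subspace:
  assumes "int_module.subspace I"
  shows "int_module.subspace (cnj ` I)"
proof (rule int_module.subspaceI)
  show "0 \<in> cnj ` I" using int_module.subspace_0[OF assms] by force
next
  fix x y assume "x \<in> cnj ` I" "y \<in> cnj ` I"
  then obtain x' y' where "x = cnj x'" "y = cnj y'" "x' \<in> I" "y' \<in> I" by blast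
  then show "x + y \<in> cnj ` I"
    using int_module.subspace_add[OF assms, of x' y'] by (auto simp flip: complex_cnj_add)
next
  fix k x assume "x \<in> cnj ` I"
  then obtain x' where x': "x = cnj x'" "x' \<in> I" by blast
  then have "of_int k * x = cnj (of_int k * x')" by simp
  then show "of_int k * x \<in> cnj ` I"
    using int_module.subspace_scale[OF assms x'(2), of k] by blast
qed

lemma cnj_cnj_image: "cnj ` cnj ` I = I"
  by (simp add: image_image)

lemma cnj_scale_image: "cnj ` (*) c ` I = (*) (cnj c) ` cnj ` I"
  by (simp add: image_image)

lemma cnj_ideal_prod: "cnj ` (I \<star> J) = cnj ` I \<star> cnj ` J"
proof -
  have sub: "cnj ` I \<star> cnj ` J \<subseteq> cnj ` (I \<star> J)" for I J
    by (auto simp: ideal_prod_subset_iff[OF cnj_subspace[OF ideal_prod_subspace]] ideal_prod_memI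
        simp flip: complex_cnj_mult)
  have "cnj ` (I \<star> J) = cnj ` (cnj ` cnj ` I \<star> cnj ` cnj ` J)" by (simp only: cnj_cnj_image)
  also have "\<dots> \<subseteq> cnj ` cnj ` (cnj ` I \<star> cnj ` J)" using sub by (intro image_mono)
  finally have "cnj ` (I \<star> J) \<subseteq> cnj ` I \<star> cnj ` J" by (simp only: cnj_cnj_image)
  then show ?thesis using sub[of I J] by blast
qed

lemma zspan_pair: "int_module.span {b, c} = {of_int m * b + of_int n * c | m n. True}"
proof -
  have "x \<in> int_module.span {b, c} \<longleftrightarrow> (\<exists>m n. x - of_int m * b = of_int n * c)" for x
    unfolding int_module.span_breakdown_eq[of x b] int_module.span_singleton by blast
  then have "x \<in> int_module.span {b, c} \<longleftrightarrow> (\<exists>m n. x = of_int m * b + of_int n * c)" for x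
    by (simp only: diff_eq_eq add.commute)
  then show ?thesis by auto
qed

section \<open>Fractional ideals of an imaginary quadratic field\<close>

locale imag_quadratic =
  fixes D :: int
  assumes fund: "fund_disc D" and neg: "D < 0"
begin

definition s :: complex where "s = csqrt (of_int D)"

lemma s_square: "s\<^sup>2 = of_int D"
  by (simp add: s_def)

lemma s_eq: "s = \<i> * of_real (sqrt (- of_int D))"
proof -
  have "of_int D = (of_real (of_int D) :: complex)" by simp
  then show ?thesis unfolding s_def using neg by (simp only: csqrt_of_real_nonpos) simp
qed

lemma cnj_s: "cnj s = - s"
  by (simp add: s_eq)

lemma Im_s: "Im s > 0" and Re_s: "Re s = 0"
  using neg by (simp_all add: s_eq)

lemma s_irrational: "s \<notin> \<rat>"
proof
  assume "s \<in> \<rat>"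
  then obtain q where "s = of_rat q" by (auto elim: Rats_cases)
  moreover obtain a b where "q = Rat.Fract a b" "b > 0" by (cases q) auto
  ultimately have "s = of_int a / of_int b" by (simp add: of_rat_rat)
  then have "Im s = 0" by (simp add: Im_divide)
  then show False using Im_s by simp
qed

abbreviation "F \<equiv> qfield s"
abbreviation "OF \<equiv> ring_of_integers F"

lemma F_subfield: "is_subfield F"
  by (rule is_subfield_qfield[OF s_square s_irrational])

lemmas F_closed = is_subfieldD[OF F_subfield]

lemmas OF_closed = ring_of_integers_closed[OF F_subfield]

lemma s_in_F: "s \<in> F"
proof -
  have "s = of_rat 0 + of_rat 1 * s" by simp
  then show ?thesis unfolding qfield_def by blast
qed

lemma OF_iff: "x \<in> OF \<longleftrightarrow> (\<exists>a b. x = (of_int a + of_int b * s) / 2 \<and> even (a - b * D))"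
proof -
  have "(of_int a + of_int b * s) / 2 \<in> F" for a b by (intro F_closed s_in_F)
  then have "x \<in> F" if "\<exists>a b. x = (of_int a + of_int b * s) / 2 \<and> even (a - b * D)" using that by blast
  then show ?thesis
    using qfield_algebraic_int_iff[OF s_square s_irrational fund, of x] unfolding ring_of_integers_def by blast
qed

lemma OF_in_F: "x \<in> OF \<Longrightarrow> x \<in> F"
  by (simp add: ring_of_integers_def)

lemma OF_subspace: "int_module.subspace OF"
  by (rule int_module.subspaceI) (use OF_closed in auto)

lemma cnj_F: "x \<in> F \<Longrightarrow> cnj x \<in> F"
proof -
  assume "x \<in> F"
  then obtain u v where x: "x = of_rat u + of_rat v * s" by (auto simp: qfield_def)
  have r: "cnj (of_rat q) = of_rat q" for q by (cases q) (simp add: of_rat_rat)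
  have "cnj x = of_rat u + of_rat (- v) * s" by (simp add: x r cnj_s of_rat_minus)
  then show ?thesis unfolding qfield_def by blast
qed

lemma cnj_OF: "x \<in> OF \<Longrightarrow> cnj x \<in> OF"
  using cnj_F by (simp add: ring_of_integers_def)

lemma OF_trace_norm:
  assumes "x \<in> OF"
  obtains t n :: int where "x + cnj x = of_int t" "x * cnj x = of_int n"
proof -
  obtain a b where ab: "x = (of_int a + of_int b * s) / 2" "even (a - b * D)" using assms OF_iff by blast
  have cx: "cnj x = (of_int a - of_int b * s) / 2" by (simp add: ab cnj_s)
  have "x + cnj x = of_int a" by (simp add: ab cnj_s field_simps)
  moreover have "x * cnj x \<in> \<int>"
  proof (rule rational_algebraic_int_is_int)
    show "algebraic_int (x * cnj x)"
      using assms cnj_OF[OF assms] by (auto simp: ring_of_integers_def intro: algebraic_int_times)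
    have "(p + q) / 2 * ((p - q) / 2) = (p * p - q * q) / 4" for p q :: complex
      unfolding times_divide_times_eq square_diff_square_factored by simp
    then have "x * cnj x = (of_int a * of_int a - of_int b * s * (of_int b * s)) / 4"
      unfolding cx unfolding ab(1) .
    moreover have "of_int b * s * (of_int b * s) = of_int (b * b * D)"
      using s_square by (simp add: power2_eq_square)
    ultimately have eq: "x * cnj x = (of_int a * of_int a - of_int (b * b * D)) / 4" by (simp only:)
    show "x * cnj x \<in> \<rat>" unfolding eq by simp
  qed
  ultimately show ?thesis using that by (auto elim: Ints_cases)
qed

lemma F_integer_multiple:
  assumes "x \<in> F"
  obtains m :: int where "m > 0" "of_int m * x \<in> OF"
proof -
  obtain u v where x: "x = of_rat u + of_rat v * s" using assms by (auto simp: qfield_def)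
  obtain a b where u: "u = Rat.Fract a b" "b > 0" by (cases u) auto
  obtain c e where v: "v = Rat.Fract c e" "e > 0" by (cases v) auto
  have "of_int (2 * (b * e)) * x = (of_int (4 * a * e) + of_int (4 * c * b) * s) / 2"
  proof -
    have uv: "of_rat u * of_int b = (of_int a :: complex)" "of_rat v * of_int e = (of_int c :: complex)"
      using u v by (simp_all add: of_rat_rat)
    have "2 * (b * e) * (u + v * s) = (4 * (u * b) * e + 4 * (v * e) * b * s) / 2"
      for b e u v :: complex by (simp add: algebra_simps)
    from this[of "of_int b" "of_int e" "of_rat u" "of_rat v"] show ?thesis
      by (simp only: uv x of_int_mult of_int_numeral)
  qed
  moreover have "even (4 * a * e - 4 * c * b * D)" by simp
  ultimately have "of_int (2 * (b * e)) * x \<in> OF" unfolding OF_iff by blast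
  then show ?thesis using that[of "2 * (b * e)"] u v by simp
qed

abbreviation "fracs \<equiv> fractional_ideals F"

lemma fracs_iff: "I \<in> fracs \<longleftrightarrow> I \<subseteq> F \<and> int_module.subspace I \<and> I \<noteq> {0} \<and>
    (\<forall>r\<in>OF. \<forall>x\<in>I. r * x \<in> I) \<and> (\<exists>c\<in>OF. c \<noteq> 0 \<and> (\<forall>x\<in>I. c * x \<in> OF))"
  by (simp add: fractional_ideals_def)

lemma fracsD:
  assumes "I \<in> fracs"
  shows "x \<in> I \<Longrightarrow> x \<in> F" "int_module.subspace I" "r \<in> OF \<Longrightarrow> x \<in> I \<Longrightarrow> r * x \<in> I"
  using assms by (auto simp: fracs_iff)

lemma fracs_nonzero:
  assumes "I \<in> fracs"
  obtains x where "x \<in> I" "x \<noteq> 0"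
proof -
  have "0 \<in> I" "I \<noteq> {0}" using assms int_module.subspace_0 by (auto simp: fracs_iff)
  then show ?thesis using that by blast
qed

lemma fracs_denominator:
  assumes "I \<in> fracs"
  obtains c where "c \<in> OF" "c \<noteq> 0" "\<forall>x\<in>I. c * x \<in> OF"
  using assms that unfolding fracs_iff by blast

lemma OF_frac: "OF \<in> fracs"
proof -
  have "OF \<noteq> {0}" using OF_closed(5) by auto
  then show ?thesis
    unfolding fracs_iff using OF_subspace OF_closed OF_in_F by (auto intro!: bexI[of _ 1])
qed

lemma ideal_prod_frac:
  assumes I: "I \<in> fracs" and J: "J \<in> fracs"
  shows "I \<star> J \<in> fracs"
  unfolding fracs_iff
proof (intro conjI ballI)
  show "I \<star> J \<subseteq> F"
    \<comment> \<open>The long instance says that \<open>F\<close> is closed under integer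
      combinations, so that the inclusion may be tested on products of elements.\<close>
    unfolding ideal_prod_subset_iff[OF int_module.subspaceI[of F, OF F_closed(6,2) F_closed(3)[OF F_closed(10)], simplified]]
    using fracsD(1)[OF I] fracsD(1)[OF J] F_closed(3) by blast
  show "int_module.subspace (I \<star> J)" by (rule ideal_prod_subspace)
  obtain x y where xy: "x \<in> I" "x \<noteq> 0" "y \<in> J" "y \<noteq> 0" using fracs_nonzero[OF I] fracs_nonzero[OF J] by metis
  have "x * y \<in> I \<star> J" "x * y \<noteq> 0" using xy ideal_prod_memI by auto
  then show "I \<star> J \<noteq> {0}" by blast
next
  fix r x assume r: "r \<in> OF" and x: "x \<in> I \<star> J"
  show "r * x \<in> I \<star> J"
  proof (rule ideal_prod_mult_mem[OF x ideal_prod_subspace])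
    fix y z assume "y \<in> I" "z \<in> J"
    then have "r * y * z \<in> I \<star> J" using fracsD(3)[OF I r] by (intro ideal_prod_memI) auto
    then show "r * (y * z) \<in> I \<star> J" by (simp add: mult.assoc)
  qed
next
  obtain c where c: "c \<in> OF" "c \<noteq> 0" "\<forall>x\<in>I. c * x \<in> OF" using fracs_denominator[OF I] .
  obtain e where e: "e \<in> OF" "e \<noteq> 0" "\<forall>x\<in>J. e * x \<in> OF" using fracs_denominator[OF J] .
  have "c * e * u \<in> OF" if "u \<in> I \<star> J" for u
  proof (rule ideal_prod_mult_mem[OF that OF_subspace])
    fix x y assume "x \<in> I" "y \<in> J"
    then have "(c * x) * (e * y) \<in> OF" using c e OF_closed(2) by blast
    then show "c * e * (x * y) \<in> OF" by (simp add: mult_ac)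
  qed
  then show "\<exists>c\<in>OF. c \<noteq> 0 \<and> (\<forall>x\<in>I \<star> J. c * x \<in> OF)"
    using c e OF_closed(2) by (intro bexI[of _ "c * e"]) auto
qed

lemma scale_frac:
  assumes I: "I \<in> fracs" and x: "x \<in> F" "x \<noteq> 0"
  shows "(*) x ` I \<in> fracs"
  unfolding fracs_iff
proof (intro conjI ballI)
  show "(*) x ` I \<subseteq> F" using fracsD(1)[OF I] x F_closed(3) by blast
  show "int_module.subspace ((*) x ` I)" by (rule scale_subspace[OF fracsD(2)[OF I]])
  obtain y where "y \<in> I" "y \<noteq> 0" using fracs_nonzero[OF I] .
  then have "x * y \<in> (*) x ` I" "x * y \<noteq> 0" using x by auto
  then show "(*) x ` I \<noteq> {0}" by blast
next
  fix r y assume "r \<in> OF" "y \<in> (*) x ` I"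
  then obtain z where "z \<in> I" "y = x * z" by blast
  then have "r * y = x * (r * z)" "r * z \<in> I" using fracsD(3)[OF I \<open>r \<in> OF\<close>] by simp_all
  then show "r * y \<in> (*) x ` I" by blast
next
  obtain c where c: "c \<in> OF" "c \<noteq> 0" "\<forall>x\<in>I. c * x \<in> OF" using fracs_denominator[OF I] .
  obtain m :: int where m: "m > 0" "of_int m * inverse x \<in> OF" using F_integer_multiple[OF F_closed(5)[OF x(1)]] .
  have "c * (of_int m * inverse x) * y \<in> OF" if "y \<in> (*) x ` I" for y
  proof -
    obtain z where z: "z \<in> I" "y = x * z" using \<open>y \<in> _\<close> by blast
    have *: "c * (of_int m * inverse x) * y = of_int m * (c * z)" using x(2) by (simp add: z(2))
    show ?thesis unfolding * by (rule OF_closed(2)[OF OF_closed(4) bspec[OF c(3) z(1)]])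
  qed
  moreover have "c * (of_int m * inverse x) \<in> OF" "c * (of_int m * inverse x) \<noteq> 0"
    using c m x OF_closed(2)[OF c(1) m(2)] by auto
  ultimately show "\<exists>c\<in>OF. c \<noteq> 0 \<and> (\<forall>y\<in>(*) x ` I. c * y \<in> OF)" by blast
qed

lemma cnj_frac:
  assumes I: "I \<in> fracs"
  shows "cnj ` I \<in> fracs"
  unfolding fracs_iff
proof (intro conjI ballI)
  show "cnj ` I \<subseteq> F" using fracsD(1)[OF I] cnj_F by blast
  show "int_module.subspace (cnj ` I)" by (rule cnj_subspace[OF fracsD(2)[OF I]])
  obtain y where "y \<in> I" "y \<noteq> 0" using fracs_nonzero[OF I] .
  then have "cnj y \<in> cnj ` I" "cnj y \<noteq> 0" by auto
  then show "cnj ` I \<noteq> {0}" by blast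
next
  fix r y assume r: "r \<in> OF" and "y \<in> cnj ` I"
  then obtain z where "z \<in> I" "y = cnj z" by blast
  then have "r * y = cnj (cnj r * z)" "cnj r * z \<in> I" using fracsD(3)[OF I cnj_OF[OF r]] by simp_all
  then show "r * y \<in> cnj ` I" by blast
next
  obtain c where c: "c \<in> OF" "c \<noteq> 0" "\<forall>x\<in>I. c * x \<in> OF" using fracs_denominator[OF I] .
  have "cnj c * y \<in> OF" if "y \<in> cnj ` I" for y
    using that c(3) cnj_OF by (auto simp flip: complex_cnj_mult)
  then show "\<exists>c\<in>OF. c \<noteq> 0 \<and> (\<forall>y\<in>cnj ` I. c * y \<in> OF)"
    using c cnj_OF by (intro bexI[of _ "cnj c"]) auto
qed

lemma OF_prod:
  assumes I: "I \<in> fracs"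
  shows "OF \<star> I = I"
proof
  show "OF \<star> I \<subseteq> I"
    unfolding ideal_prod_subset_iff[OF fracsD(2)[OF I]] using fracsD(3)[OF I] by blast
  show "I \<subseteq> OF \<star> I" using ideal_prod_memI[OF OF_closed(5)] by force
qed

lemma prod_OF: "I \<in> fracs \<Longrightarrow> I \<star> OF = I"
  using OF_prod[of I] by (simp add: ideal_prod_comm)

definition w :: complex where "w = (of_int D + s) / 2"

lemma w_in: "w \<in> OF"
proof -
  have "w = (of_int D + of_int 1 * s) / 2 \<and> even (D - 1 * D)" by (simp add: w_def)
  then show ?thesis unfolding OF_iff by blast
qed

lemma OF_coords:
  assumes "x \<in> OF"
  shows "\<exists>m n::int. x = of_int m * 1 + of_int n * w"
proof -
  obtain a b where ab: "x = (of_int a + of_int b * s) / 2" "even (a - b * D)" using assms OF_iff by blast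
  then obtain k where k: "a - b * D = 2 * k" by (elim evenE)
  then have "(of_int a :: complex) = of_int (b * D + 2 * k)" by (simp add: diff_eq_eq add.commute)
  then have "x = of_int k * 1 + of_int b * w" by (simp add: ab w_def field_simps)
  then show ?thesis by blast
qed

lemma w_independent: "of_int m * 1 + of_int n * w = 0 \<Longrightarrow> m = 0 \<and> n = 0"
proof -
  assume *: "of_int m * 1 + of_int n * w = 0"
  have "Im w = Im s / 2" by (simp add: w_def)
  moreover have "of_int n * Im w = Im (of_int m * 1 + of_int n * w)" by simp
  ultimately have "of_int n * (Im s / 2) = Im 0" using * by (simp only:)
  then have "n = 0" using Im_s by simp
  then show ?thesis using * by simp
qed

text \<open>The generator comes from the content of the norm form of \<open>I\<close>.\<close>

lemma ideal_conj_prod: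
  assumes I: "I \<in> fracs"
  obtains r where "r \<noteq> 0" "r \<in> F" "I \<star> cnj ` I = (*) r ` OF"
proof -
  obtain c where c: "c \<in> OF" "c \<noteq> 0" "\<forall>x\<in>I. c * x \<in> OF" using fracs_denominator[OF I] .
  define M where "M = (*) c ` I"
  have M: "M \<in> fracs" unfolding M_def using scale_frac[OF I OF_in_F[OF c(1)] c(2)] .
  have MO: "M \<subseteq> OF" using c(3) by (auto simp: M_def)
  obtain x where x: "x \<in> M" "x \<noteq> 0" using fracs_nonzero[OF M] .
  obtain t N where N: "x * cnj x = of_int N" using OF_trace_norm MO x(1) by blast
  have "N \<noteq> 0" using N x(2) by auto
  have NM: "of_int N * 1 \<in> M" "of_int N * w \<in> M"
    using fracsD(3)[OF M cnj_OF x(1)] fracsD(3)[OF M OF_closed(2)[OF w_in cnj_OF] x(1)] MO x(1)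
    by (auto simp: N[symmetric] mult_ac)
  obtain \<beta> \<gamma> where bas: "Z_basis [\<beta>, \<gamma>] M"
    by (rule rank2_sublattice_basis[of 1 w M N, OF w_independent fracsD(2)[OF M] _ \<open>N \<noteq> 0\<close> NM])
      (use OF_coords MO in auto)
  have M_eq: "M = {of_int m * \<beta> + of_int n * \<gamma> | m n. True}" using bas by (simp add: Z_basis_pair_iff)
  have "of_int 1 * \<beta> + of_int 0 * \<gamma> \<in> M" "of_int 0 * \<beta> + of_int 1 * \<gamma> \<in> M" unfolding M_eq by blast+
  then have mem: "\<beta> \<in> M" "\<gamma> \<in> M" by simp_all
  then have memO: "\<beta> \<in> OF" "\<gamma> \<in> OF" using MO by blast+
  obtain A where A: "\<beta> * cnj \<beta> = of_int A" using OF_trace_norm[OF memO(1)] by metis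
  obtain C where C: "\<gamma> * cnj \<gamma> = of_int C" using OF_trace_norm[OF memO(2)] by metis
  obtain B where B: "\<beta> * cnj \<gamma> + cnj (\<beta> * cnj \<gamma>) = of_int B"
    using OF_trace_norm[OF OF_closed(2)[OF memO(1) cnj_OF[OF memO(2)]]] by metis
  define g where "g = gcd (gcd A B) C"
  have MM: "\<beta> * cnj \<beta> \<in> M \<star> cnj ` M" "\<beta> * cnj \<gamma> \<in> M \<star> cnj ` M"
    "\<gamma> * cnj \<beta> \<in> M \<star> cnj ` M" "\<gamma> * cnj \<gamma> \<in> M \<star> cnj ` M"
    using mem by (auto intro: ideal_prod_memI)
  note sub = ideal_prod_subspace[of M "cnj ` M"]
  have "\<beta> \<noteq> 0"
  proof
    assume "\<beta> = 0"
    then have "of_int 1 * \<beta> + of_int 0 * \<gamma> = 0" by simp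
    then have "(1::int) = 0" using bas unfolding Z_basis_pair_iff by blast
    then show False by simp
  qed
  then have "A \<noteq> 0" using A by auto
  then have g: "g > 0" by (simp add: g_def)
  obtain p q where "p * A + q * B = gcd A B" using bezout_int by blast
  moreover obtain p' q' where "p' * gcd A B + q' * C = g" unfolding g_def using bezout_int by blast
  ultimately have bez: "g = p' * p * A + p' * q * B + q' * C" by (metis distrib_left mult.assoc)
  have Bmem: "of_int B \<in> M \<star> cnj ` M"
    using int_module.subspace_add[OF sub MM(2,3)] B by (simp add: mult.commute)
  have "of_int g = of_int (p' * p) * (\<beta> * cnj \<beta>) + of_int (p' * q) * of_int B + of_int q' * (\<gamma> * cnj \<gamma>)"
    by (simp add: A C bez)
  also have "\<dots> \<in> M \<star> cnj ` M"
    by (intro int_module.subspace_add[OF sub] int_module.subspace_scale[OF sub] MM Bmem)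
  finally have gmem: "of_int g \<in> M \<star> cnj ` M" .
  have gsub: "int_module.subspace ((*) (of_int g) ` OF)" by (rule scale_subspace[OF OF_subspace])
  \<comment> \<open>The analogue of Gauss's lemma on contents: the mixed product divided by
    \<open>g\<close> is integral, because its trace \<open>B / g\<close> and its norm
    \<open>A * C / g\<^sup>2\<close> are integers.\<close>
  have bc: "\<beta> * cnj \<gamma> / of_int g \<in> OF"
  proof -
    obtain a' where a': "A = g * a'" by (metis dvdE g_def gcd_dvd1 dvd_trans)
    obtain b' where b': "B = g * b'" by (metis dvdE g_def gcd_dvd1 gcd_dvd2 dvd_trans)
    obtain c' where c': "C = g * c'" by (metis dvdE g_def gcd_dvd2)
    define z where "z = \<beta> * cnj \<gamma>"
    have z1: "z + cnj z = of_int g * of_int b'" using B b' by (simp add: z_def)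
    have "z * cnj z = (\<beta> * cnj \<beta>) * (\<gamma> * cnj \<gamma>)" by (simp add: z_def)
    then have z2: "z * cnj z = (of_int g)\<^sup>2 * of_int (a' * c')" by (simp add: A C a' c' power2_eq_square)
    have "z\<^sup>2 - (z + cnj z) * z + z * cnj z = 0" by (simp add: power2_eq_square algebra_simps)
    then have "z\<^sup>2 - of_int g * of_int b' * z + (of_int g)\<^sup>2 * of_int (a' * c') = 0" unfolding z1 z2 .
    moreover have "z\<^sup>2 - G * b * z + G\<^sup>2 * c = G\<^sup>2 * ((z / G)\<^sup>2 + - b * (z / G) + c)"
      if "G \<noteq> 0" for G b c :: complex
    proof -
      have "(G * y)\<^sup>2 - G * b * (G * y) + G\<^sup>2 * c = G\<^sup>2 * (y\<^sup>2 + - b * y + c)" for y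
        by (simp add: power2_eq_square algebra_simps)
      from this[of "z / G"] show ?thesis using that by simp
    qed
    ultimately have "(of_int g)\<^sup>2 * ((z / of_int g)\<^sup>2 + - of_int b' * (z / of_int g) + of_int (a' * c')) = 0"
      using g by simp
    then have "(z / of_int g)\<^sup>2 + of_int (- b') * (z / of_int g) + of_int (a' * c') = 0" using g by simp
    then have "algebraic_int (z / of_int g)" by (rule algebraic_int_quadratic)
    moreover have "z / of_int g \<in> F"
      unfolding z_def using memO OF_in_F cnj_F by (intro F_closed) auto
    ultimately show ?thesis by (simp add: ring_of_integers_def z_def)
  qed
  have "M \<star> cnj ` M \<subseteq> (*) (of_int g) ` OF"
    unfolding ideal_prod_subset_iff[OF gsub]
  proof (intro ballI)
    fix x y assume "x \<in> M" "y \<in> cnj ` M"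
    then obtain k l m n where xy: "x = of_int k * \<beta> + of_int l * \<gamma>" "y = cnj (of_int m * \<beta> + of_int n * \<gamma>)"
      unfolding M_eq by blast
    have 1: "of_int A \<in> (*) (of_int g) ` OF" "of_int C \<in> (*) (of_int g) ` OF"
    proof -
      have "g dvd A" "g dvd C" by (auto simp: g_def intro: dvd_trans)
      then show "of_int A \<in> (*) (of_int g) ` OF" "of_int C \<in> (*) (of_int g) ` OF"
        using OF_closed(4) by (auto elim!: dvdE)
    qed
    have 2: "\<beta> * cnj \<gamma> \<in> (*) (of_int g) ` OF"
      using bc g by (intro image_eqI[of _ _ "\<beta> * cnj \<gamma> / of_int g"]) auto
    have 3: "cnj (\<beta> * cnj \<gamma>) \<in> (*) (of_int g) ` OF"
      using cnj_OF[OF bc] g by (intro image_eqI[of _ _ "cnj (\<beta> * cnj \<gamma> / of_int g)"]) auto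
    have "x * y = of_int (k * m) * of_int A + of_int (k * n) * (\<beta> * cnj \<gamma>)
        + of_int (l * m) * cnj (\<beta> * cnj \<gamma>) + of_int (l * n) * of_int C"
      unfolding A[symmetric] C[symmetric] xy by (simp add: algebra_simps)
    also have "\<dots> \<in> (*) (of_int g) ` OF"
      by (intro int_module.subspace_add[OF gsub] int_module.subspace_scale[OF gsub] 1 2 3)
    finally show "x * y \<in> (*) (of_int g) ` OF" .
  qed
  moreover have "(*) (of_int g) ` OF \<subseteq> M \<star> cnj ` M"
    using fracsD(3)[OF ideal_prod_frac[OF M cnj_frac[OF M]] _ gmem] by (auto simp: mult.commute)
  ultimately have MMeq: "M \<star> cnj ` M = (*) (of_int g) ` OF" by blast
  have "I = (*) (1 / c) ` M" unfolding M_def scale_scale using c(2) by simp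
  then have "I \<star> cnj ` I = (*) (cnj (1 / c) * (1 / c)) ` (M \<star> cnj ` M)"
    by (simp only: cnj_scale_image ideal_prod_scale_left ideal_prod_scale_right scale_scale)
  then have prod: "I \<star> cnj ` I = (*) (cnj (1 / c) * (1 / c) * of_int g) ` OF" unfolding MMeq scale_scale .
  have inF: "cnj (1 / c) * (1 / c) * of_int g \<in> F"
    using cnj_F[OF F_closed(8)[OF F_closed(1) OF_in_F[OF c(1)]]] OF_in_F[OF c(1)]
    by (intro F_closed(1,3,8,10))
  show ?thesis by (rule that[OF _ inF prod]) (use c(2) g in simp)
qed

lemma ideal_inverse:
  assumes I: "I \<in> fracs"
  obtains J where "J \<in> fracs" "J \<star> I = OF"
proof -
  obtain r where r: "r \<noteq> 0" "r \<in> F" "I \<star> cnj ` I = (*) r ` OF" using ideal_conj_prod[OF I] .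
  have "(*) (1 / r) ` (cnj ` I) \<in> fracs"
    using r by (intro scale_frac cnj_frac I F_closed) auto
  moreover have "(*) (1 / r) ` (cnj ` I) \<star> I = OF"
    unfolding ideal_prod_scale_left ideal_prod_comm[of "cnj ` I"] r(3) scale_scale using r(1) by simp
  ultimately show ?thesis using that by blast
qed

section \<open>The class group as a quotient of the group of fractional ideals\<close>

abbreviation "Gr \<equiv> fractional_ideal_group F"

lemma Gr_simps: "carrier Gr = fracs" "I \<otimes>\<^bsub>Gr\<^esub> J = I \<star> J" "\<one>\<^bsub>Gr\<^esub> = OF"
  by (simp_all add: fractional_ideal_group_def ideal_prod_def)

lemma Gr_comm_group: "comm_group Gr"
proof (rule comm_groupI; unfold Gr_simps)
  fix I assume "I \<in> fracs"
  then show "\<exists>J\<in>fracs. J \<star> I = OF" using ideal_inverse by metis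
qed (simp_all add: ideal_prod_frac OF_frac ideal_prod_assoc OF_prod, rule ideal_prod_comm)

sublocale Gr: comm_group Gr
  by (rule Gr_comm_group)

abbreviation "Pr \<equiv> principal_ideals F"

lemma Pr_iff: "I \<in> Pr \<longleftrightarrow> (\<exists>x\<in>F. x \<noteq> 0 \<and> I = (*) x ` OF)"
  by (auto simp: principal_ideals_def)

lemma Pr_subgroup: "subgroup Pr Gr"
proof (rule Gr.subgroupI)
  show sub: "Pr \<subseteq> carrier Gr"
    unfolding Gr_simps using scale_frac[OF OF_frac] by (auto simp: Pr_iff)
  have "(*) 1 ` OF \<in> Pr" unfolding Pr_iff using F_closed(1) by (intro bexI[of _ 1]) auto
  then show "Pr \<noteq> {}" by blast
next
  fix I assume "I \<in> Pr"
  then obtain x where x: "x \<in> F" "x \<noteq> 0" "I = (*) x ` OF" by (auto simp: Pr_iff)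
  have "(*) (1 / x) ` OF \<in> fracs" "I \<in> fracs" unfolding x(3) using x(1,2) by (intro scale_frac OF_frac F_closed; simp)+
  moreover have "(*) (1 / x) ` OF \<star> I = OF"
    unfolding x(3) ideal_prod_scale_left ideal_prod_scale_right OF_prod[OF OF_frac] scale_scale using x(2) by simp
  ultimately have "inv\<^bsub>Gr\<^esub> I = (*) (1 / x) ` OF"
    using Gr.inv_equality[of "(*) (1 / x) ` OF" I] by (simp add: Gr_simps)
  then show "inv\<^bsub>Gr\<^esub> I \<in> Pr"
    unfolding Pr_iff using x F_closed(8)[OF F_closed(1) x(1)] by (intro bexI[of _ "1 / x"]) auto
next
  fix I J assume "I \<in> Pr" "J \<in> Pr"
  then obtain x y where xy: "x \<in> F" "x \<noteq> 0" "I = (*) x ` OF" "y \<in> F" "y \<noteq> 0" "J = (*) y ` OF"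
    by (auto simp: Pr_iff)
  have "I \<star> J = (*) (y * x) ` OF"
    unfolding xy ideal_prod_scale_left ideal_prod_scale_right OF_prod[OF OF_frac] scale_scale by (simp add: mult.commute)
  then show "I \<otimes>\<^bsub>Gr\<^esub> J \<in> Pr"
    unfolding Gr_simps Pr_iff using xy F_closed(3) by (intro bexI[of _ "y * x"]) auto
qed

sublocale Pr: normal Pr Gr
  using Gr.normal_iff_subgroup Pr_subgroup by blast

abbreviation "Cl \<equiv> class_group F"
abbreviation "cl \<equiv> ideal_class F"

sublocale Cl: comm_group Cl
  unfolding class_group_def by (rule Gr.abelian_FactGroup[OF Pr_subgroup])

lemma cl_in: "I \<in> fracs \<Longrightarrow> cl I \<in> carrier Cl"
  unfolding class_group_def ideal_class_def FactGroup_def RCOSETS_def by (auto simp: Gr_simps)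

lemma cl_mult: "I \<in> fracs \<Longrightarrow> J \<in> fracs \<Longrightarrow> cl I \<otimes>\<^bsub>Cl\<^esub> cl J = cl (I \<star> J)"
  using Pr.rcos_sum[of I J] by (simp add: class_group_def ideal_class_def FactGroup_def Gr_simps)

lemma cl_eq_iff:
  assumes I: "I \<in> fracs" and J: "J \<in> fracs"
  shows "cl I = cl J \<longleftrightarrow> (\<exists>x\<in>F. x \<noteq> 0 \<and> I = (*) x ` J)"
proof -
  have mem: "I \<in> cl J \<longleftrightarrow> (\<exists>x\<in>F. x \<noteq> 0 \<and> I = (*) x ` J)"
  proof -
    have "I \<in> cl J \<longleftrightarrow> (\<exists>P\<in>Pr. I = P \<star> J)" by (auto simp: ideal_class_def r_coset_def Gr_simps)
    also have "\<dots> \<longleftrightarrow> (\<exists>x\<in>F. x \<noteq> 0 \<and> I = (*) x ` OF \<star> J)" by (simp only: Bex_def Pr_iff) blast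
    finally show ?thesis by (simp add: ideal_prod_scale_left OF_prod[OF J])
  qed
  have "I \<in> cl I" using Gr.rcos_self[of I Pr] Pr_subgroup I by (simp add: ideal_class_def Gr_simps)
  moreover have "I \<in> cl J \<Longrightarrow> cl J = cl I"
    using Gr.repr_independence[of I Pr J] Pr_subgroup J by (simp add: ideal_class_def Gr_simps)
  ultimately show ?thesis using mem by metis
qed

lemma cl_scale: "I \<in> fracs \<Longrightarrow> x \<in> F \<Longrightarrow> x \<noteq> 0 \<Longrightarrow> cl ((*) x ` I) = cl I"
  using cl_eq_iff[of "(*) x ` I" I] scale_frac[of I x] by blast

lemma cl_one: "cl OF = \<one>\<^bsub>Cl\<^esub>"
proof -
  have "cl OF \<otimes>\<^bsub>Cl\<^esub> cl OF = cl OF" using cl_mult[OF OF_frac OF_frac] OF_prod[OF OF_frac] by simp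
  then show ?thesis using Cl.r_cancel_one[of "cl OF" "cl OF"] cl_in[OF OF_frac] by simp
qed

lemma cl_cnj:
  assumes I: "I \<in> fracs"
  shows "cl (cnj ` I) = inv\<^bsub>Cl\<^esub> (cl I)"
proof -
  obtain r where r: "r \<noteq> 0" "r \<in> F" "I \<star> cnj ` I = (*) r ` OF" using ideal_conj_prod[OF I] .
  have "cl (cnj ` I) \<otimes>\<^bsub>Cl\<^esub> cl I = \<one>\<^bsub>Cl\<^esub>"
    using cl_mult[OF cnj_frac[OF I] I] cl_scale[OF OF_frac r(2,1)] r(3) cl_one by (simp add: ideal_prod_comm)
  then show ?thesis using Cl.inv_equality cl_in[OF I] cl_in[OF cnj_frac[OF I]] by metis
qed

end

section \<open>Form ideals\<close>

lemma csqrt_of_int_neg: "D < 0 \<Longrightarrow> csqrt (of_int D) = \<i> * of_real (sqrt (- of_int D))"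
proof -
  assume "D < 0"
  then show ?thesis using csqrt_of_real_nonpos[of "of_int D"] by simp
qed

context imag_quadratic
begin

text \<open>The class group in question belongs to a square root of \<open>- 3 * d\<close>, which
  equals \<open>n\<^sup>2 * D\<close>; its principal square root is \<open>n * s\<close>, so the
  square factor does not change the field.\<close>

lemma quadratic_field_eq:
  assumes n: "n > 0"
  shows "quadratic_field (n\<^sup>2 * D) = F"
proof -
  interpret cf: field complex_ring by (rule complex_ring_field)
  have carr: "carrier complex_ring = UNIV" by (simp add: ring_of_type_algebra_def)
  have "n\<^sup>2 * D < 0" using n neg by (simp add: mult_pos_neg)
  then have "csqrt (of_int (n\<^sup>2 * D)) = \<i> * of_real (sqrt (of_int (n\<^sup>2) * (- of_int D)))"
    by (simp only: csqrt_of_int_neg) simp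
  also have "sqrt (of_int (n\<^sup>2) * (- of_int D)) = of_int n * sqrt (- of_int D)"
    unfolding real_sqrt_mult using n by simp
  also have "\<i> * of_real (of_int n * sqrt (- of_int D)) = of_int n * s" by (simp add: s_eq)
  finally have r: "csqrt (of_int (n\<^sup>2 * D)) = of_int n * s" .
  define G where "G = generate_field complex_ring {of_int n * s}"
  have G: "is_subfield G" "of_int n * s \<in> G"
    using subfield_imp_is_subfield[OF cf.generate_field_is_subfield[of "{of_int n * s}"]]
    by (auto simp: G_def carr intro: generate_field.incl)
  note Gc = is_subfieldD[OF G(1)]
  have "of_int n * s / of_int n \<in> G" by (rule Gc(8)[OF G(2) Gc(10)])
  then have "s \<in> G" using n by simp
  then have "F \<subseteq> G" unfolding qfield_def using Gc by auto
  moreover have "G \<subseteq> F"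
    unfolding G_def
    by (rule cf.generate_field_min_subfield1[OF _ is_subfield_imp_subfield[OF F_subfield]])
      (use F_closed s_in_F in \<open>auto simp: carr\<close>)
  ultimately show ?thesis unfolding quadratic_field_def r G_def by blast
qed

definition \<tau> :: "int \<Rightarrow> complex" where "\<tau> b = (- of_int b + s) / 2"

lemma form_ideal_eq:
  assumes "form_disc (a, b, c) = D"
  shows "form_ideal (a, b, c) = {of_int m * of_int a + of_int n * \<tau> b | m n. True}"
proof -
  have "form_ideal (a, b, c) = int_module.span {of_int a, \<tau> b}"
    unfolding form_ideal.simps assms \<tau>_def s_def ..
  then show ?thesis by (simp only: zspan_pair)
qed

lemma form_leading_nonzero: "form_disc (a, b, c) = D \<Longrightarrow> a \<noteq> 0"
  using neg zero_le_power2[of b] by (auto simp: not_less[symmetric])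

lemma \<tau>_in: 
  assumes "form_disc (a, b, c) = D"
  shows "\<tau> b \<in> OF"
proof -
  have "even (- b - 1 * D)" using assms by auto
  moreover have "\<tau> b = (of_int (- b) + of_int 1 * s) / 2" by (simp add: \<tau>_def)
  ultimately show ?thesis unfolding OF_iff by blast
qed

lemma cnj_\<tau>: "cnj (\<tau> b) = - of_int b - \<tau> b"
  by (simp add: \<tau>_def cnj_s field_simps)

lemma \<tau>_norm:
  assumes "form_disc (a, b, c) = D"
  shows "\<tau> b * cnj (\<tau> b) = of_int (a * c)"
proof -
  have "\<tau> b * cnj (\<tau> b) = (of_int b * of_int b - s * s) / 4"
  proof -
    have "(- p + q) / 2 * ((- p - q) / 2) = (p * p - q * q) / 4" for p q :: complex
      unfolding times_divide_times_eq by (simp add: algebra_simps)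
    then have "\<tau> b * ((- of_int b - s) / 2) = (of_int b * of_int b - s * s) / 4" unfolding \<tau>_def .
    moreover have "cnj (\<tau> b) = (- of_int b - s) / 2" by (simp add: \<tau>_def cnj_s)
    ultimately show ?thesis by (simp only:)
  qed
  moreover have "s * s = of_int D" using s_square by (simp add: power2_eq_square)
  moreover have "of_int b * of_int b - 4 * of_int a * of_int c = (of_int D :: complex)"
    using arg_cong[OF assms, of "of_int :: int \<Rightarrow> complex"] by (simp add: power2_eq_square)
  ultimately show ?thesis by (simp add: algebra_simps)
qed

lemma \<tau>_square:
  assumes "form_disc (a, b, c) = D"
  shows "\<tau> b * \<tau> b = - of_int b * \<tau> b - of_int (a * c)"
proof -
  have "\<tau> b * (- of_int b - \<tau> b) = of_int (a * c)" using \<tau>_norm[OF assms] unfolding cnj_\<tau> .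
  then show ?thesis by (simp add: algebra_simps)
qed

text \<open>\<open>\<tau> b\<close> is a root of \<open>X\<^sup>2 + b * X + a * c\<close>, and
  \<open>w\<close> differs from it by an integer, so multiplying the two generators by
  \<open>w\<close> stays in the lattice.\<close>

lemma form_ideal_frac:
  assumes disc: "form_disc f = D"
  shows "form_ideal f \<in> fracs"
proof -
  obtain a b c where f: "f = (a, b, c)" by (cases f)
  note disc = disc[unfolded f]
  note eq = form_ideal_eq[OF disc]
  let ?I = "form_ideal (a, b, c)"
  have sub: "int_module.subspace ?I" by simp
  have "of_int 1 * of_int a + of_int 0 * \<tau> b \<in> ?I" "of_int 0 * of_int a + of_int 1 * \<tau> b \<in> ?I" unfolding eq by blast+
  then have mem: "of_int a \<in> ?I" "\<tau> b \<in> ?I" by simp_all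
  have "even (D + b)" using disc by auto
  then obtain k where "D + b = 2 * k" by (elim evenE)
  then have k: "(of_int D :: complex) = 2 * of_int k - of_int b" by (simp add: algebra_simps flip: of_int_add)
  have w: "w = \<tau> b + of_int k" by (simp add: w_def \<tau>_def k field_simps)
  have "w * of_int a = of_int a * \<tau> b + of_int k * of_int a" by (simp add: w algebra_simps)
  also have "\<dots> \<in> ?I" by (intro int_module.subspace_add[OF sub] int_module.subspace_scale[OF sub] mem)
  finally have wa: "w * of_int a \<in> ?I" .
  have "w * \<tau> b = \<tau> b * \<tau> b + of_int k * \<tau> b" by (simp add: w algebra_simps)
  also have "\<dots> = of_int (k - b) * \<tau> b + of_int (- c) * of_int a"
    unfolding \<tau>_square[OF disc] by (simp add: algebra_simps)
  also have "\<dots> \<in> ?I" by (intro int_module.subspace_add[OF sub] int_module.subspace_scale[OF sub] mem)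
  finally have wt: "w * \<tau> b \<in> ?I" .
  show ?thesis
    unfolding f fracs_iff
  proof (intro conjI ballI)
    show "?I \<subseteq> F"
    proof
      fix x assume "x \<in> ?I"
      then obtain m n where "x = of_int m * of_int a + of_int n * \<tau> b" unfolding eq by blast
      then show "x \<in> F" using OF_in_F[OF \<tau>_in[OF disc]] by (simp add: F_closed(2,3,10))
    qed
    show "int_module.subspace ?I" by (rule sub)
    show "?I \<noteq> {0}" using mem(1) form_leading_nonzero[OF disc] by auto
  next
    fix r x assume "r \<in> OF" "x \<in> ?I"
    then obtain p q m n where "r = of_int p * 1 + of_int q * w" and x: "x = of_int m * of_int a + of_int n * \<tau> b"
      using OF_coords unfolding eq by blast
    then have "r * x = of_int p * x + (of_int (q * m) * (w * of_int a) + of_int (q * n) * (w * \<tau> b))"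
      by (simp add: algebra_simps)
    also have "\<dots> \<in> ?I"
      by (intro int_module.subspace_add[OF sub] int_module.subspace_scale[OF sub] wa wt \<open>x \<in> ?I\<close>)
    finally show "r * x \<in> ?I" .
  next
    have "\<forall>x\<in>?I. 1 * x \<in> OF"
    proof
      fix x assume "x \<in> ?I"
      then obtain m n where "x = of_int m * of_int a + of_int n * \<tau> b" unfolding eq by blast
      then show "1 * x \<in> OF" using \<tau>_in[OF disc] by (simp add: OF_closed(1,2,4))
    qed
    then show "\<exists>c\<in>OF. c \<noteq> 0 \<and> (\<forall>x\<in>?I. c * x \<in> OF)" using OF_closed(5) by (intro bexI[of _ 1]) auto
  qed
qed

text \<open>Products of generators and their conjugates are \<open>a * a\<close>,
  \<open>a * \<tau> b\<close>, \<open>a * cnj (\<tau> b)\<close> and \<open>a * c\<close>, all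
  multiples of \<open>a\<close>. Conversely the product contains \<open>a * a\<close>,
  \<open>a * b\<close> and \<open>a * c\<close>, hence \<open>a\<close>, because a form of
  fundamental discriminant is primitive.\<close>

lemma form_ideal_conj_prod:
  assumes disc: "form_disc (a, b, c) = D"
  shows "form_ideal (a, b, c) \<star> cnj ` form_ideal (a, b, c) = (*) (of_int a) ` OF"
proof
  note eq = form_ideal_eq[OF disc]
  let ?I = "form_ideal (a, b, c)" let ?t = "\<tau> b"
  note I = form_ideal_frac[OF disc]
  have asub: "int_module.subspace ((*) (of_int a) ` OF)" by (rule scale_subspace[OF OF_subspace])
  show "?I \<star> cnj ` ?I \<subseteq> (*) (of_int a) ` OF"
    unfolding ideal_prod_subset_iff[OF asub]
  proof (intro ballI)
    fix x y assume "x \<in> ?I" "y \<in> cnj ` ?I"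
    then obtain k l m n where x: "x = of_int k * of_int a + of_int l * ?t"
      and y: "y = cnj (of_int m * of_int a + of_int n * ?t)"
      unfolding eq by blast
    have "x * y = of_int (k * m * a * a) + of_int (k * n * a) * cnj ?t + of_int (l * m * a) * ?t
        + of_int (l * n) * (?t * cnj ?t)"
      by (simp add: x y algebra_simps)
    also have "\<dots> = of_int a * (of_int (k * m * a) + of_int (k * n) * cnj ?t + of_int (l * m) * ?t + of_int (l * n * c))"
      unfolding \<tau>_norm[OF disc] by (simp add: algebra_simps)
    finally have "x * y = \<dots>" .
    moreover have "of_int (k * m * a) + of_int (k * n) * cnj ?t + of_int (l * m) * ?t + of_int (l * n * c) \<in> OF"
      using \<tau>_in[OF disc] cnj_OF by (intro OF_closed(1,2,4)) auto
    ultimately show "x * y \<in> (*) (of_int a) ` OF" by (rule image_eqI)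
  qed
  have P: "?I \<star> cnj ` ?I \<in> fracs" by (intro ideal_prod_frac cnj_frac I)
  note sub = fracsD(2)[OF P]
  have "of_int 1 * of_int a + of_int 0 * ?t \<in> ?I" "of_int 0 * of_int a + of_int 1 * ?t \<in> ?I" unfolding eq by blast+
  then have mem: "of_int a \<in> ?I" "?t \<in> ?I" by simp_all
  then have cmem: "of_int a \<in> cnj ` ?I" "cnj ?t \<in> cnj ` ?I" by (auto intro: image_eqI[of _ _ "of_int a"])
  have "Gcd {a, b, c} = 1" using fund_disc_primitive_form[of "(a, b, c)"] fund disc by simp
  then have g: "gcd a (gcd b c) = 1" by simp
  obtain p q where pq: "p * b + q * c = gcd b c" using bezout_int by blast
  obtain u v where "u * a + v * gcd b c = 1" using bezout_int[of a "gcd b c"] g by auto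
  then have bez: "u * a + v * p * b + v * q * c = 1" unfolding pq[symmetric] by (simp add: algebra_simps)
  have "of_int a = of_int a * (of_int (u * a + v * p * b + v * q * c) :: complex)" unfolding bez by simp
  also have "\<dots> = of_int u * (of_int a * of_int a) + of_int (- v * p) * (of_int a * cnj ?t + ?t * of_int a)
      + of_int (v * q) * (?t * cnj ?t)"
    unfolding \<tau>_norm[OF disc] unfolding cnj_\<tau> by (simp add: algebra_simps)
  also have "\<dots> \<in> ?I \<star> cnj ` ?I"
    by (intro int_module.subspace_add[OF sub] int_module.subspace_scale[OF sub] ideal_prod_memI mem cmem)
  finally have "of_int a \<in> ?I \<star> cnj ` ?I" .
  then show "(*) (of_int a) ` OF \<subseteq> ?I \<star> cnj ` ?I"
    using fracsD(3)[OF P] by (auto simp: mult.commute)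
qed

text \<open>The norm of \<open>x * a - y * \<tau> b\<close> is \<open>a\<close> times the value of
  the form at \<open>(x, y)\<close>. The substitution takes the basis \<open>a\<close>,
  \<open>- \<tau> b\<close> to \<open>e1\<close>, \<open>e2\<close>, so \<open>e1\<close> has norm
  \<open>a * a'\<close>, and multiplication by \<open>cnj e1 / a\<close> turns \<open>e1\<close>
  into \<open>a'\<close> and the lattice into that of \<open>g\<close>.\<close>

lemma SL2_class_ideal:
  assumes disc: "form_disc f = D" and g: "g \<in> SL2_class f"
  shows "form_disc g = D" "\<exists>x\<in>F. x \<noteq> 0 \<and> form_ideal g = (*) x ` form_ideal f"
proof -
  obtain a b c where f: "f = (a, b, c)" by (cases f)
  obtain a' b' c' where g': "g = (a', b', c')" by (cases g)
  obtain p q r t where pqrt: "p * t - q * r = 1"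
    and ev: "\<And>x y. form_eval g x y = form_eval f (p * x + q * y) (r * x + t * y)"
    using g by (auto simp: SL2_class_def)
  have a': "a' = a * p * p + b * p * r + c * r * r"
    using ev[of 1 0] by (simp add: f g' power2_eq_square mult.assoc)
  have c': "c' = a * q * q + b * q * t + c * t * t"
    using ev[of 0 1] by (simp add: f g' power2_eq_square mult.assoc)
  have "a' + b' + c' = a * (p + q) * (p + q) + b * (p + q) * (r + t) + c * (r + t) * (r + t)"
    using ev[of 1 1] by (simp add: f g' power2_eq_square mult.assoc)
  then have b': "b' = 2 * a * p * q + b * (p * t + q * r) + 2 * c * r * t"
    unfolding a' c' by (simp add: algebra_simps)
  have "b' * b' - 4 * a' * c' = (b * b - 4 * a * c) * ((p * t - q * r) * (p * t - q * r))"
    unfolding a' b' c' by (simp add: algebra_simps)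
  then show disc': "form_disc g = D" using disc pqrt by (simp add: f g' power2_eq_square)
  note disc = disc[unfolded f] and disc' = disc'[unfolded g']
  have a0: "a \<noteq> 0" "a' \<noteq> 0" using form_leading_nonzero[OF disc] form_leading_nonzero[OF disc'] by simp_all
  define e1 e2 where "e1 = of_int p * of_int a - of_int r * \<tau> b" and "e2 = of_int q * of_int a - of_int t * \<tau> b"
  have I: "form_ideal (a, b, c) = {of_int m * e1 + of_int n * e2 | m n. True}"
    unfolding form_ideal_eq[OF disc]
  proof (intro equalityI subsetI)
    fix x assume "x \<in> {of_int m * of_int a + of_int n * \<tau> b | m n. True}"
    then obtain m n where x: "x = of_int m * of_int a + of_int n * \<tau> b" by blast
    have "of_int (m * t + n * q) * e1 + of_int (- m * r - n * p) * e2
        = of_int m * of_int a * of_int (p * t - q * r) + of_int n * \<tau> b * of_int (p * t - q * r)"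
      by (simp add: e1_def e2_def algebra_simps)
    then have "x = of_int (m * t + n * q) * e1 + of_int (- m * r - n * p) * e2"
      unfolding pqrt x by simp
    then show "x \<in> {of_int m * e1 + of_int n * e2 | m n. True}" by blast
  next
    fix x assume "x \<in> {of_int m * e1 + of_int n * e2 | m n. True}"
    then obtain m n where "x = of_int m * e1 + of_int n * e2" by blast
    then have "x = of_int (m * p + n * q) * of_int a + of_int (- m * r - n * t) * \<tau> b"
      by (simp add: e1_def e2_def algebra_simps)
    then show "x \<in> {of_int m * of_int a + of_int n * \<tau> b | m n. True}" by blast
  qed
  define z where "z = cnj e1 / of_int a"
  have tt: "\<tau> b * \<tau> b = - of_int b * \<tau> b - of_int (a * c)" by (rule \<tau>_square[OF disc])
  have ce1: "cnj e1 = of_int p * of_int a + of_int r * of_int b + of_int r * \<tau> b"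
    by (simp add: e1_def cnj_\<tau> algebra_simps)
  have e11: "cnj e1 * e1 = of_int a * of_int a'"
  proof -
    have "cnj e1 * e1 = of_int (p * p * a * a + r * b * p * a) - of_int (r * r * b) * \<tau> b - of_int (r * r) * (\<tau> b * \<tau> b)"
      unfolding ce1 unfolding e1_def by (simp add: algebra_simps)
    then show ?thesis unfolding tt a' by (simp add: algebra_simps)
  qed
  have e12: "cnj e1 * e2 = - of_int a * \<tau> b'"
  proof -
    have "cnj e1 * e2 = of_int (p * q * a * a + r * b * q * a) + of_int (r * q * a - p * t * a - r * b * t) * \<tau> b
        - of_int (r * t) * (\<tau> b * \<tau> b)"
      unfolding ce1 e2_def by (simp add: algebra_simps)
    also have "\<dots> = of_int a * (of_int (p * q * a + r * b * q + r * t * c) - of_int (p * t - q * r) * \<tau> b)"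
      unfolding tt by (simp add: algebra_simps)
    also have "\<dots> = of_int a * (of_int (p * q * a + r * b * q + r * t * c) - \<tau> b)"
      unfolding pqrt by simp
    also have "of_int (p * q * a + r * b * q + r * t * c) - \<tau> b = - \<tau> b'"
    proof -
      have "b' - b = 2 * (p * q * a + r * b * q + r * t * c) + b * (p * t - q * r) - b"
        unfolding b' by (simp add: algebra_simps)
      then have "b' - b = 2 * (p * q * a + r * b * q + r * t * c)" unfolding pqrt by simp
      then have "(of_int b' :: complex) - of_int b = 2 * of_int (p * q * a + r * b * q + r * t * c)"
        by (metis of_int_diff of_int_mult of_int_numeral)
      then have "of_int (p * q * a + r * b * q + r * t * c) = (of_int b' - of_int b) / (2::complex)" by simp
      then show ?thesis unfolding \<tau>_def by (simp add: field_simps)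
    qed
    finally show ?thesis by simp
  qed
  have z1: "z * e1 = of_int a'" "z * e2 = - \<tau> b'"
    using e11 e12 a0 by (simp_all add: z_def)
  have "(*) z ` form_ideal (a, b, c) = form_ideal (a', b', c')"
    unfolding I form_ideal_eq[OF disc']
  proof (intro equalityI subsetI)
    fix x assume "x \<in> (*) z ` {of_int m * e1 + of_int n * e2 | m n. True}"
    then obtain m n where "x = z * (of_int m * e1 + of_int n * e2)" by blast
    then have "x = of_int m * (z * e1) + of_int n * (z * e2)" by (simp add: algebra_simps)
    then have "x = of_int m * of_int a' + of_int (- n) * \<tau> b'" unfolding z1 by simp
    then show "x \<in> {of_int m * of_int a' + of_int n * \<tau> b' | m n. True}" by blast
  next
    fix x assume "x \<in> {of_int m * of_int a' + of_int n * \<tau> b' | m n. True}"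
    then obtain m n where "x = of_int m * of_int a' + of_int n * \<tau> b'" by blast
    then have "x = of_int m * (z * e1) + of_int (- n) * (z * e2)" unfolding z1 by simp
    then have "x = z * (of_int m * e1 + of_int (- n) * e2)" by (simp add: algebra_simps)
    then show "x \<in> (*) z ` {of_int m * e1 + of_int n * e2 | m n. True}" by blast
  qed
  moreover have "z \<in> F"
    unfolding z_def ce1 using OF_in_F[OF \<tau>_in[OF disc]] by (intro F_closed(2,3,8,10))
  moreover have "z \<noteq> 0" using z1(1) a0 by auto
  ultimately show "\<exists>x\<in>F. x \<noteq> 0 \<and> form_ideal g = (*) x ` form_ideal f" unfolding f g' by metis
qed

lemma self_in_SL2_class: "f \<in> SL2_class f"
  unfolding SL2_class_def by (intro CollectI exI[of _ 1] exI[of _ 0]) simp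

text \<open>Equivalent forms give ideals in one class, so the set to which
  \<open>gauss_class\<close> applies \<open>the_elem\<close> is a singleton.\<close>

lemma gauss_class_SL2_class:
  assumes "form_disc f = D"
  shows "gauss_class F (SL2_class f) = cl (form_ideal f)"
proof -
  have "cl (form_ideal g) = cl (form_ideal f)" if g: "g \<in> SL2_class f" for g
  proof -
    obtain x where "x \<in> F" "x \<noteq> 0" "form_ideal g = (*) x ` form_ideal f"
      using SL2_class_ideal(2)[OF assms g] by blast
    then show ?thesis using cl_scale[OF form_ideal_frac[OF assms]] by simp
  qed
  then have "(\<lambda>f. cl (form_ideal f)) ` SL2_class f = (\<lambda>_. cl (form_ideal f)) ` SL2_class f"
    by (rule image_cong[OF refl])
  also have "\<dots> = {cl (form_ideal f)}" using self_in_SL2_class[of f] by (subst image_constant) auto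
  finally have "(\<lambda>f. cl (form_ideal f)) ` SL2_class f = {cl (form_ideal f)}" .
  then show ?thesis by (simp add: gauss_class_def)
qed

text \<open>A unit \<open>(a + b * s) / 2\<close> has norm 1, that is
  \<open>a\<^sup>2 - b\<^sup>2 * D = 4\<close>. For \<open>D \<le> - 4\<close> this leaves
  \<open>b = 0\<close> or \<open>a = 0\<close>, so its square is 1 or -1. Excluding
  \<open>D = - 3\<close> removes the units of order 3 and 6.\<close>

lemma unit_fourth_power:
  assumes D: "D \<noteq> - 3" and u: "u \<in> OF" "u' \<in> OF" "u * u' = 1"
  shows "u ^ 4 = 1"
proof -
  obtain n where n: "u * cnj u = of_int n" using OF_trace_norm[OF u(1)] by metis
  obtain m where m: "u' * cnj u' = of_int m" using OF_trace_norm[OF u(2)] by metis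
  have "(u * cnj u) * (u' * cnj u') = (u * u') * cnj (u * u')" by (simp add: mult_ac)
  then have "of_int (n * m) = (of_int 1 :: complex)" unfolding n m u(3) by simp
  then have "n * m = 1" unfolding of_int_eq_iff .
  moreover have "n \<ge> 0"
  proof -
    have "Re (u * cnj u) \<ge> 0" by simp
    then show ?thesis unfolding n by simp
  qed
  ultimately have n1: "n = 1" by (auto simp: zmult_eq_1_iff)
  obtain a b where ab: "u = (of_int a + of_int b * s) / 2" using u(1) OF_iff by blast
  have "4 * (u * cnj u) = (2 * u) * cnj (2 * u)" by simp
  also have "2 * u = of_int a + of_int b * s" by (simp add: ab)
  also have "(of_int a + of_int b * s) * cnj (of_int a + of_int b * s) = of_int (a * a) - of_int (b * b) * s\<^sup>2"
    by (simp add: cnj_s power2_eq_square algebra_simps)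
  also have "\<dots> = of_int (a * a - b * b * D)" by (simp add: s_square)
  finally have "of_int (a * a - b * b * D) = (of_int 4 :: complex)" unfolding n n1 by simp
  then have N: "a * a - b * b * D = 4" unfolding of_int_eq_iff .
  have sq: "(2 * u)\<^sup>2 = of_int (a * a + b * b * D) + of_int (2 * a * b) * s"
    using s_square by (simp add: ab power2_eq_square algebra_simps)
  have "D \<le> - 4"
  proof -
    have "D mod 4 = 0 \<or> D mod 4 = 1" using fund by (simp add: fund_disc_def)
    then have "D \<noteq> - 1" "D \<noteq> - 2" by auto
    then show ?thesis using neg D by linarith
  qed
  show ?thesis
  proof (cases "b = 0")
    case True
    then have "a * a + b * b * D = 4" "2 * a * b = 0" using N by simp_all
    then have "(2 * u)\<^sup>2 = 4" unfolding sq by (simp only:) simp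
    then have "u\<^sup>2 = 1" by simp
    then show ?thesis by (metis power2_eq_square power4_eq_xxxx mult.assoc mult_1)
  next
    case False
    then have "b * b \<ge> 1" by (metis int_one_le_iff_zero_less zero_less_mult_iff linorder_neqE_linordered_idom)
    then have "b * b * (- D) \<ge> 1 * 4" using \<open>D \<le> - 4\<close> by (intro mult_mono) auto
    then have "a * a \<le> 0" using N by simp
    then have a: "a = 0" by (metis mult_eq_0_iff not_square_less_zero order_le_less)
    then have "a * a + b * b * D = - 4" "2 * a * b = 0" using N by simp_all
    then have "(2 * u)\<^sup>2 = - 4" unfolding sq by (simp only:) simp
    then have "u\<^sup>2 = - 1" by simp
    then show ?thesis by (metis power2_eq_square power4_eq_xxxx mult.assoc mult_1 mult_minus1 minus_minus)
  qed
qed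

lemma unit_scale:
  assumes I: "I \<in> fracs" and u: "u \<in> OF" "u' \<in> OF" "u * u' = 1"
  shows "(*) u ` I = I"
proof
  show "(*) u ` I \<subseteq> I" using fracsD(3)[OF I u(1)] by blast
  have "x = u * (u' * x)" for x using u(3) by (simp flip: mult.assoc)
  then show "I \<subseteq> (*) u ` I" using fracsD(3)[OF I u(2)] by blast
qed

text \<open>\<open>\<mu> ^ 3\<close> stabilises \<open>E\<close>, so it is a unit u; from u^4 = 1
  follows u = u^9, the cube of the unit u^3.\<close>

lemma cube_scaling:
  assumes D: "D \<noteq> - 3" and E: "E \<in> fracs" and \<mu>: "(*) (\<mu> ^ 3) ` E = E"
  obtains \<epsilon> \<epsilon>' where "\<epsilon> \<in> OF" "\<epsilon>' \<in> OF" "\<epsilon> * \<epsilon>' = 1" "\<epsilon> ^ 3 = \<mu> ^ 3"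
proof -
  \<comment> \<open>Multiplying by the conjugate ideal replaces \<open>E\<close> by a principal
    ideal, where the stabiliser can be read off from the generator.\<close>
  obtain r where r: "r \<noteq> 0" "r \<in> F" "E \<star> cnj ` E = (*) r ` OF" using ideal_conj_prod[OF E] .
  have "(*) (\<mu> ^ 3) ` (E \<star> cnj ` E) = E \<star> cnj ` E"
    using \<mu> by (simp only: ideal_prod_scale_left[symmetric])
  then have eq: "(*) (\<mu> ^ 3 * r) ` OF = (*) r ` OF" unfolding r(3) scale_scale .
  have "\<mu> ^ 3 * r * 1 \<in> (*) r ` OF" unfolding eq[symmetric] using OF_closed(5) by blast
  then have u: "\<mu> ^ 3 \<in> OF" using r(1) by auto
  have "r * 1 \<in> (*) (\<mu> ^ 3 * r) ` OF" unfolding eq using OF_closed(5) by blast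
  then obtain u' where u': "u' \<in> OF" "r * 1 = \<mu> ^ 3 * r * u'" by blast
  then have uu': "\<mu> ^ 3 * u' = 1" using r(1) by simp
  have u4: "(\<mu> ^ 3) ^ 4 = 1" by (rule unit_fourth_power[OF D u u'(1) uu'])
  have pow: "x ^ 3 \<in> OF" if "x \<in> OF" for x
    using that OF_closed(2) by (simp add: power3_eq_cube)
  have "(\<mu> ^ 3) ^ 3 * u' ^ 3 = 1" using uu' by (metis power_mult_distrib power_one)
  moreover have "((\<mu> ^ 3) ^ 3) ^ 3 = \<mu> ^ 3"
  proof -
    have "((x ^ 3) ^ 3) ^ 3 = ((x ^ 3) ^ 4)\<^sup>2 * x ^ 3" for x :: complex
      by (simp flip: power_mult power_add)
    then show ?thesis by (simp only: u4 power_one mult_1)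
  qed
  ultimately show ?thesis using that[OF pow[OF u] pow[OF u'(1)]] by blast
qed

text \<open>Equal cubes make \<open>\<mu> ^ 3\<close> stabilise \<open>E\<close>, hence it is the
  cube of a unit \<epsilon>. As \<epsilon> stabilises the lattice, \<mu> may be divided by it, and
  the quotient is a cube root of unity.\<close>

lemma cube_equal_imp_root_of_unity:
  assumes D: "D \<noteq> - 3" and I': "I' \<in> fracs" and E: "E \<in> fracs"
    and L: "L = (*) \<mu> ` L'" "L' = (*) \<kappa>' ` I'" "L \<star> L \<star> L = E" "L' \<star> L' \<star> L' = E"
  obtains \<zeta> where "\<zeta> ^ 3 = 1" "L = (*) \<zeta> ` L'"
proof -
  have "E = (*) (\<mu> ^ 3) ` E"
    using L(3) unfolding L(1) ideal_prod_scale_left ideal_prod_scale_right scale_scale L(4)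
    by (simp add: power3_eq_cube mult.assoc)
  then obtain \<epsilon> \<epsilon>' where \<epsilon>: "\<epsilon> \<in> OF" "\<epsilon>' \<in> OF" "\<epsilon> * \<epsilon>' = 1" "\<epsilon> ^ 3 = \<mu> ^ 3"
    using cube_scaling[OF D E, of \<mu>] by metis
  have unit: "(*) \<epsilon> ` L' = L'"
  proof -
    have "(*) \<epsilon> ` L' = (*) \<kappa>' ` (*) \<epsilon> ` I'" unfolding L(2) scale_scale by (simp add: mult.commute)
    then show ?thesis unfolding unit_scale[OF I' \<epsilon>(1-3)] L(2) .
  qed
  have "L = (*) (\<mu> * \<epsilon>') ` (*) \<epsilon> ` L'"
  proof -
    have "\<mu> * \<epsilon>' * \<epsilon> = \<mu>" using \<epsilon>(3) by (metis mult.assoc mult.commute mult_1_right)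
    then show ?thesis unfolding L(1) scale_scale by (simp only:)
  qed
  then have "L = (*) (\<mu> * \<epsilon>') ` L'" unfolding unit .
  moreover have "(\<mu> * \<epsilon>') ^ 3 = 1"
  proof -
    have "(\<mu> * \<epsilon>') ^ 3 = (\<epsilon> * \<epsilon>') ^ 3" unfolding power_mult_distrib \<epsilon>(4) ..
    then show ?thesis using \<epsilon>(3) by simp
  qed
  ultimately show ?thesis using that by blast
qed

text \<open>For \<open>n = 1\<close> this is the ramified prime ideal above \<open>3\<close>, for \<open>n = 3\<close> the ideal \<open>(3)\<close>.\<close>

definition three_ideal :: "int \<Rightarrow> int \<Rightarrow> complex set"
  where "three_ideal n d = {(of_int (3 * a) + of_int (b * n) * s) / 2 | a b. even (a - b * d)}"

context
  fixes n d :: int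
  assumes nd: "n = 1 \<and> D = - 3 * d \<or> n = 3 \<and> d = - 3 * D" and d4: "d mod 4 \<in> {0, 1}"
begin

text \<open>For \<open>n = 1\<close>, completing the coefficients 3 and \<open>- 3 * d\<close> to a
  form of discriminant \<open>D = - 3 * d\<close> requires \<open>4 * c = d * (3 * d + 1)\<close>,
  which is solvable since \<open>d\<close> is 0 or 1 mod 4. This brings the ideal under the results
  on form ideals.\<close>

lemma three_ideal_cases:
  obtains c where "n = 1" "form_disc (3, - 3 * d, c) = D" "three_ideal n d = form_ideal (3, - 3 * d, c)"
  | "n = 3" "three_ideal n d = (*) 3 ` OF"
proof (cases "n = 1")
  case True
  then have D: "D = - 3 * d" using nd by auto
  have "4 dvd d * (3 * d + 1)"
  proof -
    have "4 dvd d \<or> 4 dvd d - 1" using d4 by (auto simp: mod_eq_dvd_iff[of d 4 1, simplified])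
    moreover have "3 * d + 1 = 3 * (d - 1) + 4" by simp
    ultimately show ?thesis by (metis dvd_add dvd_mult dvd_mult2 dvd_refl)
  qed
  then obtain c where c: "d * (3 * d + 1) = 4 * c" by auto
  have "(- 3 * d)\<^sup>2 - 4 * 3 * c = 9 * d * d - 3 * (d * (3 * d + 1))"
    unfolding c by (simp add: power2_eq_square)
  also have "\<dots> = D" unfolding D by (simp add: algebra_simps)
  finally have disc: "form_disc (3, - 3 * d, c) = D" by simp
  have "three_ideal n d = form_ideal (3, - 3 * d, c)"
    unfolding form_ideal_eq[OF disc] three_ideal_def True
  proof (intro equalityI subsetI)
    fix x assume "x \<in> {(of_int (3 * a) + of_int (b * 1) * s) / 2 | a b. even (a - b * d)}"
    then obtain a b where x: "x = (of_int (3 * a) + of_int (b * 1) * s) / 2" and "even (a - b * d)" by blast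
    then obtain k where "a - b * d = 2 * k" by (elim evenE)
    then have a: "a = 2 * k + b * d" by simp
    have "x = of_int k * of_int 3 + of_int b * \<tau> (- 3 * d)" unfolding x a \<tau>_def by (simp add: field_simps)
    then show "x \<in> {of_int m * of_int 3 + of_int n * \<tau> (- 3 * d) | m n. True}" by blast
  next
    fix x assume "x \<in> {of_int m * of_int 3 + of_int n * \<tau> (- 3 * d) | m n. True}"
    then obtain m n where "x = of_int m * of_int 3 + of_int n * \<tau> (- 3 * d)" by blast
    then have "x = (of_int (3 * (2 * m + n * d)) + of_int (n * 1) * s) / 2"
      unfolding \<tau>_def by (simp add: field_simps)
    moreover have "even (2 * m + n * d - n * d)" by simp
    ultimately show "x \<in> {(of_int (3 * a) + of_int (b * 1) * s) / 2 | a b. even (a - b * d)}" by blast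
  qed
  then show ?thesis using that(1) True disc by blast
next
  case False
  then have n: "n = 3" and d: "d = - 3 * D" using nd by auto
  have "three_ideal n d = (*) 3 ` OF"
  proof (intro equalityI subsetI)
    fix x assume "x \<in> three_ideal n d"
    then obtain a b where x: "x = (of_int (3 * a) + of_int (b * n) * s) / 2" and e: "even (a - b * d)"
      unfolding three_ideal_def by blast
    have "x = 3 * ((of_int a + of_int b * s) / 2)" unfolding x n by (simp add: algebra_simps)
    moreover have "even (a - b * D)" using e unfolding d by auto
    ultimately show "x \<in> (*) 3 ` OF" unfolding OF_iff image_iff bex_simps by (metis OF_iff)
  next
    fix x assume "x \<in> (*) 3 ` OF"
    then obtain y where y: "y \<in> OF" "x = 3 * y" by blast
    obtain a b where ab: "y = (of_int a + of_int b * s) / 2" "even (a - b * D)" using y(1) OF_iff by blast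
    have "x = (of_int (3 * a) + of_int (b * n) * s) / 2" unfolding y ab(1) n by (simp add: algebra_simps)
    moreover have "even (a - b * d)" using ab(2) unfolding d by auto
    ultimately show "x \<in> three_ideal n d" unfolding three_ideal_def by blast
  qed
  then show ?thesis using that(2) n by blast
qed

lemma three_ideal_frac: "three_ideal n d \<in> fracs"
proof (rule three_ideal_cases)
  fix c assume c: "form_disc (3, - 3 * d, c) = D" "three_ideal n d = form_ideal (3, - 3 * d, c)"
  show ?thesis unfolding c(2) by (rule form_ideal_frac[OF c(1)])
next
  assume eq: "three_ideal n d = (*) 3 ` OF"
  show ?thesis unfolding eq by (rule scale_frac[OF OF_frac F_closed(13)]) simp
qed

lemma three_in_three_ideal: "3 \<in> three_ideal n d"
proof -
  have "3 = (of_int (3 * 2) + of_int (0 * n) * s) / 2" "even (2 - 0 * d)" by simp_all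
  then show ?thesis unfolding three_ideal_def by blast
qed

lemma cnj_three_ideal: "cnj ` three_ideal n d = three_ideal n d"
proof -
  have sub: "cnj x \<in> three_ideal n d" if mem: "x \<in> three_ideal n d" for x
  proof -
    obtain a b where x: "x = (of_int (3 * a) + of_int (b * n) * s) / 2" and e: "even (a - b * d)"
      using mem unfolding three_ideal_def by blast
    have "cnj x = (of_int (3 * a) + of_int (- b * n) * s) / 2" by (simp add: x cnj_s)
    moreover have "even (a - (- b) * d)" using e by auto
    ultimately show ?thesis unfolding three_ideal_def by blast
  qed
  show ?thesis
  proof
    show "three_ideal n d \<subseteq> cnj ` three_ideal n d" using sub by (metis complex_cnj_cnj image_eqI subsetI)
  qed (use sub in blast)
qed

text \<open>For \<open>n = 1\<close>, stability under conjugation identifies the square with the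
  product of the ideal and its conjugate, generated by the leading coefficient 3; for
  \<open>n = 3\<close> it is the square of (3).\<close>

lemma three_ideal_square: "three_ideal n d \<star> three_ideal n d = (*) (of_int (3 * n)) ` OF"
proof (rule three_ideal_cases)
  fix c assume c: "n = 1" "form_disc (3, - 3 * d, c) = D" "three_ideal n d = form_ideal (3, - 3 * d, c)"
  have "three_ideal n d \<star> three_ideal n d = three_ideal n d \<star> cnj ` three_ideal n d"
    by (simp only: cnj_three_ideal)
  also have "\<dots> = (*) (of_int 3) ` OF" unfolding c(3) by (rule form_ideal_conj_prod[OF c(2)])
  finally show ?thesis using c(1) by simp
next
  assume n: "n = 3" "three_ideal n d = (*) 3 ` OF"
  then show ?thesis
    by (simp only: ideal_prod_scale_left ideal_prod_scale_right OF_prod[OF OF_frac] scale_scale) simp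
qed

end

end

section \<open>Lagrange resolvents\<close>

lemma ideal_prod_left_comm: "I \<star> (J \<star> M) = J \<star> (I \<star> M)"
  by (simp only: ideal_prod_assoc[symmetric] ideal_prod_comm[of I J])

text \<open>A non-real root has its conjugate among the other two roots. The remaining root is then
  real and the product of differences is purely imaginary, so its square cannot be positive.\<close>

lemma cubic_root_real:
  fixes t1 t2 t3 :: complex
  assumes real: "t1 + t2 + t3 \<in> \<real>" "t1 * t2 + t1 * t3 + t2 * t3 \<in> \<real>" "t1 * t2 * t3 \<in> \<real>"
    and V: "((t2 - t1) * (t3 - t1) * (t3 - t2))\<^sup>2 = of_real v" "v > 0"
  shows "t1 \<in> \<real>"
proof (rule ccontr)
  assume nreal: "t1 \<notin> \<real>"
  have neq: "cnj t1 \<noteq> t1" using nreal by (simp add: Reals_cnj_iff)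
  let ?p = "\<lambda>z. z * z * z - (t1 + t2 + t3) * (z * z) + (t1 * t2 + t1 * t3 + t2 * t3) * z - t1 * t2 * t3"
  have factor: "?p z = (z - t1) * (z - t2) * (z - t3)" for z by (simp add: algebra_simps)
  have "cnj (?p t1) = ?p (cnj t1)"
    using real unfolding Reals_cnj_iff complex_cnj_diff complex_cnj_add complex_cnj_mult by simp
  moreover have "?p t1 = 0" unfolding factor by simp
  ultimately have "(cnj t1 - t1) * (cnj t1 - t2) * (cnj t1 - t3) = 0" unfolding factor by simp
  then have "t2 = cnj t1 \<or> t3 = cnj t1" using neq by auto
  \<comment> \<open>Stated for roots \<open>u\<close> and \<open>w\<close>, so that it covers both
    positions of the conjugate root.\<close>
  moreover have False
    if u: "u = cnj t1" and w: "t1 + u + w \<in> \<real>" and V': "((u - t1) * (w - t1) * (w - u))\<^sup>2 = of_real v" for u w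
  proof -
    have "t1 + cnj t1 = of_real (2 * Re t1)" by (simp add: complex_add_cnj)
    then have "t1 + u + w - of_real (2 * Re t1) = w" using u by simp
    then have wr: "cnj w = w" using w by (metis Reals_cnj_iff Reals_diff Reals_of_real)
    have "(w - t1) * (w - u) = (w - t1) * cnj (w - t1)" using wr u by simp
    then have "(w - t1) * (w - u) = of_real ((cmod (w - t1))\<^sup>2)" by (simp only: complex_norm_square)
    moreover have "u - t1 = of_real (- 2 * Im t1) * \<i>" by (simp add: u complex_eq_iff)
    ultimately have "(u - t1) * ((w - t1) * (w - u)) = of_real (- 2 * Im t1 * (cmod (w - t1))\<^sup>2) * \<i>"
      by (simp only: of_real_mult mult_ac)
    moreover have "(of_real r * \<i>)\<^sup>2 = of_real (- (r\<^sup>2))" for r by (simp add: power_mult_distrib)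
    ultimately have "((u - t1) * ((w - t1) * (w - u)))\<^sup>2 = of_real (- ((- 2 * Im t1 * (cmod (w - t1))\<^sup>2)\<^sup>2))"
      by (simp only:)
    then have "of_real (- ((- 2 * Im t1 * (cmod (w - t1))\<^sup>2)\<^sup>2)) = (of_real v :: complex)"
      using V' by (simp only: mult.assoc)
    then have "- ((- 2 * Im t1 * (cmod (w - t1))\<^sup>2)\<^sup>2) = v" unfolding of_real_eq_iff .
    moreover have "0 \<le> (- 2 * Im t1 * (cmod (w - t1))\<^sup>2)\<^sup>2" by (rule zero_le_power2)
    ultimately show False using V(2) by linarith
  qed
  moreover have "((t3 - t1) * (t2 - t1) * (t2 - t3))\<^sup>2 = of_real v"
    unfolding V(1)[symmetric] by (simp add: power2_eq_square algebra_simps)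
  moreover have "t1 + t3 + t2 \<in> \<real>" using real(1) by (simp add: ac_simps)
  ultimately show False using real(1) V(1) by blast
qed

context cubic_embeddings
begin

text \<open>The determinant with rows (1, 1, 1), the conjugates of \<open>x\<close> and the
  conjugates of \<open>y\<close>.\<close>

definition det3 :: "complex \<Rightarrow> complex \<Rightarrow> complex"
  where "det3 x y = (\<sigma>2 x * \<sigma>3 y - \<sigma>3 x * \<sigma>2 y) - (\<sigma>1 x * \<sigma>3 y - \<sigma>3 x * \<sigma>1 y) + (\<sigma>1 x * \<sigma>2 y - \<sigma>2 x * \<sigma>1 y)"

lemma trace_zero_sum: "x \<in> OK0 \<Longrightarrow> \<sigma>3 x = - \<sigma>1 x - \<sigma>2 x"
  using trace[of x] unfolding trace_zero_integers_def ring_of_integers_def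
  by (simp add: eq_neg_iff_add_eq_0 algebra_simps)

lemma trace_mult:
  assumes "x \<in> OK" "y \<in> OK"
  shows "of_int (int_trace (x * y)) = \<sigma>1 x * \<sigma>1 y + \<sigma>2 x * \<sigma>2 y + \<sigma>3 x * \<sigma>3 y"
  using int_trace[OF OK_closed(2)[OF assms]] assms OK_in_K simps1(4) simps2(4) simps3(4) by simp

text \<open>The squared determinant is the Gram determinant of 1, \<open>x\<close>, \<open>y\<close>
  for the trace form; at trace zero the row of 1 contributes just the factor tr 1 = 3.\<close>

lemma det3_square:
  assumes x: "x \<in> OK0" and y: "y \<in> OK0"
  shows "(det3 x y)\<^sup>2 = of_int (3 * (int_trace (x * x) * int_trace (y * y) - (int_trace (x * y))\<^sup>2))"
proof -
  note O = OK0_in_OK[OF x] OK0_in_OK[OF y]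
  have "(det3 x y)\<^sup>2 = 3 * ((\<sigma>1 x * \<sigma>1 x + \<sigma>2 x * \<sigma>2 x + \<sigma>3 x * \<sigma>3 x) * (\<sigma>1 y * \<sigma>1 y + \<sigma>2 y * \<sigma>2 y + \<sigma>3 y * \<sigma>3 y)
      - (\<sigma>1 x * \<sigma>1 y + \<sigma>2 x * \<sigma>2 y + \<sigma>3 x * \<sigma>3 y)\<^sup>2)"
    unfolding det3_def trace_zero_sum[OF x] trace_zero_sum[OF y]
    by (simp add: power2_eq_square algebra_simps)
  then show ?thesis using O by (simp add: trace_mult)
qed

end

text \<open>For a basis of the trace-zero integers the squared determinant is \<open>9 * d\<close>,
  which is positive. It is also a rational square times the discriminant of the cubic of the
  generator, since conjugates of \<beta> and \<gamma> are polynomials of degree at most two in the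
  roots. So that discriminant is positive and all roots are real.\<close>

theorem real_embeddings_exist:
  assumes K: "K \<in> cubic_fields d" and d: "fund_disc d" "d > 0"
  obtains \<sigma>1 \<sigma>2 \<sigma>3 where "cubic_embeddings K \<sigma>1 \<sigma>2 \<sigma>3"
    "\<And>x. x \<in> K \<Longrightarrow> \<sigma>1 x \<in> \<real>" "\<And>x. x \<in> K \<Longrightarrow> \<sigma>2 x \<in> \<real>" "\<And>x. x \<in> K \<Longrightarrow> \<sigma>3 x \<in> \<real>"
proof -
  have deg: "field_of_degree 3 K" and disc: "field_discriminant K = d"
    using K by (auto simp: cubic_fields_def)
  obtain \<sigma>1 \<sigma>2 \<sigma>3 t1 t2 t3 c0 c1 c2 \<theta> where emb: "cubic_embeddings K \<sigma>1 \<sigma>2 \<sigma>3"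
    and "cubic_generator K \<theta> c0 c1 c2"
    and t: "t1 + t2 + t3 = of_rat c2" "t1 * t2 + t1 * t3 + t2 * t3 = of_rat (- c1)" "t1 * t2 * t3 = of_rat c0"
    and coords: "\<forall>x\<in>K. \<exists>q0 q1 q2. x = of_rat q0 + of_rat q1 * \<theta> + of_rat q2 * \<theta>\<^sup>2 \<and>
      \<sigma>1 x = of_rat q0 + of_rat q1 * t1 + of_rat q2 * t1\<^sup>2 \<and>
      \<sigma>2 x = of_rat q0 + of_rat q1 * t2 + of_rat q2 * t2\<^sup>2 \<and>
      \<sigma>3 x = of_rat q0 + of_rat q1 * t3 + of_rat q2 * t3\<^sup>2"
    by (rule cubic_embeddings_exist[OF deg], rule that, assumption+, rule ballI, blast)
  note coords = bspec[OF coords]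
  interpret cubic_embeddings K \<sigma>1 \<sigma>2 \<sigma>3 by (rule emb)
  obtain \<beta> \<gamma> where basis: "Z_basis [\<beta>, \<gamma>] OK0" by (rule trace_zero_basis_exists)
  interpret cubic_trace_basis K \<sigma>1 \<sigma>2 \<sigma>3 d \<beta> \<gamma>
    by unfold_locales (use d disc basis in auto)
  have det: "(det3 \<beta> \<gamma>)\<^sup>2 = of_int (9 * d)"
    unfolding det3_square[OF basis_in] A_def[symmetric] B_def[symmetric] C_def[symmetric] gram_det by simp
  have \<beta>\<gamma>: "\<beta> \<in> K" "\<gamma> \<in> K" using basis_in_OK OK_in_K by auto
  obtain p0 p1 p2 where p: "\<sigma>1 \<beta> = of_rat p0 + of_rat p1 * t1 + of_rat p2 * t1\<^sup>2"
      "\<sigma>2 \<beta> = of_rat p0 + of_rat p1 * t2 + of_rat p2 * t2\<^sup>2"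
      "\<sigma>3 \<beta> = of_rat p0 + of_rat p1 * t3 + of_rat p2 * t3\<^sup>2"
    using coords[OF \<beta>\<gamma>(1)] by blast
  obtain q0 q1 q2 where q: "\<sigma>1 \<gamma> = of_rat q0 + of_rat q1 * t1 + of_rat q2 * t1\<^sup>2"
      "\<sigma>2 \<gamma> = of_rat q0 + of_rat q1 * t2 + of_rat q2 * t2\<^sup>2"
      "\<sigma>3 \<gamma> = of_rat q0 + of_rat q1 * t3 + of_rat q2 * t3\<^sup>2"
    using coords[OF \<beta>\<gamma>(2)] by blast
  \<comment> \<open>The minor formed by the coordinates of \<beta> and \<gamma> at \<theta> and
    \<theta>^2; it relates \<open>det3\<close> to the Vandermonde determinant of the roots.\<close>
  define m :: real where "m = of_rat (p1 * q2 - p2 * q1)"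
  have rr: "(of_rat z :: complex) = of_real (of_rat z)" for z
    by (cases z) (simp add: of_rat_rat)
  have "det3 \<beta> \<gamma> = of_rat (p1 * q2 - p2 * q1) * ((t2 - t1) * (t3 - t1) * (t3 - t2))"
    unfolding det3_def p q by (simp add: of_rat_diff of_rat_mult power2_eq_square algebra_simps)
  then have "of_real m * ((t2 - t1) * (t3 - t1) * (t3 - t2)) = det3 \<beta> \<gamma>" unfolding m_def rr by simp
  then have mV: "(of_real m)\<^sup>2 * ((t2 - t1) * (t3 - t1) * (t3 - t2))\<^sup>2 = of_int (9 * d)"
    using det by (simp only: power_mult_distrib[symmetric])
  have "m \<noteq> 0"
  proof
    assume "m = 0"
    then have "(of_int (9 * d) :: complex) = 0" using mV by simp
    then show False using d(2) by simp
  qed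
  then have V: "((t2 - t1) * (t3 - t1) * (t3 - t2))\<^sup>2 = of_real (of_int (9 * d) / m\<^sup>2)" "of_int (9 * d) / m\<^sup>2 > 0"
    using mV d(2) by (simp_all add: field_simps)
  have ratreal: "(of_rat z :: complex) \<in> \<real>" for z unfolding rr by simp
  have r: "t1 \<in> \<real>"
    by (rule cubic_root_real[OF _ _ _ V]) (simp_all only: t ratreal)
  have r2: "t2 \<in> \<real>"
  proof (rule cubic_root_real[OF _ _ _ _ V(2)])
    show "t2 + t1 + t3 \<in> \<real>" "t2 * t1 + t2 * t3 + t1 * t3 \<in> \<real>" "t2 * t1 * t3 \<in> \<real>"
      using t ratreal by (simp_all add: ac_simps)
    show "((t1 - t2) * (t3 - t2) * (t3 - t1))\<^sup>2 = of_real (of_int (9 * d) / m\<^sup>2)"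
      unfolding V(1)[symmetric] by (simp add: power2_eq_square algebra_simps)
  qed
  have "t3 = of_rat c2 - t1 - t2" unfolding t(1)[symmetric] by simp
  then have r3: "t3 \<in> \<real>" using r r2 ratreal by simp
  have "\<sigma>1 x \<in> \<real>" "\<sigma>2 x \<in> \<real>" "\<sigma>3 x \<in> \<real>" if "x \<in> K" for x
    using coords[OF that] r r2 r3 ratreal by (auto intro!: Reals_add Reals_mult Reals_power)
  then show ?thesis using that emb by blast
qed

section \<open>The Lagrange resolvent of a totally real cubic field\<close>

definition \<omega> :: complex where "\<omega> = Complex (- 1 / 2) (sqrt 3 / 2)"

lemma \<omega>_square: "\<omega> * \<omega> = - 1 - \<omega>"
  by (simp add: \<omega>_def complex_eq_iff)

lemma \<omega>_square': "\<omega> * (\<omega> * z) = - z - \<omega> * z"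
  unfolding mult.assoc[symmetric] \<omega>_square by (simp add: algebra_simps)

lemma cnj_\<omega>: "cnj \<omega> = - 1 - \<omega>"
  by (simp add: \<omega>_def complex_eq_iff)

lemma cube_root_of_unity_cases: "\<zeta> ^ 3 = 1 \<Longrightarrow> \<zeta> = 1 \<or> \<zeta> = \<omega> \<or> \<zeta> = - 1 - \<omega>" for \<zeta> :: complex
proof -
  assume \<zeta>: "\<zeta> ^ 3 = 1"
  have "(\<zeta> - 1) * ((\<zeta> - \<omega>) * (\<zeta> - (- 1 - \<omega>))) = \<zeta> ^ 3 - 1"
    by (simp add: power3_eq_cube algebra_simps \<omega>_square \<omega>_square')
  then show ?thesis using \<zeta> by auto
qed

locale cubic_resolvent = cubic_trace_basis K \<sigma>1 \<sigma>2 \<sigma>3 d \<beta> \<gamma> + Q: imag_quadratic D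
  for K \<sigma>1 \<sigma>2 \<sigma>3 d \<beta> \<gamma> D +
  assumes D: "D = (- 3 * d) div (gcd 3 d)\<^sup>2"
    and real1: "x \<in> K \<Longrightarrow> \<sigma>1 x \<in> \<real>" and real2: "x \<in> K \<Longrightarrow> \<sigma>2 x \<in> \<real>" and real3: "x \<in> K \<Longrightarrow> \<sigma>3 x \<in> \<real>"
begin

abbreviation "n \<equiv> gcd 3 d"

lemmas n_cases = fund_disc_dual(3)[OF fund, folded D]

lemma n_pos: "n > 0"
  by simp

definition \<rho> :: "complex \<Rightarrow> complex"
  where "\<rho> x = \<sigma>1 x + \<omega> * \<sigma>2 x + (- 1 - \<omega>) * \<sigma>3 x"

lemma \<rho>_add: "x \<in> K \<Longrightarrow> y \<in> K \<Longrightarrow> \<rho> (x + y) = \<rho> x + \<rho> y"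
  by (simp add: \<rho>_def simps1 simps2 simps3 algebra_simps)

lemma \<rho>_scale: "x \<in> K \<Longrightarrow> \<rho> (of_int k * x) = of_int k * \<rho> x"
  by (simp add: \<rho>_def simps1 simps2 simps3 K_closed algebra_simps)

lemma \<rho>_of_int: "\<rho> (of_int k) = 0"
  by (simp add: \<rho>_def simps1 simps2 simps3 algebra_simps)

text \<open>Because the embeddings are real, complex conjugation exchanges the resolvents belonging
  to \<omega> and to \<omega>^2.\<close>

lemma cnj_\<rho>: "x \<in> K \<Longrightarrow> cnj (\<rho> x) = \<sigma>1 x + (- 1 - \<omega>) * \<sigma>2 x + \<omega> * \<sigma>3 x"
  using real1[of x] real2[of x] real3[of x]
  by (simp add: \<rho>_def Reals_cnj_iff cnj_\<omega>)

text \<open>Polarised form of the relation between resolvents and the trace form. It supplies the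
  real part of \<open>\<rho> x * cnj (\<rho> y)\<close>; the next lemma supplies the imaginary
  part.\<close>

lemma \<rho>_trace:
  assumes x: "x \<in> OK" and y: "y \<in> OK"
  shows "\<rho> x * cnj (\<rho> y) + cnj (\<rho> x) * \<rho> y = of_int (3 * int_trace (x * y) - int_trace x * int_trace y)"
proof -
  have "\<rho> x * cnj (\<rho> y) + cnj (\<rho> x) * \<rho> y = 3 * (\<sigma>1 x * \<sigma>1 y + \<sigma>2 x * \<sigma>2 y + \<sigma>3 x * \<sigma>3 y)
      - (\<sigma>1 x + \<sigma>2 x + \<sigma>3 x) * (\<sigma>1 y + \<sigma>2 y + \<sigma>3 y)"
    unfolding cnj_\<rho>[OF OK_in_K[OF x]] cnj_\<rho>[OF OK_in_K[OF y]] unfolding \<rho>_def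
    by (simp add: algebra_simps \<omega>_square \<omega>_square')
  then show ?thesis by (simp add: trace_mult[OF x y] int_trace[OF x] int_trace[OF y])
qed

lemma \<rho>_det:
  assumes x: "x \<in> OK" and y: "y \<in> OK"
  shows "\<rho> x * cnj (\<rho> y) - cnj (\<rho> x) * \<rho> y = - (1 + 2 * \<omega>) * det3 x y"
  unfolding cnj_\<rho>[OF OK_in_K[OF x]] cnj_\<rho>[OF OK_in_K[OF y]] unfolding \<rho>_def det3_def
  by (simp add: algebra_simps \<omega>_square \<omega>_square')

text \<open>Under a cyclic shift of the three conjugates a resolvent picks up a cube root of unity,
  so a product of two resolvents behaves like a conjugate resolvent. Trace zero of \<open>x\<close>
  and \<open>y\<close> removes the invariant component, and subtracting the trace makes the argument
  on the right trace-zero again.\<close>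

lemma \<rho>_mult:
  assumes x: "x \<in> OK0" and y: "y \<in> OK0"
  shows "\<rho> x * \<rho> y = cnj (\<rho> (3 * (x * y) - of_int (int_trace (x * y))))"
proof -
  note O = OK0_in_OK[OF x] OK0_in_OK[OF y]
  note K = OK_in_K[OF O(1)] OK_in_K[OF O(2)]
  have "\<rho> (3 * (x * y) - of_int (int_trace (x * y))) = 3 * \<rho> (x * y)"
    using \<rho>_add[of "of_int 3 * (x * y)" "of_int (- int_trace (x * y))"] \<rho>_scale[of "x * y" 3]
      \<rho>_of_int[of "- int_trace (x * y)"] K K_closed by simp
  moreover have "cnj (\<rho> (x * y)) = \<sigma>1 x * \<sigma>1 y + (- 1 - \<omega>) * (\<sigma>2 x * \<sigma>2 y) + \<omega> * (\<sigma>3 x * \<sigma>3 y)"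
    using K K_closed by (simp add: cnj_\<rho> simps1(4) simps2(4) simps3(4))
  moreover have "\<rho> x * \<rho> y = 3 * (\<sigma>1 x * \<sigma>1 y + (- 1 - \<omega>) * (\<sigma>2 x * \<sigma>2 y) + \<omega> * (\<sigma>3 x * \<sigma>3 y))"
    unfolding \<rho>_def trace_zero_sum[OF x] trace_zero_sum[OF y]
    by (simp add: algebra_simps \<omega>_square \<omega>_square')
  ultimately show ?thesis by simp
qed

definition \<Lambda> :: "complex set" where "\<Lambda> = \<rho> ` OK0"

lemma \<Lambda>_eq: "\<Lambda> = {of_int k * \<rho> \<beta> + of_int l * \<rho> \<gamma> | k l. True}"
proof -
  have "\<rho> (of_int k * \<beta> + of_int l * \<gamma>) = of_int k * \<rho> \<beta> + of_int l * \<rho> \<gamma>" for k l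
    using basis_in_OK OK_in_K K_closed by (simp add: \<rho>_add \<rho>_scale)
  then show ?thesis unfolding \<Lambda>_def OK0_eq by (auto simp: image_iff) metis
qed

text \<open>The norm of \<open>\<rho> \<beta>\<close> is \<open>3 * n * a\<close>, and
  \<open>\<rho> \<gamma> * cnj (\<rho> \<beta>)\<close> is \<open>3 * n * (b + s) / 2\<close> up to
  the sign of \<open>s\<close>. After division by \<kappa> the two resolvents are, up to sign, the
  generators of \<open>form_ideal f\<close> or of its conjugate; which one occurs depends on the
  orientation of \<beta>, \<gamma>.\<close>

lemma \<Lambda>_form_ideal:
  assumes f: "is_scaled_trace_form d K \<beta> \<gamma> f"
  obtains \<kappa> where "\<kappa> \<noteq> 0" "form_disc f = D"
    "\<Lambda> = (*) \<kappa> ` form_ideal f \<or> \<Lambda> = (*) \<kappa> ` cnj ` form_ideal f"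
    "\<Lambda> \<star> cnj ` \<Lambda> = (*) (of_int (3 * n)) ` Q.OF"
proof -
  obtain a b c where abc: "scaled_form = (a, b, c)" "A = 2 * n * a" "B = n * b" "C = 2 * n * c"
    by (rule scaled_form_coeffs)
  obtain a' b' c' where f': "f = (a', b', c')" by (cases f)
  have "of_int (form_eval f x y) = (of_int (form_eval scaled_form x y) :: rat)" for x y
    using f is_scaled_trace_form_scaled_form unfolding is_scaled_trace_form_def by simp
  then have ev: "form_eval f x y = form_eval scaled_form x y" for x y unfolding of_int_eq_iff .
  have "f = scaled_form" using ev[of 1 0] ev[of 0 1] ev[of 1 1] by (simp add: f' abc(1))
  then have f: "f = (a, b, c)" using abc(1) by simp
  have disc: "form_disc (a, b, c) = D" using scaled_form_disc abc(1) D by simp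
  have a0: "a \<noteq> 0" by (rule Q.form_leading_nonzero[OF disc])
  have tr0: "int_trace \<beta> = 0" "int_trace \<gamma> = 0" using basis_in by (simp_all add: OK0_iff)
  have N: "\<rho> \<beta> * cnj (\<rho> \<beta>) = of_int (3 * n * a)"
  proof -
    have "\<rho> \<beta> * cnj (\<rho> \<beta>) + cnj (\<rho> \<beta>) * \<rho> \<beta> = of_int (3 * A)"
      using \<rho>_trace[OF basis_in_OK(1,1)] tr0 by (simp add: A_def)
    also have "\<dots> = 2 * of_int (3 * n * a)" unfolding abc(2) by simp
    finally show ?thesis by (simp add: mult.commute)
  qed
  have \<rho>0: "\<rho> \<beta> \<noteq> 0" using N a0 n_pos by auto
  \<comment> \<open>This is the mixed product minus its conjugate. Its square is known from the Gram
    determinant, so it is determined up to sign.\<close>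
  define \<delta> where "\<delta> = - (1 + 2 * \<omega>) * det3 \<gamma> \<beta>"
  have "\<delta>\<^sup>2 = (of_int (3 * n) * Q.s)\<^sup>2"
  proof -
    have "(- (1 + 2 * \<omega>))\<^sup>2 = - 3" by (simp add: power2_eq_square algebra_simps \<omega>_square')
    then have "\<delta>\<^sup>2 = - 3 * (det3 \<gamma> \<beta>)\<^sup>2" by (simp only: \<delta>_def power_mult_distrib)
    also have "(det3 \<gamma> \<beta>)\<^sup>2 = of_int (3 * (A * C - B\<^sup>2))"
      unfolding det3_square[OF basis_in(2,1)] by (simp add: A_def B_def C_def mult.commute)
    also have "3 * (A * C - B\<^sup>2) = 9 * d" using gram_det by simp
    also have "- 3 * of_int (9 * d) = (of_int (9 * (- 3 * d)) :: complex)" by simp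
    also have "- 3 * d = n\<^sup>2 * D" unfolding D fund_disc_dual(1)[OF fund] ..
    finally show ?thesis by (simp add: power_mult_distrib Q.s_square)
  qed
  then have \<delta>: "\<delta> = of_int (3 * n) * Q.s \<or> \<delta> = - (of_int (3 * n) * Q.s)"
    by (simp only: power2_eq_iff)
  have M: "\<rho> \<gamma> * cnj (\<rho> \<beta>) = (of_int (3 * n * b) + \<delta>) / 2"
  proof -
    have 1: "\<rho> \<gamma> * cnj (\<rho> \<beta>) + cnj (\<rho> \<gamma>) * \<rho> \<beta> = of_int (3 * B)"
      using \<rho>_trace[OF basis_in_OK(2,1)] tr0 by (simp add: B_def mult.commute)
    have 2: "\<rho> \<gamma> * cnj (\<rho> \<beta>) - cnj (\<rho> \<gamma>) * \<rho> \<beta> = \<delta>"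
      unfolding \<delta>_def by (rule \<rho>_det[OF basis_in_OK(2,1)])
    have "2 * (\<rho> \<gamma> * cnj (\<rho> \<beta>)) = of_int (3 * B) + \<delta>" unfolding 1[symmetric] 2[symmetric] by simp
    also have "of_int (3 * B) = (of_int (3 * n * b) :: complex)" unfolding abc(3) by simp
    finally have eq: "2 * (\<rho> \<gamma> * cnj (\<rho> \<beta>)) = of_int (3 * n * b) + \<delta>" .
    have "z = w / 2" if "2 * z = w" for z w :: complex using that by auto
    from this[OF eq] show ?thesis .
  qed
  define \<kappa> where "\<kappa> = \<rho> \<beta> / of_int a"
  have \<kappa>0: "\<kappa> \<noteq> 0" using \<rho>0 a0 by (simp add: \<kappa>_def)
  have \<rho>\<beta>: "\<rho> \<beta> = \<kappa> * of_int a" using a0 by (simp add: \<kappa>_def)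
  have \<kappa>cnj: "\<kappa> * cnj \<kappa> * of_int a = of_int (3 * n)"
    using N a0 by (simp add: \<kappa>_def field_simps)
  have \<rho>\<gamma>: "\<rho> \<gamma> = \<kappa> * ((of_int (3 * n * b) + \<delta>) / (2 * of_int (3 * n)))"
  proof -
    have "\<rho> \<gamma> * (cnj (\<rho> \<beta>) * \<rho> \<beta>) = \<rho> \<beta> * ((of_int (3 * n * b) + \<delta>) / 2)"
      using M by (simp only: mult.assoc[symmetric]) (simp only: mult.commute)
    then have "\<rho> \<gamma> * of_int (3 * n * a) = \<rho> \<beta> * ((of_int (3 * n * b) + \<delta>) / 2)"
      using N by (simp only: mult.commute)
    then have "\<rho> \<gamma> * of_int (3 * n) * of_int a = \<kappa> * ((of_int (3 * n * b) + \<delta>) / 2) * of_int a"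
      unfolding \<rho>\<beta> by (simp only: of_int_mult mult_ac)
    then have "\<rho> \<gamma> * of_int (3 * n) = \<kappa> * ((of_int (3 * n * b) + \<delta>) / 2)" using a0 by simp
    then have "\<rho> \<gamma> = \<kappa> * ((of_int (3 * n * b) + \<delta>) / 2) / of_int (3 * n)"
      using n_pos by (simp only: eq_divide_eq) simp
    then show ?thesis by simp
  qed
  have half: "(of_int (3 * n * b) + of_int (3 * n) * z) / (2 * of_int (3 * n)) = (of_int b + z) / 2" for z :: complex
  proof -
    have "of_int (3 * n * b) + of_int (3 * n) * z = of_int (3 * n) * (of_int b + z)" by (simp add: algebra_simps)
    then show ?thesis using n_pos by simp
  qed
  have "\<rho> \<gamma> = - (\<kappa> * Q.\<tau> b) \<or> \<rho> \<gamma> = - (\<kappa> * cnj (Q.\<tau> b))"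
  proof -
    have "\<rho> \<gamma> = \<kappa> * ((of_int b + Q.s) / 2) \<or> \<rho> \<gamma> = \<kappa> * ((of_int b + - Q.s) / 2)"
      using \<delta>
    proof
      assume *: "\<delta> = of_int (3 * n) * Q.s"
      have "\<rho> \<gamma> = \<kappa> * ((of_int b + Q.s) / 2)" unfolding \<rho>\<gamma> * half ..
      then show ?thesis by blast
    next
      assume *: "\<delta> = - (of_int (3 * n) * Q.s)"
      have "\<rho> \<gamma> = \<kappa> * ((of_int b + - Q.s) / 2)" unfolding \<rho>\<gamma> * mult_minus_right[symmetric] half ..
      then show ?thesis by blast
    qed
    moreover have "(of_int b + Q.s) / 2 = - cnj (Q.\<tau> b)" "(of_int b + - Q.s) / 2 = - Q.\<tau> b"
      by (simp_all add: Q.\<tau>_def Q.cnj_s field_simps)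
    ultimately show ?thesis by auto
  qed
  then have cases: "\<Lambda> = (*) \<kappa> ` form_ideal f \<or> \<Lambda> = (*) \<kappa> ` cnj ` form_ideal f"
  proof
    assume *: "\<rho> \<gamma> = - (\<kappa> * Q.\<tau> b)"
    have "\<Lambda> = (*) \<kappa> ` form_ideal f"
      unfolding \<Lambda>_eq f Q.form_ideal_eq[OF disc]
    proof (intro equalityI subsetI)
      fix x assume "x \<in> {of_int k * \<rho> \<beta> + of_int l * \<rho> \<gamma> | k l. True}"
      then obtain k l where "x = of_int k * \<rho> \<beta> + of_int l * \<rho> \<gamma>" by blast
      then have "x = \<kappa> * (of_int k * of_int a + of_int (- l) * Q.\<tau> b)"
        unfolding * \<rho>\<beta> by (simp add: algebra_simps)
      then show "x \<in> (*) \<kappa> ` {of_int m * of_int a + of_int n * Q.\<tau> b | m n. True}" by blast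
    next
      fix x assume "x \<in> (*) \<kappa> ` {of_int m * of_int a + of_int n * Q.\<tau> b | m n. True}"
      then obtain k l where "x = \<kappa> * (of_int k * of_int a + of_int l * Q.\<tau> b)" by blast
      then have "x = of_int k * \<rho> \<beta> + of_int (- l) * \<rho> \<gamma>"
        unfolding * \<rho>\<beta> by (simp add: algebra_simps)
      then show "x \<in> {of_int k * \<rho> \<beta> + of_int l * \<rho> \<gamma> | k l. True}" by blast
    qed
    then show ?thesis by blast
  next
    assume *: "\<rho> \<gamma> = - (\<kappa> * cnj (Q.\<tau> b))"
    have "\<Lambda> = (*) \<kappa> ` cnj ` form_ideal f"
      unfolding \<Lambda>_eq f Q.form_ideal_eq[OF disc]
    proof (intro equalityI subsetI)
      fix x assume "x \<in> {of_int k * \<rho> \<beta> + of_int l * \<rho> \<gamma> | k l. True}"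
      then obtain k l where "x = of_int k * \<rho> \<beta> + of_int l * \<rho> \<gamma>" by blast
      then have "x = \<kappa> * cnj (of_int k * of_int a + of_int (- l) * Q.\<tau> b)"
        unfolding * \<rho>\<beta> by (simp add: algebra_simps)
      then show "x \<in> (*) \<kappa> ` cnj ` {of_int m * of_int a + of_int n * Q.\<tau> b | m n. True}" by blast
    next
      fix x assume "x \<in> (*) \<kappa> ` cnj ` {of_int m * of_int a + of_int n * Q.\<tau> b | m n. True}"
      then obtain k l where "x = \<kappa> * cnj (of_int k * of_int a + of_int l * Q.\<tau> b)" by blast
      then have "x = of_int k * \<rho> \<beta> + of_int (- l) * \<rho> \<gamma>"
        unfolding * \<rho>\<beta> by (simp add: algebra_simps)
      then show "x \<in> {of_int k * \<rho> \<beta> + of_int l * \<rho> \<gamma> | k l. True}" by blast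
    qed
    then show ?thesis by blast
  qed
  have prod: "(*) \<kappa> ` I \<star> cnj ` (*) \<kappa> ` I = (*) (of_int (3 * n)) ` Q.OF"
    if "I \<star> cnj ` I = (*) (of_int a) ` Q.OF" for I
  proof -
    have "(*) \<kappa> ` I \<star> cnj ` (*) \<kappa> ` I = (*) (cnj \<kappa> * \<kappa> * of_int a) ` Q.OF"
      unfolding cnj_scale_image ideal_prod_scale_left ideal_prod_scale_right that scale_scale by (simp only: mult_ac)
    moreover have "cnj \<kappa> * \<kappa> * of_int a = of_int (3 * n)" using \<kappa>cnj by (simp only: mult_ac)
    ultimately show ?thesis by (simp only:)
  qed
  have "form_ideal f \<star> cnj ` form_ideal f = (*) (of_int a) ` Q.OF"
    unfolding f by (rule Q.form_ideal_conj_prod[OF disc])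
  moreover have "cnj ` form_ideal f \<star> cnj ` cnj ` form_ideal f = (*) (of_int a) ` Q.OF"
    unfolding cnj_cnj_image ideal_prod_comm[of "cnj ` form_ideal f"] using calculation .
  ultimately have "\<Lambda> \<star> cnj ` \<Lambda> = (*) (of_int (3 * n)) ` Q.OF"
    using cases prod by metis
  then show ?thesis using that[OF \<kappa>0 _ cases] disc f by simp
qed

lemma \<Lambda>_frac:
  obtains \<kappa> I where "\<kappa> \<noteq> 0" "I \<in> Q.fracs" "\<Lambda> = (*) \<kappa> ` I"
proof -
  obtain \<kappa> where \<kappa>: "\<kappa> \<noteq> 0" "form_disc scaled_form = D"
    "\<Lambda> = (*) \<kappa> ` form_ideal scaled_form \<or> \<Lambda> = (*) \<kappa> ` cnj ` form_ideal scaled_form"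
    by (rule \<Lambda>_form_ideal[OF is_scaled_trace_form_scaled_form])
  then show ?thesis
    using that Q.form_ideal_frac[OF \<kappa>(2)] Q.cnj_frac[OF Q.form_ideal_frac[OF \<kappa>(2)]] by blast
qed

lemma \<Lambda>_norm: "\<Lambda> \<star> cnj ` \<Lambda> = (*) (of_int (3 * n)) ` Q.OF"
  by (rule \<Lambda>_form_ideal[OF is_scaled_trace_form_scaled_form])

lemma \<rho>_norm:
  assumes x: "x \<in> OK0"
  obtains N :: int where "\<rho> x * cnj (\<rho> x) = of_int (3 * n * N)"
proof -
  obtain k l where kl: "x = of_int k * \<beta> + of_int l * \<gamma>" using x unfolding OK0_eq by blast
  have "trace_form K x / (2 * of_int n) = of_int (form_eval scaled_form k l)"
    using is_scaled_trace_form_scaled_form unfolding is_scaled_trace_form_def kl by simp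
  then have "trace_form K x = of_int (2 * n * form_eval scaled_form k l)"
    using n_pos by (simp add: field_simps)
  then have "of_int (int_trace (x * x)) = (of_int (2 * n * form_eval scaled_form k l) :: rat)"
    using field_trace_eq_int[OF OK_closed(2)[OF OK0_in_OK[OF x] OK0_in_OK[OF x]]]
    by (simp add: trace_form_def power2_eq_square)
  then have "int_trace (x * x) = 2 * n * form_eval scaled_form k l" unfolding of_int_eq_iff .
  then have "\<rho> x * cnj (\<rho> x) + cnj (\<rho> x) * \<rho> x = 2 * of_int (3 * n * form_eval scaled_form k l)"
    using \<rho>_trace[OF OK0_in_OK[OF x] OK0_in_OK[OF x]] x by (simp add: OK0_iff mult.commute)
  moreover have "\<rho> x * cnj (\<rho> x) + cnj (\<rho> x) * \<rho> x = 2 * (\<rho> x * cnj (\<rho> x))" by (simp only: mult.commute mult_2)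
  ultimately have "\<rho> x * cnj (\<rho> x) = of_int (3 * n * form_eval scaled_form k l)" by simp
  then show ?thesis by (rule that)
qed

text \<open>The real part of a product of three resolvents is a trace, hence divisible by \<open>3\<close>; its norm
  then decides in which ideal of norm \<open>(3 n)\<^sup>3\<close> the product lies.\<close>

lemma \<rho>_triple_product:
  assumes x: "x \<in> OK0" and y: "y \<in> OK0" and z: "z \<in> OK0"
  shows "\<rho> x * \<rho> y * \<rho> z \<in> (*) (of_int (3 * n)) ` Q.three_ideal n d"
proof -
  \<comment> \<open>The first two resolvents combine to the conjugate resolvent of \<open>v\<close>,
    which reduces a product of three to a product of two.\<close>
  define v where "v = 3 * (x * y) - of_int (int_trace (x * y))"
  note O = OK0_in_OK[OF x] OK0_in_OK[OF y] OK0_in_OK[OF z]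
  have v: "v \<in> OK0" unfolding v_def by (rule three_times_minus_trace[OF OK_closed(2)[OF O(1,2)]])
  define t where "t = \<rho> x * \<rho> y * \<rho> z"
  have t: "t = cnj (\<rho> v) * \<rho> z" unfolding t_def \<rho>_mult[OF x y] v_def ..
  have "\<rho> z * cnj (\<rho> v) \<in> \<Lambda> \<star> cnj ` \<Lambda>" using z v by (intro ideal_prod_memI) (auto simp: \<Lambda>_def)
  then have "t \<in> (*) (of_int (3 * n)) ` Q.OF" unfolding \<Lambda>_norm t by (simp only: mult.commute)
  then obtain u where u: "u \<in> Q.OF" "t = of_int (3 * n) * u" by blast
  obtain a b where ab: "u = (of_int a + of_int b * Q.s) / 2" "even (a - b * D)" using u(1) Q.OF_iff by blast
  have "t + cnj t = of_int (3 * int_trace (z * v))"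
    using \<rho>_trace[OF O(3) OK0_in_OK[OF v]] z v by (simp add: t OK0_iff mult.commute)
  moreover have "int_trace (z * v) = 3 * int_trace (x * y * z)"
  proof -
    have xyz: "x * y * z \<in> OK" using O OK_closed(2) by simp
    have zv: "z * v = of_int 3 * (x * y * z) - of_int (int_trace (x * y)) * z" by (simp add: v_def algebra_simps)
    show ?thesis
      unfolding zv int_trace_diff[OF OK_closed(2)[OF OK_closed(4) xyz] OK_closed(2)[OF OK_closed(4) O(3)]]
        int_trace_scale[OF xyz] int_trace_scale[OF O(3)]
      using z by (simp add: OK0_iff)
  qed
  moreover have "t + cnj t = of_int (3 * n * a)"
    unfolding u(2) ab(1) by (simp add: Q.cnj_s field_simps)
  ultimately have "(of_int (3 * n * a) :: complex) = of_int (9 * int_trace (x * y * z))" by simp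
  then have "3 * n * a = 9 * int_trace (x * y * z)" unfolding of_int_eq_iff .
  then have na: "n * a = 3 * int_trace (x * y * z)" by linarith
  \<comment> \<open>The trace gives a factor 3 in \<open>a\<close> in both cases. For
    \<open>n = 3\<close> a factor 3 in \<open>b\<close> is needed as well and has to come from the
    norm.\<close>
  have main: "u \<in> Q.three_ideal n d"
    using n_cases
  proof (elim disjE conjE)
    assume n: "n = 1" and D': "D = - 3 * d"
    have a: "a = 3 * int_trace (x * y * z)" using na n by simp
    have "u = (of_int (3 * int_trace (x * y * z)) + of_int (b * n) * Q.s) / 2"
      unfolding ab(1) a n by simp
    moreover have "even (int_trace (x * y * z) - b * d)" using ab(2) unfolding a D' by auto
    ultimately show ?thesis unfolding Q.three_ideal_def by blast
  next
    assume n: "n = 3" and D': "d = - 3 * D" "\<not> 3 dvd D"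
    have "n dvd int_trace (x * y * z)" by (rule triple_trace_divisible[OF x y z])
    then obtain a' where a': "int_trace (x * y * z) = 3 * a'" unfolding n by (elim dvdE)
    then have a: "a = 3 * a'" using na unfolding n by simp
    obtain N1 N2 N3 :: int where N: "\<rho> x * cnj (\<rho> x) = of_int (3 * n * N1)"
      "\<rho> y * cnj (\<rho> y) = of_int (3 * n * N2)" "\<rho> z * cnj (\<rho> z) = of_int (3 * n * N3)"
      using \<rho>_norm[OF x] \<rho>_norm[OF y] \<rho>_norm[OF z] by metis
    have "t * cnj t = (\<rho> x * cnj (\<rho> x)) * (\<rho> y * cnj (\<rho> y)) * (\<rho> z * cnj (\<rho> z))"
      unfolding t_def by (simp only: complex_cnj_mult mult_ac)
    also have "\<dots> = of_int (9 * 9 * (9 * (N1 * N2 * N3)))" unfolding N n by simp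
    finally have 1: "t * cnj t = of_int (9 * 9 * (9 * (N1 * N2 * N3)))" .
    have "4 * (t * cnj t) = of_int (9 * 9) * ((2 * u) * cnj (2 * u))" unfolding u(2) n by simp
    also have "2 * u = of_int a + of_int b * Q.s" by (simp add: ab(1))
    also have "(of_int a + of_int b * Q.s) * cnj (of_int a + of_int b * Q.s) = of_int (a * a) - of_int (b * b) * Q.s\<^sup>2"
      by (simp add: Q.cnj_s power2_eq_square algebra_simps)
    also have "\<dots> = of_int (a * a - b * b * D)" by (simp add: Q.s_square)
    finally have "of_int (4 * (9 * 9 * (9 * (N1 * N2 * N3)))) = (of_int (9 * 9 * (a * a - b * b * D)) :: complex)"
      unfolding 1 by simp
    then have "4 * (9 * 9 * (9 * (N1 * N2 * N3))) = 9 * 9 * (a * a - b * b * D)" unfolding of_int_eq_iff .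
    \<comment> \<open>The norm of \<open>u\<close> is a multiple of 9 and 3 divides
      \<open>a\<close>; so \<open>b * b * D\<close> is a multiple of 3, while \<open>D\<close> is
      prime to 3.\<close>
    then have "b * b * D = 3 * (3 * a' * a' - 12 * (N1 * N2 * N3))" unfolding a by simp
    then have "3 dvd b * b * D" by simp
    then have "3 dvd b" using D'(2) by (simp add: prime_dvd_mult_iff)
    then obtain b' where b': "b = 3 * b'" by (elim dvdE)
    have "u = (of_int (3 * a') + of_int (b' * n) * Q.s) / 2" unfolding ab(1) a b' n by (simp add: mult.commute)
    moreover have "even (a' - b' * d)" using ab(2) unfolding a b' D'(1) by auto
    ultimately show ?thesis unfolding Q.three_ideal_def by blast
  qed
  have "t \<in> (*) (of_int (3 * n)) ` Q.three_ideal n d" unfolding u(2) using main by (rule imageI)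
  then show ?thesis unfolding t_def .
qed

lemma three_ideal_conditions: "n = 1 \<and> D = - 3 * d \<or> n = 3 \<and> d = - 3 * D" "d mod 4 \<in> {0, 1}"
  using n_cases fund by (auto simp: fund_disc_def)

text \<open>With L the cube and E the right-hand side, L is contained in E, and L times its
  conjugate equals E times its conjugate. So L times the conjugate of E is squeezed between equal
  ideals; multiplying by E and cancelling the norm gives L = E, without any factorisation into
  primes.\<close>

lemma \<Lambda>_cube: "\<Lambda> \<star> \<Lambda> \<star> \<Lambda> = (*) (of_int (3 * n)) ` Q.three_ideal n d"
proof -
  let ?P = "Q.three_ideal n d" and ?r = "of_int (3 * n) :: complex" and ?L = "\<Lambda> \<star> \<Lambda> \<star> \<Lambda>"
  define E where "E = (*) ?r ` ?P"
  note Pfrac = Q.three_ideal_frac[OF three_ideal_conditions]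
  have r: "?r \<in> Q.F" "?r \<noteq> 0" "cnj ?r = ?r" by (rule Q.F_closed(10)) (use n_pos in simp_all)
  have E: "E \<in> Q.fracs" unfolding E_def by (rule Q.scale_frac[OF Pfrac r(1,2)])
  have sub: "?L \<subseteq> E"
    unfolding ideal_prod_subset_iff[OF Q.fracsD(2)[OF E]]
  proof (intro ballI)
    fix u v assume u: "u \<in> \<Lambda> \<star> \<Lambda>" and v: "v \<in> \<Lambda>"
    have "v * u \<in> E"
    proof (rule ideal_prod_mult_mem[OF u Q.fracsD(2)[OF E]])
      fix x y assume "x \<in> \<Lambda>" "y \<in> \<Lambda>"
      then have "x * y * v \<in> E" using v \<rho>_triple_product unfolding \<Lambda>_def E_def by blast
      then show "v * (x * y) \<in> E" by (simp only: mult.commute)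
    qed
    then show "u * v \<in> E" by (simp only: mult.commute)
  qed
  have EE: "E \<star> cnj ` E = (*) (?r ^ 3) ` Q.OF"
  proof -
    have "E \<star> cnj ` E = (*) (?r * ?r * ?r) ` Q.OF"
      unfolding E_def cnj_scale_image r(3) Q.cnj_three_ideal[OF three_ideal_conditions]
        ideal_prod_scale_left ideal_prod_scale_right Q.three_ideal_square[OF three_ideal_conditions] scale_scale
      by (simp only: mult.assoc)
    then show ?thesis by (simp only: power3_eq_cube)
  qed
  have LL: "?L \<star> cnj ` ?L = (*) (?r ^ 3) ` Q.OF"
  proof -
    have "?L \<star> cnj ` ?L = (\<Lambda> \<star> cnj ` \<Lambda>) \<star> (\<Lambda> \<star> cnj ` \<Lambda>) \<star> (\<Lambda> \<star> cnj ` \<Lambda>)"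
      unfolding cnj_ideal_prod by (simp only: ideal_prod_assoc ideal_prod_comm ideal_prod_left_comm)
    also have "\<dots> = (*) (?r * ?r * ?r) ` Q.OF"
      unfolding \<Lambda>_norm ideal_prod_scale_left ideal_prod_scale_right Q.OF_prod[OF Q.OF_frac] scale_scale
      by (simp only: mult.assoc)
    finally show ?thesis by (simp only: power3_eq_cube)
  qed
  have "?L \<star> cnj ` ?L \<subseteq> ?L \<star> cnj ` E" by (rule ideal_prod_mono[OF subset_refl image_mono[OF sub]])
  moreover have "?L \<star> cnj ` E \<subseteq> E \<star> cnj ` E" by (rule ideal_prod_mono[OF sub subset_refl])
  ultimately have LE: "?L \<star> cnj ` E = (*) (?r ^ 3) ` Q.OF" unfolding LL EE by blast
  have EO: "E \<star> Q.OF = E" by (rule Q.prod_OF[OF E])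
  have LO: "?L \<star> Q.OF = ?L"
  proof -
    obtain \<kappa> I where "I \<in> Q.fracs" "\<Lambda> = (*) \<kappa> ` I" by (rule \<Lambda>_frac)
    then have "\<Lambda> \<star> Q.OF = \<Lambda>" using Q.prod_OF by (simp only: ideal_prod_scale_left)
    then show ?thesis by (simp only: ideal_prod_assoc)
  qed
  have "(?L \<star> cnj ` E) \<star> E = (*) (?r ^ 3) ` ?L"
  proof -
    have "(?L \<star> cnj ` E) \<star> E = ?L \<star> (E \<star> cnj ` E)" by (simp only: ideal_prod_assoc ideal_prod_comm[of E])
    then show ?thesis unfolding EE ideal_prod_scale_right LO .
  qed
  moreover have "(?L \<star> cnj ` E) \<star> E = (*) (?r ^ 3) ` E"
    unfolding LE ideal_prod_scale_left ideal_prod_comm[of Q.OF] EO ..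
  ultimately have "(*) (1 / ?r ^ 3) ` (*) (?r ^ 3) ` ?L = (*) (1 / ?r ^ 3) ` (*) (?r ^ 3) ` E" by (simp only:)
  then show ?thesis unfolding scale_scale using r(2) by (simp add: E_def)
qed

text \<open>Inverse discrete Fourier transform at trace zero: \<zeta> = 1 recovers \<sigma>1,
  \<zeta> = \<omega> recovers \<sigma>3 and \<zeta> = \<omega>^2 recovers \<sigma>2. Thus
  multiplying the lattice by a cube root of unity only changes the conjugate.\<close>

lemma \<Lambda>_real_part:
  assumes \<zeta>: "\<zeta> ^ 3 = 1"
  shows "\<exists>\<sigma>. is_embedding K \<sigma> \<and> \<sigma> ` OK0 = (\<lambda>z. (\<zeta> * z + cnj (\<zeta> * z)) / 3) ` \<Lambda>"
proof -
  have "\<exists>\<sigma>. is_embedding K \<sigma> \<and> (\<forall>x\<in>OK0. \<sigma> x = (\<zeta> * \<rho> x + cnj (\<zeta> * \<rho> x)) / 3)"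
  proof -
    have c: "cnj (\<rho> x) = \<sigma>1 x + (- 1 - \<omega>) * \<sigma>2 x + \<omega> * \<sigma>3 x" if "x \<in> OK0" for x
      using cnj_\<rho>[OF OK_in_K[OF OK0_in_OK[OF that]]] .
    have "\<sigma>1 x = (1 * \<rho> x + cnj (1 * \<rho> x)) / 3" if "x \<in> OK0" for x
      unfolding complex_cnj_mult c[OF that] unfolding \<rho>_def trace_zero_sum[OF that]
      by (simp add: algebra_simps)
    moreover have "\<sigma>3 x = (\<omega> * \<rho> x + cnj (\<omega> * \<rho> x)) / 3" if "x \<in> OK0" for x
      unfolding complex_cnj_mult c[OF that] cnj_\<omega> unfolding \<rho>_def trace_zero_sum[OF that]
      by (simp add: algebra_simps \<omega>_square \<omega>_square')
    moreover have "\<sigma>2 x = ((- 1 - \<omega>) * \<rho> x + cnj ((- 1 - \<omega>) * \<rho> x)) / 3" if "x \<in> OK0" for x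
      unfolding complex_cnj_mult complex_cnj_diff complex_cnj_minus complex_cnj_one c[OF that] cnj_\<omega>
      unfolding \<rho>_def trace_zero_sum[OF that]
      by (simp add: algebra_simps \<omega>_square \<omega>_square')
    ultimately show ?thesis using cube_root_of_unity_cases[OF \<zeta>] emb1 emb2 emb3 by blast
  qed
  then obtain \<sigma> where "is_embedding K \<sigma>" and \<sigma>: "\<And>x. x \<in> OK0 \<Longrightarrow> \<sigma> x = (\<zeta> * \<rho> x + cnj (\<zeta> * \<rho> x)) / 3" by blast
  moreover have "\<sigma> ` OK0 = (\<lambda>z. (\<zeta> * z + cnj (\<zeta> * z)) / 3) ` \<Lambda>"
    unfolding \<Lambda>_def image_image using \<sigma> by (rule image_cong[OF refl])
  ultimately show ?thesis by blast
qed

end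

section \<open>Resolvent lattices in the class group\<close>

lemma isomorphic_fields_iff_embedding:
  assumes K: "is_subfield K"
  shows "isomorphic_fields K L \<longleftrightarrow> (\<exists>\<phi>. is_embedding K \<phi> \<and> \<phi> ` K = L)"
proof
  assume "isomorphic_fields K L"
  then obtain h where h: "h \<in> ring_iso (complex_ring\<lparr>carrier := K\<rparr>) (complex_ring\<lparr>carrier := L\<rparr>)"
    by (auto simp: isomorphic_fields_def is_ring_iso_def)
  then have "is_embedding K h"
    unfolding ring_iso_def Ring.ring_hom_def is_embedding_def by (auto simp: ring_of_type_algebra_def)
  moreover have "h ` K = L" using h by (auto simp: ring_iso_def bij_betw_def)
  ultimately show "\<exists>\<phi>. is_embedding K \<phi> \<and> \<phi> ` K = L" by blast
next
  assume "\<exists>\<phi>. is_embedding K \<phi> \<and> \<phi> ` K = L"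
  then obtain \<phi> where \<phi>: "is_embedding K \<phi>" "\<phi> ` K = L" by blast
  have "inj_on \<phi> K" using embedding_eq_iff[OF K \<phi>(1)] by (auto intro: inj_onI)
  then have "\<phi> \<in> ring_iso (complex_ring\<lparr>carrier := K\<rparr>) (complex_ring\<lparr>carrier := L\<rparr>)"
    using \<phi> unfolding ring_iso_def Ring.ring_hom_def is_embedding_def bij_betw_def
    by (auto simp: ring_of_type_algebra_def)
  then show "isomorphic_fields K L" by (auto simp: isomorphic_fields_def is_ring_iso_def)
qed

lemma embedding_inverse:
  assumes K: "is_subfield K" and \<phi>: "is_embedding K \<phi>"
  obtains \<psi> where "is_embedding (\<phi> ` K) \<psi>" "\<And>x. x \<in> K \<Longrightarrow> \<psi> (\<phi> x) = x"
proof -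
  define \<psi> where "\<psi> = the_inv_into K \<phi>"
  have "inj_on \<phi> K" using embedding_eq_iff[OF K \<phi>] by (auto intro: inj_onI)
  then have inv: "\<psi> (\<phi> x) = x" if "x \<in> K" for x using that by (simp add: \<psi>_def the_inv_into_f_f)
  have "is_embedding (\<phi> ` K) \<psi>"
    unfolding is_embedding_def
  proof (intro conjI ballI)
    show "\<psi> 1 = 1" using inv[OF is_subfieldD(1)[OF K]] by (simp add: embedding_simps[OF K \<phi>])
  next
    fix y y' assume "y \<in> \<phi> ` K" "y' \<in> \<phi> ` K"
    then obtain x x' where x: "x \<in> K" "x' \<in> K" "y = \<phi> x" "y' = \<phi> x'" by blast
    show "\<psi> (y + y') = \<psi> y + \<psi> y'"
      using inv[OF is_subfieldD(2)[OF K x(1,2)]] inv x by (simp add: embedding_simps[OF K \<phi>])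
    show "\<psi> (y * y') = \<psi> y * \<psi> y'"
      using inv[OF is_subfieldD(3)[OF K x(1,2)]] inv x by (simp add: embedding_simps[OF K \<phi>])
  qed
  then show ?thesis using that inv by blast
qed

lemma embedding_compose:
  assumes "is_embedding K \<phi>" "\<phi> ` K \<subseteq> L" "is_embedding L \<psi>"
  shows "is_embedding K (\<psi> \<circ> \<phi>)"
  using assms unfolding is_embedding_def by (auto simp: image_subset_iff)

lemma isomorphic_fields_sym:
  assumes K: "is_subfield K" and L: "is_subfield L" and iso: "isomorphic_fields K L"
  shows "isomorphic_fields L K"
proof -
  obtain \<phi> where \<phi>: "is_embedding K \<phi>" "\<phi> ` K = L" using iso isomorphic_fields_iff_embedding[OF K] by blast
  obtain \<psi> where \<psi>: "is_embedding (\<phi> ` K) \<psi>" "\<And>x. x \<in> K \<Longrightarrow> \<psi> (\<phi> x) = x" using embedding_inverse[OF K \<phi>(1)] by metis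
  have "\<psi> ` L = K" unfolding \<phi>(2)[symmetric] image_image using \<psi>(2) by simp
  moreover have "is_embedding L \<psi>" using \<psi>(1) \<phi>(2) by simp
  ultimately show ?thesis unfolding isomorphic_fields_iff_embedding[OF L] by (intro exI conjI)
qed

lemma isomorphic_fields_trans:
  assumes K: "is_subfield K" and L: "is_subfield L" and iso: "isomorphic_fields K L" "isomorphic_fields L M"
  shows "isomorphic_fields K M"
proof -
  obtain \<phi> where \<phi>: "is_embedding K \<phi>" "\<phi> ` K = L" using iso isomorphic_fields_iff_embedding[OF K] by blast
  obtain \<psi> where \<psi>: "is_embedding L \<psi>" "\<psi> ` L = M" using iso isomorphic_fields_iff_embedding[OF L] by blast
  have "is_embedding K (\<psi> \<circ> \<phi>)" using embedding_compose[OF \<phi>(1) _ \<psi>(1)] \<phi>(2) by simp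
  moreover have "(\<psi> \<circ> \<phi>) ` K = M" unfolding image_comp[symmetric] \<phi>(2) \<psi>(2) ..
  ultimately show ?thesis using isomorphic_fields_iff_embedding[OF K] by blast
qed

lemma isomorphic_fields_refl: "is_subfield K \<Longrightarrow> isomorphic_fields K K"
  using isomorphic_fields_iff_embedding[of K K] by (auto simp: is_embedding_def intro!: exI[of _ id])

text \<open>An isomorphism maps trace-zero integers onto trace-zero integers and preserves traces,
  so the same form \<open>f\<close> belongs to the transported basis. This is why \<Theta> may be
  evaluated at any representative of an isomorphism class.\<close>

lemma g_classes_iso_subset:
  assumes K: "field_of_degree 3 K" and L: "field_of_degree 3 L" and iso: "isomorphic_fields K L"
  shows "g_classes d K \<subseteq> g_classes d L"
proof
  note sub = field_of_degree_is_subfield[OF K]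
  note K' = is_subfieldD[OF sub]
  obtain \<phi> where \<phi>: "is_embedding K \<phi>" "\<phi> ` K = L" using iso isomorphic_fields_iff_embedding[OF sub] by blast
  obtain \<psi> where \<psi>: "is_embedding (\<phi> ` K) \<psi>" "\<And>x. x \<in> K \<Longrightarrow> \<psi> (\<phi> x) = x"
    using embedding_inverse[OF sub \<phi>(1)] by metis
  note simps = embedding_simps[OF sub \<phi>(1)]
  note tr = field_trace_iso[OF K L \<phi>]
  have tz: "trace_zero_integers L = \<phi> ` trace_zero_integers K"
  proof (intro equalityI subsetI)
    fix y assume y: "y \<in> trace_zero_integers L"
    then obtain x where x: "x \<in> K" "y = \<phi> x" using \<phi>(2) by (auto simp: trace_zero_integers_def ring_of_integers_def)
    have "algebraic_int (\<psi> y)"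
      using y \<psi>(1) \<phi>(2)
      by (intro embedding_algebraic_int[OF field_of_degree_is_subfield[OF L], of \<psi> y])
        (simp_all add: trace_zero_integers_def ring_of_integers_def)
    then have "x \<in> trace_zero_integers K"
      using y x \<psi>(2)[OF x(1)] tr[OF x(1)] by (simp add: trace_zero_integers_def ring_of_integers_def)
    then show "y \<in> \<phi> ` trace_zero_integers K" using x(2) by blast
  next
    fix y assume "y \<in> \<phi> ` trace_zero_integers K"
    then obtain x where x: "x \<in> trace_zero_integers K" "y = \<phi> x" by blast
    then have xK: "x \<in> K" "algebraic_int x" by (auto simp: trace_zero_integers_def ring_of_integers_def)
    then show "y \<in> trace_zero_integers L"
      using x tr[OF xK(1)] embedding_algebraic_int[OF sub \<phi>(1) xK] \<phi>(2)
      by (auto simp: trace_zero_integers_def ring_of_integers_def)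
  qed
  fix g assume "g \<in> g_classes d K"
  then obtain f \<beta> \<gamma> where f: "g = SL2_class f" and basis: "Z_basis [\<beta>, \<gamma>] (trace_zero_integers K)"
    and scaled: "is_scaled_trace_form d K \<beta> \<gamma> f"
    by (auto simp: g_classes_def)
  have eq: "trace_zero_integers K = {of_int m * \<beta> + of_int n * \<gamma> | m n. True}"
    and ind: "\<And>m n. of_int m * \<beta> + of_int n * \<gamma> = 0 \<Longrightarrow> m = 0 \<and> n = 0"
    using basis by (simp_all add: Z_basis_pair_iff)
  have "of_int 1 * \<beta> + of_int 0 * \<gamma> \<in> trace_zero_integers K" "of_int 0 * \<beta> + of_int 1 * \<gamma> \<in> trace_zero_integers K"
    unfolding eq by blast+
  then have \<beta>\<gamma>: "\<beta> \<in> K" "\<gamma> \<in> K" by (simp_all add: trace_zero_integers_def ring_of_integers_def)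
  have lin: "\<phi> (of_int m * \<beta> + of_int n * \<gamma>) = of_int m * \<phi> \<beta> + of_int n * \<phi> \<gamma>" for m n
    using \<beta>\<gamma> K' by (simp add: simps)
  have in_K: "of_int m * \<beta> + of_int n * \<gamma> \<in> K" for m n using \<beta>\<gamma> K' by simp
  have "Z_basis [\<phi> \<beta>, \<phi> \<gamma>] (trace_zero_integers L)"
    unfolding Z_basis_pair_iff
  proof (intro conjI allI impI)
    fix m n assume "of_int m * \<phi> \<beta> + of_int n * \<phi> \<gamma> = 0"
    then have "\<phi> (of_int m * \<beta> + of_int n * \<gamma>) = \<phi> 0" by (simp add: lin simps)
    then have "of_int m * \<beta> + of_int n * \<gamma> = 0"
      using embedding_eq_iff[OF sub \<phi>(1) in_K K'(6)] by blast
    then show "m = 0" "n = 0" using ind by blast+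
  next
    show "trace_zero_integers L = {of_int m * \<phi> \<beta> + of_int n * \<phi> \<gamma> | m n. True}"
      unfolding tz eq lin[symmetric] by blast
  qed
  moreover have "is_scaled_trace_form d L (\<phi> \<beta>) (\<phi> \<gamma>) f"
  proof -
    have "trace_form L (of_int x * \<phi> \<beta> + of_int y * \<phi> \<gamma>) = trace_form K (of_int x * \<beta> + of_int y * \<gamma>)" for x y
      unfolding trace_form_def lin[symmetric] using tr[OF K'(12)[OF in_K]] by (simp add: simps in_K)
    then show ?thesis using scaled by (simp add: is_scaled_trace_form_def)
  qed
  ultimately show "g \<in> g_classes d L" unfolding g_classes_def f by blast
qed

lemma (in comm_group) generate_order3:
  assumes y: "y \<in> carrier G" "y \<noteq> \<one>" "y \<otimes> y \<otimes> y = \<one>"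
  shows "generate G {y} = {\<one>, y, inv y}" "card (generate G {y}) = 3"
proof -
  have yy: "y \<otimes> y = inv y" using y(1,3) inv_equality[of "y \<otimes> y" y] by simp
  have iyy: "inv y \<otimes> inv y = y" using yy y(1) inv_mult[of y y] by simp
  have "subgroup {\<one>, y, inv y} G"
    by (rule subgroupI) (use y(1) yy iyy in auto)
  then have "generate G {y} \<subseteq> {\<one>, y, inv y}" by (intro generate_subgroup_incl) auto
  moreover have "{\<one>, y, inv y} \<subseteq> generate G {y}"
    by (auto intro: generate.one generate.incl generate.inv)
  ultimately show eq: "generate G {y} = {\<one>, y, inv y}" by blast
  have "y \<noteq> inv y" using y yy by (metis r_inv)
  moreover have "inv y \<noteq> \<one>" using y by (metis inv_inv inv_one)
  ultimately show "card (generate G {y}) = 3" unfolding eq using y(2) by auto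
qed

lemma (in cubic_embeddings) trace_zero_multiple:
  assumes "z \<in> K"
  obtains x N t where "x \<in> OK0" "N > 0" "of_int (3 * N) * z = x + of_int t"
proof -
  obtain N where N: "N > 0" "of_int N * z \<in> OK" using integer_multiple[OF assms] .
  have "of_int (3 * N) * z = (3 * (of_int N * z) - of_int (int_trace (of_int N * z))) + of_int (int_trace (of_int N * z))"
    by (simp add: algebra_simps)
  then show ?thesis using that[OF three_times_minus_trace[OF N(2)] N(1)] by blast
qed

text \<open>Every element of \<open>K\<close> is a rational number plus a rational multiple of a
  trace-zero integer, and embeddings fix the rational numbers.\<close>

lemma cubic_image_determined:
  assumes K: "field_of_degree 3 K" and L: "is_subfield L" and \<sigma>: "is_embedding K \<sigma>" and \<tau>: "is_embedding L \<tau>"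
    and incl: "\<sigma> ` trace_zero_integers K \<subseteq> \<tau> ` trace_zero_integers L"
  shows "\<sigma> ` K \<subseteq> \<tau> ` L"
proof
  note K' = field_of_degree_is_subfield[OF K]
  obtain \<sigma>1 \<sigma>2 \<sigma>3 where "cubic_embeddings K \<sigma>1 \<sigma>2 \<sigma>3" using cubic_embeddings_exist[OF K] by metis
  then interpret cubic_embeddings K \<sigma>1 \<sigma>2 \<sigma>3 .
  fix y assume "y \<in> \<sigma> ` K"
  then obtain z where z: "z \<in> K" "y = \<sigma> z" by blast
  obtain x N t where x: "x \<in> trace_zero_integers K" "N > 0" "of_int (3 * N) * z = x + of_int t"
    using trace_zero_multiple[OF z(1)] by metis
  have xK: "x \<in> K" using x(1) by (simp add: trace_zero_integers_def ring_of_integers_def)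
  have "of_int (3 * N) * \<sigma> z = \<sigma> (of_int (3 * N) * z)"
    using z(1) K_closed by (simp only: embedding_simps[OF K' \<sigma>])
  then have y: "of_int (3 * N) * y = \<sigma> x + of_int t"
    unfolding x(3) z(2) using xK K_closed by (simp only: embedding_simps[OF K' \<sigma>])
  obtain u where u: "u \<in> trace_zero_integers L" "\<sigma> x = \<tau> u" using incl x(1) by blast
  have uL: "u \<in> L" using u(1) by (simp add: trace_zero_integers_def ring_of_integers_def)
  note L' = is_subfieldD[OF L]
  define v where "v = (u + of_int t) / of_int (3 * N)"
  have v: "v \<in> L" unfolding v_def using uL by (simp add: L')
  have "of_int (3 * N) * v = u + of_int t" using x(2) by (simp add: v_def)
  then have "\<tau> (of_int (3 * N) * v) = \<tau> (u + of_int t)" by (rule arg_cong)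
  then have "of_int (3 * N) * \<tau> v = \<tau> u + of_int t"
    using v uL L' by (simp only: embedding_simps[OF L \<tau>])
  then have "of_int (3 * N) * \<tau> v = of_int (3 * N) * y" using y u(2) by (simp only:)
  then have "y = \<tau> v" using x(2) by simp
  then show "y \<in> \<tau> ` L" using v by blast
qed

text \<open>Equal images of the trace-zero integers give equal image fields, and \<sigma> followed
  by the inverse of \<tau> is the isomorphism.\<close>

lemma isomorphic_if_trace_zero_images_eq:
  assumes K: "field_of_degree 3 K" and L: "field_of_degree 3 L" and \<sigma>: "is_embedding K \<sigma>" and \<tau>: "is_embedding L \<tau>"
    and eq: "\<sigma> ` trace_zero_integers K = \<tau> ` trace_zero_integers L"
  shows "isomorphic_fields K L"
proof -
  note K' = field_of_degree_is_subfield[OF K] and L' = field_of_degree_is_subfield[OF L]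
  have im: "\<sigma> ` K = \<tau> ` L"
    using cubic_image_determined[OF K L' \<sigma> \<tau>] cubic_image_determined[OF L K' \<tau> \<sigma>] eq by blast
  obtain \<psi> where \<psi>: "is_embedding (\<tau> ` L) \<psi>" "\<And>x. x \<in> L \<Longrightarrow> \<psi> (\<tau> x) = x"
    using embedding_inverse[OF L' \<tau>] by metis
  have "is_embedding K (\<psi> \<circ> \<sigma>)" using embedding_compose[OF \<sigma> _ \<psi>(1)] im by simp
  moreover have "(\<psi> \<circ> \<sigma>) ` K = L"
    unfolding image_comp[symmetric] im image_image using \<psi>(2) by simp
  ultimately show ?thesis using isomorphic_fields_iff_embedding[OF K'] by blast
qed

section \<open>Basis-free description of the resolvent lattice\<close>

context imag_quadratic
begin

text \<open>Resolvent lattices are tied to ideals by arbitrary complex factors. Between two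
  fractional ideals such a factor is a quotient of nonzero elements and therefore lies in
  \<open>F\<close>, so the ideal class of a lattice is well defined.\<close>

lemma scaled_same_class:
  assumes I: "I \<in> fracs" and J: "J \<in> fracs" and eq: "I = (*) c ` J"
  shows "cl I = cl J" "c \<in> F" "c \<noteq> 0"
proof -
  obtain x where x: "x \<in> I" "x \<noteq> 0" by (rule fracs_nonzero[OF I])
  then obtain y where y: "y \<in> J" "x = c * y" using eq by blast
  then have "c = x / y" using x(2) by auto
  then show c: "c \<in> F" using F_closed(8) fracsD(1)[OF I x(1)] fracsD(1)[OF J y(1)] by blast
  show c0: "c \<noteq> 0" using x y by auto
  show "cl I = cl J" unfolding eq by (rule cl_scale[OF J c c0])
qed

text \<open>The properties of the lattice of Lagrange resolvents of \<open>K\<close> that are independent of the chosen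
  basis of trace-zero integers.\<close>

definition resolvent_lattice :: "int \<Rightarrow> complex set \<Rightarrow> complex set \<Rightarrow> bool"
  where "resolvent_lattice d K \<Lambda> \<longleftrightarrow>
    \<Lambda> \<star> \<Lambda> \<star> \<Lambda> = (*) (of_int (3 * gcd 3 d)) ` three_ideal (gcd 3 d) d \<and>
    (\<forall>\<zeta>. \<zeta> ^ 3 = 1 \<longrightarrow> (\<exists>\<sigma>. is_embedding K \<sigma> \<and>
      \<sigma> ` trace_zero_integers K = (\<lambda>z. (\<zeta> * z + cnj (\<zeta> * z)) / 3) ` \<Lambda>)) \<and>
    (\<forall>\<beta> \<gamma> f. Z_basis [\<beta>, \<gamma>] (trace_zero_integers K) \<longrightarrow> is_scaled_trace_form d K \<beta> \<gamma> f \<longrightarrow>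
      form_disc f = D \<and> (\<exists>\<kappa>. \<kappa> \<noteq> 0 \<and> (\<Lambda> = (*) \<kappa> ` form_ideal f \<or> \<Lambda> = (*) \<kappa> ` cnj ` form_ideal f)))"

lemma resolvent_lattice_cube:
  "resolvent_lattice d K \<Lambda> \<Longrightarrow> \<Lambda> \<star> \<Lambda> \<star> \<Lambda> = (*) (of_int (3 * gcd 3 d)) ` three_ideal (gcd 3 d) d"
  unfolding resolvent_lattice_def by (elim conjE)

lemma resolvent_lattice_embedding:
  assumes "resolvent_lattice d K \<Lambda>" "\<zeta> ^ 3 = 1"
  obtains \<sigma> where "is_embedding K \<sigma>"
    "\<sigma> ` trace_zero_integers K = (\<lambda>z. (\<zeta> * z + cnj (\<zeta> * z)) / 3) ` \<Lambda>"
proof -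
  have "\<forall>\<zeta>. \<zeta> ^ 3 = 1 \<longrightarrow> (\<exists>\<sigma>. is_embedding K \<sigma> \<and>
      \<sigma> ` trace_zero_integers K = (\<lambda>z. (\<zeta> * z + cnj (\<zeta> * z)) / 3) ` \<Lambda>)"
    using assms(1) unfolding resolvent_lattice_def by (elim conjE)
  from mp[OF spec[OF this] assms(2)] show ?thesis by (elim exE conjE) (rule that)
qed

lemma resolvent_lattice_form:
  assumes "resolvent_lattice d K \<Lambda>" "Z_basis [\<beta>, \<gamma>] (trace_zero_integers K)" "is_scaled_trace_form d K \<beta> \<gamma> f"
  obtains \<kappa> J where "form_disc f = D" "\<kappa> \<noteq> 0" "J = form_ideal f \<or> J = cnj ` form_ideal f" "\<Lambda> = (*) \<kappa> ` J"
proof -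
  have "\<forall>\<beta> \<gamma> f. Z_basis [\<beta>, \<gamma>] (trace_zero_integers K) \<longrightarrow> is_scaled_trace_form d K \<beta> \<gamma> f \<longrightarrow>
      form_disc f = D \<and> (\<exists>\<kappa>. \<kappa> \<noteq> 0 \<and> (\<Lambda> = (*) \<kappa> ` form_ideal f \<or> \<Lambda> = (*) \<kappa> ` cnj ` form_ideal f))"
    using assms(1) unfolding resolvent_lattice_def by (elim conjE)
  from mp[OF mp[OF spec[OF spec[OF spec[OF this]]] assms(2)] assms(3)]
  obtain \<kappa> where "form_disc f = D" "\<kappa> \<noteq> 0" "\<Lambda> = (*) \<kappa> ` form_ideal f \<or> \<Lambda> = (*) \<kappa> ` cnj ` form_ideal f"
    by (elim exE conjE)
  then show ?thesis using that[of \<kappa> "form_ideal f"] that[of \<kappa> "cnj ` form_ideal f"] by (elim disjE) simp_all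
qed

end

lemma cubic_trace_basis_if_cubic_field:
  assumes "K \<in> cubic_fields d" "fund_disc d" "Z_basis [\<beta>, \<gamma>] (trace_zero_integers K)"
  obtains \<sigma>1 \<sigma>2 \<sigma>3 where "cubic_trace_basis K \<sigma>1 \<sigma>2 \<sigma>3 d \<beta> \<gamma>"
proof -
  obtain \<sigma>1 \<sigma>2 \<sigma>3 where "cubic_embeddings K \<sigma>1 \<sigma>2 \<sigma>3"
    using cubic_embeddings_exist assms(1) unfolding cubic_fields_def by (metis (lifting) mem_Collect_eq)
  then show ?thesis
    using that assms unfolding cubic_trace_basis_def cubic_trace_basis_axioms_def cubic_fields_def by blast
qed

lemma trace_zero_basis_exists:
  assumes "K \<in> cubic_fields d"
  obtains \<beta> \<gamma> where "Z_basis [\<beta>, \<gamma>] (trace_zero_integers K)"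
proof -
  obtain \<sigma>1 \<sigma>2 \<sigma>3 where "cubic_embeddings K \<sigma>1 \<sigma>2 \<sigma>3"
    using cubic_embeddings_exist assms(1) unfolding cubic_fields_def by (metis (lifting) mem_Collect_eq)
  then interpret cubic_embeddings K \<sigma>1 \<sigma>2 \<sigma>3 .
  show ?thesis using trace_zero_basis_exists that by metis
qed

text \<open>The condition \<open>d \<noteq> 1\<close> excludes \<open>D = - 3\<close>, the case in
  which the quadratic field has units of order 3.\<close>

locale scholz = imag_quadratic D for D +
  fixes d :: int
  assumes d: "fund_disc d" "d > 0" "d \<noteq> 1" and D_eq: "D = (- 3 * d) div (gcd 3 d)\<^sup>2"
begin

abbreviation "n \<equiv> gcd 3 d"
abbreviation "TI \<equiv> three_ideal n d"
abbreviation "E \<equiv> (*) (of_int (3 * n)) ` TI"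

lemmas n_cases = fund_disc_dual(3)[OF d(1), folded D_eq]

lemma nd: "n = 1 \<and> D = - 3 * d \<or> n = 3 \<and> d = - 3 * D" "d mod 4 \<in> {0, 1}"
  using n_cases d(1) by (auto simp: fund_disc_def)

lemma D_ne: "D \<noteq> - 3"
  using n_cases d(3) by auto

lemmas TI_frac = three_ideal_frac[OF nd]
lemmas TI_square = three_ideal_square[OF nd]
lemmas cnj_TI = cnj_three_ideal[OF nd]

lemma r_in: "of_int (3 * n) \<in> F" "(of_int (3 * n) :: complex) \<noteq> 0"
  by (rule F_closed(10)) simp

lemma E_frac: "E \<in> fracs"
  by (rule scale_frac[OF TI_frac r_in])

text \<open>The ideal \<open>TI\<close> has the same cube as every resolvent lattice, which makes it
  the lattice to compare with when the square of a class is assumed trivial.\<close>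

lemma TI_cube: "TI \<star> TI \<star> TI = E"
  unfolding TI_square ideal_prod_scale_left OF_prod[OF TI_frac] ..

lemma cnj_E: "cnj ` E = E"
  unfolding cnj_scale_image cnj_TI by simp

lemma quadratic_field_F: "quadratic_field (- 3 * d) = F"
proof -
  have "n\<^sup>2 * D = - 3 * d" unfolding D_eq by (rule fund_disc_dual(1)[OF d(1)])
  then show ?thesis using quadratic_field_eq[of n] by simp
qed

lemma cl_TI_square: "cl TI \<otimes>\<^bsub>Cl\<^esub> cl TI = \<one>\<^bsub>Cl\<^esub>"
  unfolding cl_mult[OF TI_frac TI_frac] TI_square cl_scale[OF OF_frac r_in] by (rule cl_one)

lemma resolvent_lattice_exists:
  assumes K: "K \<in> cubic_fields d"
  obtains \<Lambda> where "resolvent_lattice d K \<Lambda>"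
proof -
  obtain \<sigma>1 \<sigma>2 \<sigma>3 where emb: "cubic_embeddings K \<sigma>1 \<sigma>2 \<sigma>3"
    and real: "\<forall>x\<in>K. \<sigma>1 x \<in> \<real>" "\<forall>x\<in>K. \<sigma>2 x \<in> \<real>" "\<forall>x\<in>K. \<sigma>3 x \<in> \<real>"
    using real_embeddings_exist[OF K d(1,2)] by metis
  have res: "cubic_resolvent K \<sigma>1 \<sigma>2 \<sigma>3 d \<beta> \<gamma> D" if "Z_basis [\<beta>, \<gamma>] (trace_zero_integers K)" for \<beta> \<gamma>
    using emb real that K d(1) D_eq imag_quadratic_axioms
    unfolding cubic_resolvent_def cubic_resolvent_axioms_def cubic_trace_basis_def cubic_trace_basis_axioms_def
      cubic_fields_def by blast
  \<comment> \<open>The lattice is built from \<open>K\<close> and the embeddings alone, so one and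
    the same \<Lambda> serves for every basis \<beta>, \<gamma>.\<close>
  define \<Lambda> where "\<Lambda> = cubic_resolvent.\<Lambda> K \<sigma>1 \<sigma>2 \<sigma>3"
  obtain \<beta>0 \<gamma>0 where b0: "Z_basis [\<beta>0, \<gamma>0] (trace_zero_integers K)" using trace_zero_basis_exists[OF K] .
  have "resolvent_lattice d K \<Lambda>"
    unfolding resolvent_lattice_def
  proof (intro conjI allI impI)
    show "\<Lambda> \<star> \<Lambda> \<star> \<Lambda> = E" unfolding \<Lambda>_def by (rule cubic_resolvent.\<Lambda>_cube[OF res[OF b0]])
  next
    fix \<zeta> :: complex assume "\<zeta> ^ 3 = 1"
    then show "\<exists>\<sigma>. is_embedding K \<sigma> \<and> \<sigma> ` trace_zero_integers K = (\<lambda>z. (\<zeta> * z + cnj (\<zeta> * z)) / 3) ` \<Lambda>"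
      unfolding \<Lambda>_def by (rule cubic_resolvent.\<Lambda>_real_part[OF res[OF b0]])
  next
    fix \<beta> \<gamma> f assume b: "Z_basis [\<beta>, \<gamma>] (trace_zero_integers K)" and f: "is_scaled_trace_form d K \<beta> \<gamma> f"
    obtain \<kappa> where \<kappa>: "\<kappa> \<noteq> 0" "form_disc f = D"
      "\<Lambda> = (*) \<kappa> ` form_ideal f \<or> \<Lambda> = (*) \<kappa> ` cnj ` form_ideal f"
      "\<Lambda> \<star> cnj ` \<Lambda> = (*) (of_int (3 * n)) ` OF"
      unfolding \<Lambda>_def by (rule cubic_resolvent.\<Lambda>_form_ideal[OF res[OF b] f])
    show "form_disc f = D" by (rule \<kappa>(2))
    show "\<exists>\<kappa>. \<kappa> \<noteq> 0 \<and> (\<Lambda> = (*) \<kappa> ` form_ideal f \<or> \<Lambda> = (*) \<kappa> ` cnj ` form_ideal f)"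
      by (intro exI[of _ \<kappa>] conjI \<kappa>(1,3))
  qed
  then show ?thesis by (rule that)
qed

lemma resolvent_lattice_frac:
  assumes K: "K \<in> cubic_fields d" and \<Lambda>: "resolvent_lattice d K \<Lambda>"
  obtains \<kappa> I where "\<kappa> \<noteq> 0" "I \<in> fracs" "\<Lambda> = (*) \<kappa> ` I"
proof -
  obtain \<beta> \<gamma> where b: "Z_basis [\<beta>, \<gamma>] (trace_zero_integers K)" using trace_zero_basis_exists[OF K] .
  obtain \<sigma>1 \<sigma>2 \<sigma>3 where "cubic_trace_basis K \<sigma>1 \<sigma>2 \<sigma>3 d \<beta> \<gamma>"
    using cubic_trace_basis_if_cubic_field[OF K d(1) b] .
  then obtain f where f: "is_scaled_trace_form d K \<beta> \<gamma> f" using cubic_trace_basis.is_scaled_trace_form_scaled_form by blast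
  obtain \<kappa> J where J: "form_disc f = D" "\<kappa> \<noteq> 0" "J = form_ideal f \<or> J = cnj ` form_ideal f" "\<Lambda> = (*) \<kappa> ` J"
    by (rule resolvent_lattice_form[OF \<Lambda> b f])
  have "J \<in> fracs" using J(3) form_ideal_frac[OF J(1)] cnj_frac[OF form_ideal_frac[OF J(1)]] by (elim disjE) simp_all
  then show ?thesis by (rule that[OF J(2) _ J(4)])
qed

lemma resolvent_class_cube:
  assumes \<Lambda>: "resolvent_lattice d K \<Lambda>" and I: "I \<in> fracs" "\<kappa> \<noteq> 0" "\<Lambda> = (*) \<kappa> ` I"
  shows "cl I \<otimes>\<^bsub>Cl\<^esub> cl I \<otimes>\<^bsub>Cl\<^esub> cl I = cl TI"
proof -
  have "(*) (\<kappa> * \<kappa> * \<kappa>) ` (I \<star> I \<star> I) = E"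
    using resolvent_lattice_cube[OF \<Lambda>] unfolding I(3) ideal_prod_scale_left ideal_prod_scale_right scale_scale
    by (simp only: mult.assoc)
  then have "I \<star> I \<star> I = (*) (1 / (\<kappa> * \<kappa> * \<kappa>) * of_int (3 * n)) ` TI"
    using I(2) by (subst (asm) scale_eq_iff) (simp_all only: scale_scale mult_eq_0_iff simp_thms)
  then have "cl (I \<star> I \<star> I) = cl TI" by (rule scaled_same_class(1)[OF ideal_prod_frac[OF ideal_prod_frac[OF I(1,1)] I(1)] TI_frac])
  then show ?thesis using I(1) by (simp add: cl_mult ideal_prod_frac)
qed

text \<open>If the resolvent lattice were a multiple of \<open>TI\<close>, then it would contain \<open>3\<close> up to a cube root of
  unity, and this is the resolvent of an element with conjugate \<open>2\<close>.\<close>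

lemma resolvent_class_square_nontrivial:
  assumes K: "K \<in> cubic_fields d" and \<Lambda>: "resolvent_lattice d K \<Lambda>" and I: "I \<in> fracs" "\<kappa> \<noteq> 0" "\<Lambda> = (*) \<kappa> ` I"
  shows "cl I \<otimes>\<^bsub>Cl\<^esub> cl I \<noteq> \<one>\<^bsub>Cl\<^esub>"
proof
  assume "cl I \<otimes>\<^bsub>Cl\<^esub> cl I = \<one>\<^bsub>Cl\<^esub>"
  \<comment> \<open>A class with trivial square equals its own cube.\<close>
  then have "cl I = cl TI" using resolvent_class_cube[OF \<Lambda> I] cl_in[OF I(1)] by simp
  then obtain x where x: "x \<in> F" "x \<noteq> 0" "I = (*) x ` TI" using cl_eq_iff[OF I(1) TI_frac] by blast
  have L: "\<Lambda> = (*) (\<kappa> * x) ` TI" unfolding I(3) x(3) scale_scale ..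
  note cube = resolvent_lattice_cube[OF \<Lambda>]
  obtain \<zeta> where \<zeta>: "\<zeta> ^ 3 = 1" "\<Lambda> = (*) \<zeta> ` TI"
    by (rule cube_equal_imp_root_of_unity[OF D_ne TI_frac E_frac L scale_one[symmetric] cube TI_cube])
  have z3: "\<zeta> * 3 \<in> \<Lambda>" unfolding \<zeta>(2) using three_in_three_ideal[OF nd] by blast
  have \<zeta>0: "\<zeta> \<noteq> 0" using \<zeta>(1) by auto
  have "(1 / \<zeta>) ^ 3 = 1" using \<zeta>(1) by (simp add: power_divide)
  then obtain \<sigma> where \<sigma>: "is_embedding K \<sigma>"
    "\<sigma> ` trace_zero_integers K = (\<lambda>z. (1 / \<zeta> * z + cnj (1 / \<zeta> * z)) / 3) ` \<Lambda>"
    by (rule resolvent_lattice_embedding[OF \<Lambda>])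
  have "(1 / \<zeta> * (\<zeta> * 3) + cnj (1 / \<zeta> * (\<zeta> * 3))) / 3 \<in> \<sigma> ` trace_zero_integers K"
    unfolding \<sigma>(2) using z3 by blast
  moreover have "(1 / \<zeta> * (\<zeta> * 3) + cnj (1 / \<zeta> * (\<zeta> * 3))) / 3 = 2" using \<zeta>0 by simp
  ultimately obtain y where y: "y \<in> trace_zero_integers K" "\<sigma> y = 2" by force
  have deg: "field_of_degree 3 K" using K by (simp add: cubic_fields_def)
  note sub = field_of_degree_is_subfield[OF deg]
  have yK: "y \<in> K" using y(1) by (simp add: trace_zero_integers_def ring_of_integers_def)
  have "\<sigma> y = \<sigma> 2" using y(2) by (simp add: embedding_simps[OF sub \<sigma>(1)])
  then have "y = 2" using embedding_eq_iff[OF sub \<sigma>(1) yK is_subfieldD(13)[OF sub]] by blast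
  then have "field_trace K (of_int 2 * 1) = 0" using y(1) by (simp add: trace_zero_integers_def)
  then show False
    using field_trace_scale_int[OF deg is_subfieldD(1)[OF sub], of 2] field_trace_one[OF deg] by simp
qed

text \<open>Regrouping, the cube of the square is the square of the cube, that is, the square of the
  class of \<open>TI\<close>.\<close>

lemma resolvent_class_square_cube:
  assumes \<Lambda>: "resolvent_lattice d K \<Lambda>" and I: "I \<in> fracs" "\<kappa> \<noteq> 0" "\<Lambda> = (*) \<kappa> ` I"
  defines "y \<equiv> cl I \<otimes>\<^bsub>Cl\<^esub> cl I"
  shows "y \<otimes>\<^bsub>Cl\<^esub> y \<otimes>\<^bsub>Cl\<^esub> y = \<one>\<^bsub>Cl\<^esub>"
proof -
  have c: "cl I \<in> carrier Cl" by (rule cl_in[OF I(1)])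
  have "y \<otimes>\<^bsub>Cl\<^esub> y \<otimes>\<^bsub>Cl\<^esub> y = (cl I \<otimes>\<^bsub>Cl\<^esub> cl I \<otimes>\<^bsub>Cl\<^esub> cl I) \<otimes>\<^bsub>Cl\<^esub> (cl I \<otimes>\<^bsub>Cl\<^esub> cl I \<otimes>\<^bsub>Cl\<^esub> cl I)"
    unfolding y_def using c by (simp add: Cl.m_assoc)
  then show ?thesis unfolding resolvent_class_cube[OF \<Lambda> I] cl_TI_square .
qed

text \<open>Independence of the basis: any choice gives a form whose ideal class is that of the
  lattice or its inverse, according to the orientation, and inverse elements generate the same
  subgroup.\<close>

lemma square_subgroup_eq:
  assumes K: "K \<in> cubic_fields d" and \<Lambda>: "resolvent_lattice d K \<Lambda>" and I: "I \<in> fracs" "\<kappa> \<noteq> 0" "\<Lambda> = (*) \<kappa> ` I"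
    and g: "g \<in> g_classes d K"
  shows "square_subgroup d g = generate Cl {cl I \<otimes>\<^bsub>Cl\<^esub> cl I}"
proof -
  obtain f \<beta> \<gamma> where f: "g = SL2_class f" and b: "Z_basis [\<beta>, \<gamma>] (trace_zero_integers K)"
    and scaled: "is_scaled_trace_form d K \<beta> \<gamma> f"
    using g by (auto simp: g_classes_def)
  obtain \<kappa>' J where disc: "form_disc f = D" and \<kappa>': "\<kappa>' \<noteq> 0"
    and J: "J = form_ideal f \<or> J = cnj ` form_ideal f" "\<Lambda> = (*) \<kappa>' ` J"
    by (rule resolvent_lattice_form[OF \<Lambda> b scaled])
  note If = form_ideal_frac[OF disc]
  have "J \<in> fracs" using J(1) If cnj_frac[OF If] by (elim disjE) simp_all
  moreover have "J = (*) (1 / \<kappa>' * \<kappa>) ` I"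
    unfolding scale_scale[symmetric] I(3)[symmetric] by (rule iffD1[OF scale_eq_iff[OF \<kappa>']]) (rule J(2)[symmetric])
  ultimately have same: "cl J = cl I" by (rule scaled_same_class(1)[OF _ I(1)])
  define c where "c = cl (form_ideal f)"
  have c: "c \<in> carrier Cl" unfolding c_def by (rule cl_in[OF If])
  have cI: "cl I \<in> carrier Cl" by (rule cl_in[OF I(1)])
  define y where "y = cl I \<otimes>\<^bsub>Cl\<^esub> cl I"
  have y: "y \<in> carrier Cl" "y \<noteq> \<one>\<^bsub>Cl\<^esub>" "y \<otimes>\<^bsub>Cl\<^esub> y \<otimes>\<^bsub>Cl\<^esub> y = \<one>\<^bsub>Cl\<^esub>"
    unfolding y_def using cI resolvent_class_square_nontrivial[OF K \<Lambda> I] resolvent_class_square_cube[OF \<Lambda> I] by simp_all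
  have "c = cl I \<or> inv\<^bsub>Cl\<^esub> c = cl I"
    using J(1) same cl_cnj[OF If] unfolding c_def by (elim disjE) simp_all
  then have "c = cl I \<or> c = inv\<^bsub>Cl\<^esub> (cl I)" using c Cl.inv_inv by metis
  then have cc: "c \<otimes>\<^bsub>Cl\<^esub> c = y \<or> c \<otimes>\<^bsub>Cl\<^esub> c = inv\<^bsub>Cl\<^esub> y"
    unfolding y_def using Cl.inv_mult[OF cI cI] by auto
  have iy: "inv\<^bsub>Cl\<^esub> y \<in> carrier Cl" "inv\<^bsub>Cl\<^esub> y \<noteq> \<one>\<^bsub>Cl\<^esub>"
    "inv\<^bsub>Cl\<^esub> y \<otimes>\<^bsub>Cl\<^esub> inv\<^bsub>Cl\<^esub> y \<otimes>\<^bsub>Cl\<^esub> inv\<^bsub>Cl\<^esub> y = \<one>\<^bsub>Cl\<^esub>"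
  proof -
    show "inv\<^bsub>Cl\<^esub> y \<in> carrier Cl" using y by simp
    show "inv\<^bsub>Cl\<^esub> y \<noteq> \<one>\<^bsub>Cl\<^esub>" using y(1,2) Cl.inv_inv Cl.inv_one by metis
    show "inv\<^bsub>Cl\<^esub> y \<otimes>\<^bsub>Cl\<^esub> inv\<^bsub>Cl\<^esub> y \<otimes>\<^bsub>Cl\<^esub> inv\<^bsub>Cl\<^esub> y = \<one>\<^bsub>Cl\<^esub>"
      using y(1,3) Cl.inv_mult Cl.inv_one Cl.m_closed by metis
  qed
  have "generate Cl {inv\<^bsub>Cl\<^esub> y} = generate Cl {y}"
    unfolding Cl.generate_order3(1)[OF y] Cl.generate_order3(1)[OF iy] using y(1) by auto
  then have "generate Cl {c \<otimes>\<^bsub>Cl\<^esub> c} = generate Cl {y}" using cc by auto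
  moreover have "square_subgroup d g = generate Cl {c [^]\<^bsub>Cl\<^esub> (2::nat)}"
    unfolding square_subgroup_def Let_def quadratic_field_F f gauss_class_SL2_class[OF disc] c_def ..
  moreover have "c [^]\<^bsub>Cl\<^esub> (2::nat) = c \<otimes>\<^bsub>Cl\<^esub> c" using c by (simp add: numeral_2_eq_2)
  ultimately show ?thesis unfolding y_def by simp
qed

text \<open>Once the factor is reduced to a cube root of unity \<zeta>, the real parts that give an
  embedding of \<open>K\<close> on \<Lambda> are those of \<open>\<zeta> * z\<close> for
  \<open>z\<close> in \<open>M'\<close>. If \<open>M'\<close> is the conjugate of \<open>M\<close>,
  then \<open>\<zeta> * cnj z\<close> has the same real part as \<open>cnj \<zeta> * z\<close>, so
  an embedding of \<open>L\<close> appears in this case too.\<close>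

lemma isomorphic_if_resolvent_lattices_proportional:
  assumes K: "K \<in> cubic_fields d" and L: "L \<in> cubic_fields d"
    and \<Lambda>: "resolvent_lattice d K \<Lambda>" and M: "resolvent_lattice d L M"
    and I: "I \<in> fracs" and eq: "\<Lambda> = (*) \<mu> ` M'" "M' = (*) \<kappa> ` I" "M' = M \<or> M' = cnj ` M"
  shows "isomorphic_fields K L"
proof -
  have deg: "field_of_degree 3 K" "field_of_degree 3 L" using K L by (auto simp: cubic_fields_def)
  note cubes = resolvent_lattice_cube[OF \<Lambda>] resolvent_lattice_cube[OF M]
  have "cnj ` (M \<star> M \<star> M) = E" unfolding cubes(2) by (rule cnj_E)
  then have M'3: "M' \<star> M' \<star> M' = E" using eq(3) cubes(2) unfolding cnj_ideal_prod by (elim disjE) simp_all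
  obtain \<zeta> where \<zeta>: "\<zeta> ^ 3 = 1" "\<Lambda> = (*) \<zeta> ` M'"
    by (rule cube_equal_imp_root_of_unity[OF D_ne I E_frac eq(1,2) cubes(1) M'3])
  obtain \<sigma> where \<sigma>: "is_embedding K \<sigma>"
    "\<sigma> ` trace_zero_integers K = (\<lambda>z. (1 * z + cnj (1 * z)) / 3) ` \<Lambda>"
    by (rule resolvent_lattice_embedding[OF \<Lambda> power_one])
  have "cnj \<zeta> ^ 3 = 1" using \<zeta>(1) by (metis complex_cnj_one complex_cnj_power)
  obtain \<tau>1 where \<tau>1: "is_embedding L \<tau>1" "\<tau>1 ` trace_zero_integers L = (\<lambda>z. (\<zeta> * z + cnj (\<zeta> * z)) / 3) ` M"
    by (rule resolvent_lattice_embedding[OF M \<zeta>(1)])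
  obtain \<tau>2 where \<tau>2: "is_embedding L \<tau>2" "\<tau>2 ` trace_zero_integers L = (\<lambda>z. (cnj \<zeta> * z + cnj (cnj \<zeta> * z)) / 3) ` M"
    by (rule resolvent_lattice_embedding[OF M \<open>cnj \<zeta> ^ 3 = 1\<close>])
  show ?thesis
    using eq(3)
  proof
    assume "M' = M"
    then have "\<sigma> ` trace_zero_integers K = \<tau>1 ` trace_zero_integers L"
      unfolding \<sigma>(2) \<tau>1(2) \<zeta>(2) by (simp add: image_image)
    then show ?thesis by (rule isomorphic_if_trace_zero_images_eq[OF deg \<sigma>(1) \<tau>1(1)])
  next
    assume "M' = cnj ` M"
    then have "\<sigma> ` trace_zero_integers K = \<tau>2 ` trace_zero_integers L"
      unfolding \<sigma>(2) \<tau>2(2) \<zeta>(2) by (simp add: image_image add.commute)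
    then show ?thesis by (rule isomorphic_if_trace_zero_images_eq[OF deg \<sigma>(1) \<tau>2(1)])
  qed
qed

text \<open>Equal subgroups of order 3 make the square of \<open>y\<close> equal to that of
  \<open>x\<close> or to its inverse. Both classes have the cube \<open>p\<close>, which is its own
  inverse, so each is recovered from its square and \<open>y\<close> is \<open>x\<close> or its
  inverse. The inverse corresponds to the conjugate lattice.\<close>

lemma isomorphic_if_generate_eq:
  assumes K: "K \<in> cubic_fields d" and L: "L \<in> cubic_fields d"
    and \<Lambda>: "resolvent_lattice d K \<Lambda>" and M: "resolvent_lattice d L M"
    and I: "I \<in> fracs" "\<kappa> \<noteq> 0" "\<Lambda> = (*) \<kappa> ` I" and J: "J \<in> fracs" "\<kappa>' \<noteq> 0" "M = (*) \<kappa>' ` J"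
    and gen: "generate Cl {cl I \<otimes>\<^bsub>Cl\<^esub> cl I} = generate Cl {cl J \<otimes>\<^bsub>Cl\<^esub> cl J}"
  shows "isomorphic_fields K L"
proof -
  define x y where "x = cl I" and "y = cl J"
  have xy: "x \<in> carrier Cl" "y \<in> carrier Cl" using cl_in I(1) J(1) by (auto simp: x_def y_def)
  define p where "p = cl TI"
  have x3: "x \<otimes>\<^bsub>Cl\<^esub> x \<otimes>\<^bsub>Cl\<^esub> x = p" and y3: "y \<otimes>\<^bsub>Cl\<^esub> y \<otimes>\<^bsub>Cl\<^esub> y = p"
    unfolding x_def y_def p_def using resolvent_class_cube[OF \<Lambda> I] resolvent_class_cube[OF M J] by simp_all
  have pc: "p \<in> carrier Cl" unfolding p_def by (rule cl_in[OF TI_frac])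
  have pp: "p \<otimes>\<^bsub>Cl\<^esub> p = \<one>\<^bsub>Cl\<^esub>" unfolding p_def by (rule cl_TI_square)
  have ip: "inv\<^bsub>Cl\<^esub> p = p" using Cl.inv_equality[OF pp pc pc] .
  have sx: "x \<otimes>\<^bsub>Cl\<^esub> x \<in> carrier Cl" "x \<otimes>\<^bsub>Cl\<^esub> x \<noteq> \<one>\<^bsub>Cl\<^esub>"
    "(x \<otimes>\<^bsub>Cl\<^esub> x) \<otimes>\<^bsub>Cl\<^esub> (x \<otimes>\<^bsub>Cl\<^esub> x) \<otimes>\<^bsub>Cl\<^esub> (x \<otimes>\<^bsub>Cl\<^esub> x) = \<one>\<^bsub>Cl\<^esub>"
    unfolding x_def using cl_in[OF I(1)] resolvent_class_square_nontrivial[OF K \<Lambda> I] resolvent_class_square_cube[OF \<Lambda> I] by simp_all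
  have sy: "y \<otimes>\<^bsub>Cl\<^esub> y \<noteq> \<one>\<^bsub>Cl\<^esub>"
    unfolding y_def using resolvent_class_square_nontrivial[OF L M J] .
  have "y \<otimes>\<^bsub>Cl\<^esub> y \<in> generate Cl {y \<otimes>\<^bsub>Cl\<^esub> y}" by (rule generate.incl) simp
  then have "y \<otimes>\<^bsub>Cl\<^esub> y \<in> generate Cl {x \<otimes>\<^bsub>Cl\<^esub> x}" using gen by (simp add: x_def y_def)
  then have cases: "y \<otimes>\<^bsub>Cl\<^esub> y = x \<otimes>\<^bsub>Cl\<^esub> x \<or> y \<otimes>\<^bsub>Cl\<^esub> y = inv\<^bsub>Cl\<^esub> (x \<otimes>\<^bsub>Cl\<^esub> x)"
    unfolding Cl.generate_order3(1)[OF sx] using sy by blast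
  have root: "z = inv\<^bsub>Cl\<^esub> (z \<otimes>\<^bsub>Cl\<^esub> z) \<otimes>\<^bsub>Cl\<^esub> p" if "z \<in> carrier Cl" "z \<otimes>\<^bsub>Cl\<^esub> z \<otimes>\<^bsub>Cl\<^esub> z = p" for z
    unfolding that(2)[symmetric] using that(1)
      Cl.m_assoc[OF Cl.inv_closed[OF Cl.m_closed] Cl.m_closed, OF that(1,1,1,1,1), symmetric] by simp
  have "y = x \<or> y = inv\<^bsub>Cl\<^esub> x"
    using cases
  proof
    assume "y \<otimes>\<^bsub>Cl\<^esub> y = x \<otimes>\<^bsub>Cl\<^esub> x"
    then have "y = x" using root[OF xy(1) x3] root[OF xy(2) y3] by simp
    then show ?thesis by simp
  next
    assume eq: "y \<otimes>\<^bsub>Cl\<^esub> y = inv\<^bsub>Cl\<^esub> (x \<otimes>\<^bsub>Cl\<^esub> x)"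
    have "y = x \<otimes>\<^bsub>Cl\<^esub> x \<otimes>\<^bsub>Cl\<^esub> p" using root[OF xy(2) y3] unfolding eq Cl.inv_inv[OF sx(1)] .
    moreover have "inv\<^bsub>Cl\<^esub> x = inv\<^bsub>Cl\<^esub> (inv\<^bsub>Cl\<^esub> (x \<otimes>\<^bsub>Cl\<^esub> x) \<otimes>\<^bsub>Cl\<^esub> p)" using root[OF xy(1) x3] by simp
    then have "inv\<^bsub>Cl\<^esub> x = x \<otimes>\<^bsub>Cl\<^esub> x \<otimes>\<^bsub>Cl\<^esub> p"
      using Cl.inv_mult[OF Cl.inv_closed[OF sx(1)] pc] ip Cl.inv_inv[OF sx(1)] by simp
    ultimately show ?thesis by simp
  qed
  then have "\<exists>J' M'. J' \<in> fracs \<and> cl I = cl J' \<and> (\<exists>c. c \<noteq> 0 \<and> M' = (*) c ` J') \<and> (M' = M \<or> M' = cnj ` M)"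
  proof
    assume "y = x"
    then show ?thesis using J x_def y_def by (intro exI[of _ J] exI[of _ M]) auto
  next
    assume "y = inv\<^bsub>Cl\<^esub> x"
    then have "x = inv\<^bsub>Cl\<^esub> y" using xy by simp
    then have "cl I = cl (cnj ` J)" unfolding cl_cnj[OF J(1)] x_def y_def .
    moreover have "cnj ` M = (*) (cnj \<kappa>') ` cnj ` J" unfolding J(3) by (rule cnj_scale_image)
    ultimately show ?thesis using cnj_frac[OF J(1)] J(2)
      by (intro exI[of _ "cnj ` J"] exI[of _ "cnj ` M"]) (auto intro!: exI[of _ "cnj \<kappa>'"])
  qed
  then obtain J' M' c where J': "J' \<in> fracs" "cl I = cl J'" "c \<noteq> 0" "M' = (*) c ` J'" "M' = M \<or> M' = cnj ` M" by blast
  obtain z where z: "I = (*) z ` J'" using cl_eq_iff[OF I(1) J'(1)] J'(2) by blast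
  have "J' = (*) (1 / c) ` M'" using J'(3,4) scale_eq_iff[OF J'(3), of J' M'] by blast
  then have "\<Lambda> = (*) (\<kappa> * (z * (1 / c))) ` M'" unfolding I(3) z by (simp only: scale_scale mult.assoc)
  then show ?thesis
    by (rule isomorphic_if_resolvent_lattices_proportional[OF K L \<Lambda> M J'(1) _ J'(4,5)])
qed

end

theorem theorem6p8:
  fixes d :: int
  assumes "d > 0"
    and "fundamental_discriminant d"
    and "cubic_fields d \<noteq> {}"
  shows
    "(\<forall>K\<in>cubic_fields d.
        (\<exists>\<beta> \<gamma>. Z_basis [\<beta>, \<gamma>] (trace_zero_integers K)) \<and>
        (\<forall>\<beta> \<gamma>. Z_basis [\<beta>, \<gamma>] (trace_zero_integers K) \<longrightarrow>
          (\<exists>f. is_scaled_trace_form d K \<beta> \<gamma> f \<and> primitive_form f \<and>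
               form_disc f = (- 3 * d) div (gcd 3 d)\<^sup>2))) \<and>
     (\<forall>C\<in>cubic_field_classes d. \<exists>H. Theta_values d C = {H}) \<and>
     Theta d \<in> cubic_field_classes d \<rightarrow>
       order3_subgroups (class_group (quadratic_field (- 3 * d))) \<and>
     inj_on (Theta d) (cubic_field_classes d)"
proof -
  have fund: "fund_disc d" and d1: "d \<noteq> 1"
    using fundamental_discriminant_imp_fund_disc[OF assms(2)] by auto
  define D where "D = (- 3 * d) div (gcd 3 d)\<^sup>2"
  have nD: "(gcd 3 d)\<^sup>2 * D = - 3 * d" and fundD: "fund_disc D"
    unfolding D_def using fund_disc_dual(1,2)[OF fund] by simp_all
  have "D < 0"
  proof (rule ccontr)
    assume "\<not> D < 0"
    then have "(gcd 3 d)\<^sup>2 * D \<ge> 0" by simp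
    then show False using nD assms(1) by simp
  qed
  then interpret scholz D d
    by unfold_locales (use fund fundD assms(1) d1 D_def in auto)
  have deg: "field_of_degree 3 K" if "K \<in> cubic_fields d" for K using that by (simp add: cubic_fields_def)
  note sub = field_of_degree_is_subfield[OF deg]
  have forms: "\<exists>f. is_scaled_trace_form d K \<beta> \<gamma> f \<and> primitive_form f \<and> form_disc f = (- 3 * d) div (gcd 3 d)\<^sup>2"
    if K: "K \<in> cubic_fields d" and b: "Z_basis [\<beta>, \<gamma>] (trace_zero_integers K)" for K \<beta> \<gamma>
  proof -
    obtain \<sigma>1 \<sigma>2 \<sigma>3 where "cubic_trace_basis K \<sigma>1 \<sigma>2 \<sigma>3 d \<beta> \<gamma>"
      using cubic_trace_basis_if_cubic_field[OF K d(1) b] .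
    then interpret cb: cubic_trace_basis K \<sigma>1 \<sigma>2 \<sigma>3 d \<beta> \<gamma> .
    show ?thesis
      using cb.is_scaled_trace_form_scaled_form cb.scaled_form_primitive cb.scaled_form_disc by blast
  qed
  \<comment> \<open>Nonemptiness matters because \<open>Theta_values\<close> is a union of images;
    over empty sets of classes it would be empty instead of a singleton.\<close>
  have g_nonempty: "g_classes d K \<noteq> {}" if K: "K \<in> cubic_fields d" for K
  proof -
    obtain \<beta> \<gamma> where b: "Z_basis [\<beta>, \<gamma>] (trace_zero_integers K)" using trace_zero_basis_exists[OF K] .
    then show ?thesis using forms[OF K b] unfolding g_classes_def by blast
  qed
  define R where "R = {(K, L). K \<in> cubic_fields d \<and> L \<in> cubic_fields d \<and> isomorphic_fields K L}"
  have equiv: "equiv (cubic_fields d) R"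
  proof (rule equivI)
    show "refl_on (cubic_fields d) R"
      by (rule refl_onI) (use isomorphic_fields_refl sub in \<open>auto simp: R_def\<close>)
    show "sym R" by (rule symI) (use isomorphic_fields_sym sub in \<open>auto simp: R_def\<close>)
    show "trans R"
      by (rule transI) (use isomorphic_fields_trans sub in \<open>unfold R_def, blast\<close>)
  qed (auto simp: R_def)
  have classes: "cubic_field_classes d = cubic_fields d // R"
    by (simp add: cubic_field_classes_def R_def)
  have "\<exists>\<Lambda> \<kappa> I. resolvent_lattice d K \<Lambda> \<and> I \<in> fracs \<and> \<kappa> \<noteq> 0 \<and> \<Lambda> = (*) \<kappa> ` I" if K: "K \<in> cubic_fields d" for K
  proof -
    obtain \<Lambda> where \<Lambda>: "resolvent_lattice d K \<Lambda>" using resolvent_lattice_exists[OF K] .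
    then show ?thesis using resolvent_lattice_frac[OF K \<Lambda>] by metis
  qed
  then obtain Lat scal Id where data: "\<And>K. K \<in> cubic_fields d \<Longrightarrow> resolvent_lattice d K (Lat K)"
    "\<And>K. K \<in> cubic_fields d \<Longrightarrow> Id K \<in> fracs" "\<And>K. K \<in> cubic_fields d \<Longrightarrow> scal K \<noteq> 0"
    "\<And>K. K \<in> cubic_fields d \<Longrightarrow> Lat K = (*) (scal K) ` Id K"
    by metis
  \<comment> \<open>\<open>H K\<close> is computed from one chosen lattice and ideal for each
    \<open>K\<close>; by independence of the basis it is the value of \<Theta> on the whole class of
    \<open>K\<close>.\<close>
  define H where "H K = generate Cl {cl (Id K) \<otimes>\<^bsub>Cl\<^esub> cl (Id K)}" for K
  have H: "square_subgroup d g = H K" if K: "K \<in> cubic_fields d" and "g \<in> g_classes d K" for K g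
    unfolding H_def by (rule square_subgroup_eq[OF K data(1)[OF K] data(2)[OF K] data(3)[OF K] data(4)[OF K] that(2)])
  have vals: "Theta_values d (R `` {K}) = {H K}" if K: "K \<in> cubic_fields d" for K
  proof -
    have "square_subgroup d ` g_classes d L = {H K}" if "L \<in> R `` {K}" for L
    proof -
      have L: "L \<in> cubic_fields d" "isomorphic_fields K L" using that by (auto simp: R_def)
      have "g_classes d L \<subseteq> g_classes d K"
        by (rule g_classes_iso_subset[OF deg[OF L(1)] deg[OF K] isomorphic_fields_sym[OF sub[OF K] sub[OF L(1)] L(2)]])
      then show ?thesis using g_nonempty[OF L(1)] H[OF K] by auto
    qed
    moreover have "K \<in> R `` {K}" using equiv_class_self[OF equiv K] .
    ultimately show ?thesis unfolding Theta_values_def by blast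
  qed
  have Theta: "Theta d (R `` {K}) = H K" if "K \<in> cubic_fields d" for K
    unfolding Theta_def vals[OF that] by simp
  have order3: "H K \<in> order3_subgroups Cl" if K: "K \<in> cubic_fields d" for K
  proof -
    note dat = data(2)[OF K] data(3)[OF K] data(4)[OF K]
    have y: "cl (Id K) \<otimes>\<^bsub>Cl\<^esub> cl (Id K) \<in> carrier Cl" using cl_in[OF data(2)[OF K]] by simp
    show ?thesis
      unfolding order3_subgroups_def H_def
      using Cl.generate_is_subgroup[of "{cl (Id K) \<otimes>\<^bsub>Cl\<^esub> cl (Id K)}"] y
        Cl.generate_order3(2)[OF y resolvent_class_square_nontrivial[OF K data(1)[OF K] dat]
          resolvent_class_square_cube[OF data(1)[OF K] dat]]
      by simp
  qed
  have inj: "R `` {K} = R `` {L}" if K: "K \<in> cubic_fields d" and L: "L \<in> cubic_fields d" and eq: "H K = H L" for K L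
  proof -
    have "isomorphic_fields K L"
      by (rule isomorphic_if_generate_eq[OF K L data(1)[OF K] data(1)[OF L] data(2)[OF K] data(3)[OF K] data(4)[OF K]
            data(2)[OF L] data(3)[OF L] data(4)[OF L] eq[unfolded H_def]])
    then have "(K, L) \<in> R" using K L by (simp add: R_def)
    then show ?thesis by (rule equiv_class_eq[OF equiv])
  qed
  show ?thesis
    unfolding classes quadratic_field_F
  proof (intro conjI ballI allI impI)
    fix K assume K: "K \<in> cubic_fields d"
    show "\<exists>\<beta> \<gamma>. Z_basis [\<beta>, \<gamma>] (trace_zero_integers K)" using trace_zero_basis_exists[OF K] by metis
    fix \<beta> \<gamma> assume "Z_basis [\<beta>, \<gamma>] (trace_zero_integers K)"
    then show "\<exists>f. is_scaled_trace_form d K \<beta> \<gamma> f \<and> primitive_form f \<and> form_disc f = (- 3 * d) div (gcd 3 d)\<^sup>2"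
      by (rule forms[OF K])
  next
    fix C assume "C \<in> cubic_fields d // R"
    then obtain K where "K \<in> cubic_fields d" "C = R `` {K}" by (rule quotientE)
    then show "\<exists>H. Theta_values d C = {H}" using vals by blast
  next
    show "Theta d \<in> cubic_fields d // R \<rightarrow> order3_subgroups Cl"
    proof
      fix C assume "C \<in> cubic_fields d // R"
      then obtain K where K: "K \<in> cubic_fields d" "C = R `` {K}" by (rule quotientE)
      show "Theta d C \<in> order3_subgroups Cl" unfolding K(2) Theta[OF K(1)] by (rule order3[OF K(1)])
    qed
  next
    show "inj_on (Theta d) (cubic_fields d // R)"
    proof (rule inj_onI)
      fix C C' assume "C \<in> cubic_fields d // R" "C' \<in> cubic_fields d // R" and eq: "Theta d C = Theta d C'"
      then obtain K L where K: "K \<in> cubic_fields d" "C = R `` {K}" and L: "L \<in> cubic_fields d" "C' = R `` {L}"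
        by (metis quotientE)
      have "H K = H L" using eq unfolding K(2) L(2) Theta[OF K(1)] Theta[OF L(1)] .
      then show "C = C'" unfolding K(2) L(2) by (rule inj[OF K(1) L(1)])
    qed
  qed
qed

end
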